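(* Consider the production-inventory model described in the context, with optimal costs $V_0(b)$, $V_1$, $V_2$. For $i=1,2$ let $\{\pi_{x,i}\in\Pi_{x,i}:x\in[l,b)\}$ be a family of admissible strategies, and set $w_i(x):=V_i^{\pi_{x,i}}(x)$ for $x\in[l,b)$. Suppose that, for $\{i,j\}=\{1,2\}$, $w_i$ (extended to $b$ by continuity, being Lipschitz) is a viscosity supersolution, at every $x\in(l,b)$, of the respective Hamilton-Jacobi-Bellman equation, in the sense defined in the context (where the obstacle for $w_i$ is $V_j+K_{ij}$), and that the boundary conditions $$w_1(b)\le w_0(b)+K_{10},\qquad w_2(b)\le w_0(b)+K_{20}$$ hold, where $$w_0(b)=\frac{\lambda}{q+\lambda}\Big(\int_0^{b-l}\overline w(b-\alpha)dF(\alpha)+\int_{b-l}^\infty\big(p(\alpha-b+l)+\overline w(l)\big)dF(\alpha)\Big)+\frac{h_0(b)}{q+\lambda}$$ and $\overline w(x)=\min\{K_{01}+w_1(x),K_{02}+w_2(x)\}$. Then $w_0(b)=V_0(b)$ and $w_i=V_i$ for $i=1,2$.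
   Context: **Model.** Fix $l\le 0<b$ (minimum inventory level and storage capacity), production rates $0<\sigma_2<\sigma_1$, $\sigma_0=0$, a discount rate $q>0$, and a compound Poisson demand process $\sum_{n=1}^{N_t}Y_n$, where $N$ is a Poisson process of rate $\lambda>0$ with arrival times $\tau_1<\tau_2<\cdots$, and $Y_n$ are i.i.d. positive random variables, independent of $N$, with distribution function $F$ and finite mean. $(\mathcal F_t)$ is the filtration generated by the demand process. **Costs.** For $i=1,2$, $h_i:[l,b)\to[0,\infty)$ is bounded with finitely many discontinuities and is Lipschitz (constant $m_h$) between discontinuities; $h_0(b)\ge 0$ is a constant. $p:[0,\infty)\to[0,\infty)$ is non-decreasing with $\int_0^\infty p(y)\,dF(y)<\infty$. Switching costs $K_{ij}\ge 0$ ($i\ne j$ in $\{0,1,2\}$) satisfy $K_{0i}\le K_{0j}+K_{ji}$ for $\{i,j\}=\{1,2\}$ and $K_{12}+K_{21}>0$. **Strategies.** A production strategy starting from inventory level $x$ and phase $i$ is $\pi=(T_k,J_k)_{k\ge0}$ with $T_0=0$, $J_0=i$, where $T_1<T_2<\cdots$ are the switching times, $T_k$ being the time of the switch from phase $J_{k-1}$ to phase $J_k$, with $J_k\in\{0,1,2\}$ and $J_k\neq J_{k-1}$. The phase process is $\mathcal J_t=J_k$ for $t\in[T_k,T_{k+1})$. The inventory $X^\pi_t$ starts at $X^\pi_0=x$, grows at rate $\sigma_{\mathcal J_t}$ between demands, and at each $\tau_n$ jumps down by $\min\{Y_n,X^\pi_{\tau_n^-}-l\}$ (the part of the demand that would bring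 the inventory below $l$ is lost). $\pi$ is admissible ($\pi\in\Pi_{x,i}$) if it is $\mathcal F_t$-adapted and càdlàg and: whenever $X_t^\pi<b$, the phase is $1$ or $2$; whenever $X^\pi$ reaches $b$ in phase $1$ or $2$, at that time there is a mandatory switch to phase $0$, after which $X^\pi=b$ until the next demand arrival, which is the next switching time, at which the new phase is $1$ or $2$. Initial data are either $x\in[l,b)$, $i\in\{1,2\}$, or $x=b$, $i=0$. **Cost functions.** For $\pi\in\Pi_{x,i}$, $$V_i^\pi(x)=\mathbb E\Big[\int_0^\infty e^{-qt}h_{\mathcal J_t}(X_t^\pi)dt\Big]+\mathbb E\Big[\sum_{k\ge0}e^{-qT_{k+1}}K_{J_k,J_{k+1}}\Big]+\mathbb E\Big[\sum_{n\ge1}e^{-q\tau_n}1_{\{X^\pi_{\tau_n^-}-l<Y_n\}}\,p(Y_n-X^\pi_{\tau_n^-}+l)\Big]$$ (where $h_0$ is used at level $b$). The optimal costs are $V_i(x)=\inf_{\pi\in\Pi_{x,i}}V_i^\pi(x)$ for $i=1,2$, $x\in[l,b)$, and $V_0(b)=\inf_{\pi\in\Pi_{b,0}}V_0^\pi(b)$. **Operators.** For $i=1,2$, $$\mathcal L_i(u)(x)=\sigma_iu'(x)-(\lambda+q)u(x)+\lambda\int_0^{x-l}u(x-\alpha)dF(\alpha)+\lambda\int_{x-l}^\infty p(\alpha-x+l)dF(\alpha)+\lambda u(l)(1-F(x-l))+h_i(x).$$ Here, and in the formula for $w_0(b)$, integrals $\int_0^{x-l}$ include the endpoint $\alpha=x-l$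 and $\int_{x-l}^\infty$ exclude it. **Hamilton-Jacobi-Bellman equations and viscosity supersolutions.** For $\{i,j\}=\{1,2\}$ the equation for $V_i$ is $\min\{\mathcal L_i(V_i)(x),\,V_j(x)+K_{ij}-V_i(x)\}=0$, $x\in[l,b)$. A function $w_i:[l,b]\to\mathbb R$ is a viscosity supersolution of this equation at $x\in[l,b)$ if it is Lipschitz and every continuously differentiable $\varphi_i:[l,b]\to\mathbb R$ with $\varphi_i(x)=w_i(x)$ such that $w_i-\varphi_i$ attains its maximum at $x$ satisfies $\min\{\mathcal L_i(\varphi_i)(x),\,V_j(x)+K_{ij}-w_i(x)\}\ge0$, where $V_j$ is the optimal cost function of the other phase. *)

theory Defs
  imports "HOL-Probability.Probability"
begin

text \<open>
  The inventory lives in \<open>[lmin, cap]\<close>. Phases are the naturals 0, 1, 2 (0 is the idle phase at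
  full storage). The arrival sequence \<open>arr\<close> and the demand sizes \<open>dem\<close> are indexed from 1:
  \<open>arr P 0 = 0\<close> is a convention and not an arrival, and \<open>dem P 0\<close> is never used.
\<close>

record 'w inventory_model =
  lmin :: real
  cap :: real
  rate :: "nat \<Rightarrow> real"
  disc :: real
  lam :: real
  hold :: "nat \<Rightarrow> real \<Rightarrow> real"  \<comment> \<open>\<open>hold P 0\<close> matters only at \<open>cap P\<close>\<close>
  lip_hold :: real
  pen :: "real \<Rightarrow> real"
  swc :: "nat \<Rightarrow> nat \<Rightarrow> real"
  pspace :: "'w measure"
  arr :: "nat \<Rightarrow> 'w \<Rightarrow> real"
  dem :: "nat \<Rightarrow> 'w \<Rightarrow> real"
  dlaw :: "real measure"

definition hold_discont :: "('w, 'z) inventory_model_scheme \<Rightarrow> nat \<Rightarrow> real set" where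
  "hold_discont P i = {x \<in> {lmin P..<cap P}. \<not> continuous (at x within {lmin P..<cap P}) (hold P i)}"

text \<open>
  The Poisson process is given by its arrival times: the interarrival times are i.i.d. exponential,
  every path has strictly increasing arrival times and finitely many arrivals in bounded time.
  One joint independence condition covers the interarrival times and the demand sizes.
\<close>

locale production_inventory = prob_space "pspace P" for P :: "'w inventory_model" +
  assumes levels: "lmin P \<le> 0" "0 < cap P"
    and rates: "rate P 0 = 0" "0 < rate P 2" "rate P 2 < rate P 1"
    and disc_pos: "0 < disc P"
    and lam_pos: "0 < lam P"
    and arr_0: "\<And>\<omega>. \<omega> \<in> space (pspace P) \<Longrightarrow> arr P 0 \<omega> = 0"
    and arr_mono: "\<And>\<omega> n. \<omega> \<in> space (pspace P) \<Longrightarrow> arr P n \<omega> < arr P (Suc n) \<omega>"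
    and arr_unbounded: "\<And>\<omega>. \<omega> \<in> space (pspace P) \<Longrightarrow> filterlim (\<lambda>n. arr P n \<omega>) at_top sequentially"
    and arr_gaps: "\<And>n. distributed (pspace P) lborel (\<lambda>\<omega>. arr P (Suc n) \<omega> - arr P n \<omega>)
                          (exponential_density (lam P))"
    and dem_pos: "\<And>\<omega> n. \<omega> \<in> space (pspace P) \<Longrightarrow> 1 \<le> n \<Longrightarrow> 0 < dem P n \<omega>"
    and dem_law: "\<And>n. 1 \<le> n \<Longrightarrow> distr (pspace P) borel (dem P n) = dlaw P"
    and dem_mean: "integrable (dlaw P) (\<lambda>y. y)"
    and indep: "indep_vars (\<lambda>_. borel)
                  (case_sum (\<lambda>n \<omega>. arr P (Suc n) \<omega> - arr P n \<omega>) (\<lambda>n. dem P (Suc n))) UNIV"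
    and hold_nonneg: "\<And>i x. i \<in> {1, 2} \<Longrightarrow> x \<in> {lmin P..<cap P} \<Longrightarrow> 0 \<le> hold P i x"
    and hold_bounded: "\<And>i. i \<in> {1, 2} \<Longrightarrow> bounded (hold P i ` {lmin P..<cap P})"
    and hold_discont: "\<And>i. i \<in> {1, 2} \<Longrightarrow> finite (hold_discont P i)"
    and hold_lipschitz: "\<And>i x y. i \<in> {1, 2} \<Longrightarrow> lmin P \<le> x \<Longrightarrow> x < y \<Longrightarrow> y < cap P \<Longrightarrow>
            {x..y} \<inter> hold_discont P i = {} \<Longrightarrow> \<bar>hold P i x - hold P i y\<bar> \<le> lip_hold P * (y - x)"
    and hold_0: "0 \<le> hold P 0 (cap P)"
    and pen_nonneg: "\<And>y. 0 \<le> y \<Longrightarrow> 0 \<le> pen P y"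
    and pen_mono: "mono_on {0..} (pen P)"
    and pen_integrable: "set_integrable (dlaw P) {0..} (pen P)"
    and swc_nonneg: "\<And>i j. i \<in> {0, 1, 2} \<Longrightarrow> j \<in> {0, 1, 2} \<Longrightarrow> i \<noteq> j \<Longrightarrow> 0 \<le> swc P i j"
    and swc_triangle: "swc P 0 1 \<le> swc P 0 2 + swc P 2 1" "swc P 0 2 \<le> swc P 0 1 + swc P 1 2"
    and swc_pos: "0 < swc P 1 2 + swc P 2 1"

definition num_arrivals :: "('w, 'z) inventory_model_scheme \<Rightarrow> real \<Rightarrow> 'w \<Rightarrow> nat" where
  "num_arrivals P t \<omega> = card {n. 1 \<le> n \<and> arr P n \<omega> \<le> t}"

definition total_demand :: "('w, 'z) inventory_model_scheme \<Rightarrow> real \<Rightarrow> 'w \<Rightarrow> real" where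
  "total_demand P t \<omega> = (\<Sum>n = 1..num_arrivals P t \<omega>. dem P n \<omega>)"

definition demand_filtration :: "('w, 'z) inventory_model_scheme \<Rightarrow> real \<Rightarrow> 'w measure" where
  "demand_filtration P t = sigma (space (pspace P))
     {total_demand P s -` A \<inter> space (pspace P) | s A. 0 \<le> s \<and> s \<le> t \<and> A \<in> sets borel}"

text \<open>
  \<open>swtime S k\<close> and \<open>swphase S k\<close> are $T_k$ and $J_k$. A strategy with only finitely many switches on a
  path has \<open>swtime S k \<omega> = \<infinity>\<close> from some \<open>k\<close> on, and the phases attached to infinite times are irrelevant.
\<close>

record 'w strategy =
  swtime :: "nat \<Rightarrow> 'w \<Rightarrow> ereal"
  swphase :: "nat \<Rightarrow> 'w \<Rightarrow> nat"

definition phase :: "'w strategy \<Rightarrow> real \<Rightarrow> 'w \<Rightarrow> nat" where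
  "phase S t \<omega> = swphase S (LEAST k. ereal t < swtime S (Suc k) \<omega>) \<omega>"

definition produced ::
    "('w, 'z) inventory_model_scheme \<Rightarrow> 'w strategy \<Rightarrow> real \<Rightarrow> real \<Rightarrow> 'w \<Rightarrow> real" where
  "produced P S s t \<omega> = set_lebesgue_integral lborel {s..t} (\<lambda>u. rate P (phase S u \<omega>))"

text \<open>Inventory level at the \<open>n\<close>-th arrival, after the demand has been (partially) served.\<close>

primrec level_after ::
    "('w, 'z) inventory_model_scheme \<Rightarrow> 'w strategy \<Rightarrow> real \<Rightarrow> 'w \<Rightarrow> nat \<Rightarrow> real" where
  "level_after P S x \<omega> 0 = x"
| "level_after P S x \<omega> (Suc n) =
     (let z = level_after P S x \<omega> n + produced P S (arr P n \<omega>) (arr P (Suc n) \<omega>) \<omega>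
      in z - min (dem P (Suc n) \<omega>) (z - lmin P))"

text \<open>The left limit of the inventory at the \<open>n\<close>-th arrival, for \<open>n \<ge> 1\<close>.\<close>

definition level_before ::
    "('w, 'z) inventory_model_scheme \<Rightarrow> 'w strategy \<Rightarrow> real \<Rightarrow> 'w \<Rightarrow> nat \<Rightarrow> real" where
  "level_before P S x \<omega> n =
     level_after P S x \<omega> (n - 1) + produced P S (arr P (n - 1) \<omega>) (arr P n \<omega>) \<omega>"

definition inventory ::
    "('w, 'z) inventory_model_scheme \<Rightarrow> 'w strategy \<Rightarrow> real \<Rightarrow> real \<Rightarrow> 'w \<Rightarrow> real" where
  "inventory P S x t \<omega> =
     (let n = num_arrivals P t \<omega> in level_after P S x \<omega> n + produced P S (arr P n \<omega>) t \<omega>)"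

text \<open>
  Only $T_1 < T_2 < \dots$ is strict; $T_1 = T_0 = 0$ is an immediate switch. That the phase process
  is defined on the whole half line and cadlag amounts to $T_k \to \infty$ on every path. The switch
  to phase 0 at the time the storage fills up is the condition \<open>X = cap \<longrightarrow> phase = 0\<close>.
\<close>

definition admissible ::
    "('w, 'z) inventory_model_scheme \<Rightarrow> real \<Rightarrow> nat \<Rightarrow> 'w strategy set" where
  "admissible P x i = {S.
     (\<forall>t\<ge>0. phase S t \<in> measurable (demand_filtration P t) (count_space UNIV)) \<and>
     (\<forall>\<omega>\<in>space (pspace P).
        swtime S 0 \<omega> = 0 \<and> swphase S 0 \<omega> = i \<and>
        (\<forall>k. swtime S k \<omega> \<le> swtime S (Suc k) \<omega>) \<and>
        (\<forall>k\<ge>1. swtime S k \<omega> < \<infinity> \<longrightarrow> swtime S k \<omega> < swtime S (Suc k) \<omega>) \<and>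
        (\<forall>t::real. \<exists>k. ereal t < swtime S k \<omega>) \<and>
        (\<forall>k. swphase S k \<omega> \<in> {0, 1, 2}) \<and>
        (\<forall>k. swtime S (Suc k) \<omega> < \<infinity> \<longrightarrow> swphase S (Suc k) \<omega> \<noteq> swphase S k \<omega>) \<and>
        (\<forall>t\<ge>0. inventory P S x t \<omega> \<le> cap P \<and>
           (inventory P S x t \<omega> < cap P \<longrightarrow> phase S t \<omega> \<in> {1, 2}) \<and>
           (inventory P S x t \<omega> = cap P \<longrightarrow> phase S t \<omega> = 0)) \<and>
        (\<forall>k. \<forall>t. swtime S k \<omega> = ereal t \<and> swphase S k \<omega> = 0 \<longrightarrow>
           swtime S (Suc k) \<omega> = ereal (arr P (Suc (num_arrivals P t \<omega>)) \<omega>)))}"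

text \<open>The discount factor $e^{-qT}$, with value 0 at $T = \infty$.\<close>

definition disc_at :: "('w, 'z) inventory_model_scheme \<Rightarrow> ereal \<Rightarrow> real" where
  "disc_at P T = (if T = \<infinity> then 0 else exp (- disc P * real_of_ereal T))"

text \<open>All costs are nonnegative, so they are extended nonnegative integrals.\<close>

definition cost ::
    "('w, 'z) inventory_model_scheme \<Rightarrow> real \<Rightarrow> 'w strategy \<Rightarrow> ennreal" where
  "cost P x S =
     (\<integral>\<^sup>+\<omega>. (\<integral>\<^sup>+t\<in>{0..}. ennreal (exp (- disc P * t) *
          hold P (phase S t \<omega>) (inventory P S x t \<omega>)) \<partial>lborel) \<partial>pspace P)
   + (\<integral>\<^sup>+\<omega>. (\<Sum>k. ennreal (disc_at P (swtime S (Suc k) \<omega>) *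
          swc P (swphase S k \<omega>) (swphase S (Suc k) \<omega>))) \<partial>pspace P)
   + (\<integral>\<^sup>+\<omega>. (\<Sum>n. let z = level_before P S x \<omega> (Suc n) - lmin P; y = dem P (Suc n) \<omega> in
          ennreal (exp (- disc P * arr P (Suc n) \<omega>) * (if z < y then pen P (y - z) else 0))) \<partial>pspace P)"

definition opt_cost :: "('w, 'z) inventory_model_scheme \<Rightarrow> nat \<Rightarrow> real \<Rightarrow> ennreal" where
  "opt_cost P i x = (INF S\<in>admissible P x i. cost P x S)"

text \<open>
  The derivative is taken within \<open>[lmin, cap]\<close>, as test functions are only given there. The law
  \<open>dlaw\<close> plays the role of \<open>dF\<close>, with distribution function \<open>F = cdf dlaw\<close>.
\<close>

definition hjb_op ::
    "('w, 'z) inventory_model_scheme \<Rightarrow> nat \<Rightarrow> (real \<Rightarrow> real) \<Rightarrow> real \<Rightarrow> real" where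
  "hjb_op P i u x =
     rate P i * vector_derivative u (at x within {lmin P..cap P})
     - (lam P + disc P) * u x
     + lam P * set_lebesgue_integral (dlaw P) {0..x - lmin P} (\<lambda>a. u (x - a))
     + lam P * set_lebesgue_integral (dlaw P) {x - lmin P<..} (\<lambda>a. pen P (a - x + lmin P))
     + lam P * u (lmin P) * (1 - cdf (dlaw P) (x - lmin P))
     + hold P i x"

definition C1_on :: "real \<Rightarrow> real \<Rightarrow> (real \<Rightarrow> real) \<Rightarrow> bool" where
  "C1_on a b f \<longleftrightarrow> (\<exists>f'. continuous_on {a..b} f' \<and>
     (\<forall>x\<in>{a..b}. (f has_real_derivative f' x) (at x within {a..b})))"

text \<open>Supersolution at \<open>x\<close> of the equation for phase \<open>i\<close>, with obstacle the optimal cost of phase \<open>j\<close>.\<close>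

definition viscosity_supersolution_at ::
    "('w, 'z) inventory_model_scheme \<Rightarrow> nat \<Rightarrow> nat \<Rightarrow> (real \<Rightarrow> real) \<Rightarrow> real \<Rightarrow> bool" where
  "viscosity_supersolution_at P i j w x \<longleftrightarrow>
     (\<exists>L. L-lipschitz_on {lmin P..cap P} w) \<and>
     (\<forall>\<phi>. C1_on (lmin P) (cap P) \<phi> \<and> \<phi> x = w x \<and>
           (\<forall>y\<in>{lmin P..cap P}. w y - \<phi> y \<le> w x - \<phi> x) \<longrightarrow>
        min (hjb_op P i \<phi> x) (enn2real (opt_cost P j x) + swc P i j - w x) \<ge> 0)"

definition wbar ::
    "('w, 'z) inventory_model_scheme \<Rightarrow> (nat \<Rightarrow> real \<Rightarrow> real) \<Rightarrow> real \<Rightarrow> real" where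
  "wbar P w x = min (swc P 0 1 + w 1 x) (swc P 0 2 + w 2 x)"

definition w0_cap ::
    "('w, 'z) inventory_model_scheme \<Rightarrow> (nat \<Rightarrow> real \<Rightarrow> real) \<Rightarrow> real" where
  "w0_cap P w =
     lam P / (disc P + lam P) *
       (set_lebesgue_integral (dlaw P) {0..cap P - lmin P} (\<lambda>a. wbar P w (cap P - a))
        + set_lebesgue_integral (dlaw P) {cap P - lmin P<..}
            (\<lambda>a. pen P (a - cap P + lmin P) + wbar P w (lmin P)))
     + hold P 0 (cap P) / (disc P + lam P)"

end

theory Submission
  imports Defs
begin

text \<open>
  Given the past, an adapted strategy is a deterministic control between two consecutive demands.
  Test functions touch \<open>w i\<close> from above, so the supersolution property says that \<open>w i\<close> grows along such
  a control at least as fast as the equation prescribes; integrated, with the discount factor as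
  weight, it bounds \<open>w i\<close> at the start of a production period by the running cost plus the discounted
  \<open>w i\<close> at its end. Obstacle and boundary inequalities take care of the switches, the definition of
  \<open>w0_cap\<close> of the idle periods, and the compensator formula of the jumps. Summing up, \<open>w i\<close> and
  \<open>w0_cap\<close> are below the cost of every admissible strategy, whereas \<open>w i\<close> is itself a cost.

  That \<open>opt_cost P 0 (cap P)\<close> is at most \<open>w0_cap\<close> needs no time shift of strategies, for which the
  abstract probability space offers no room: as \<open>x\<close> tends to \<open>cap P\<close>, the strategy \<open>strat i x\<close> fills the storage
  before the first demand with probability tending to 1, and can be imitated from the first demand on
  by a strategy started at full storage. Hence the optimal cost $V_0$ at full storage satisfies
  $V_0 + \min(K_{i0}, K_{ij} + K_{j0}) \le w_i$ at \<open>cap P\<close> for $i = 1, 2$, and the boundary conditions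
  together with $w_1 \le w_2 + K_{12}$ give $V_0 \le w_0$.

  Switching costs are never shown to be measurable: they only enter through lower integrals.
\<close>

section \<open>Integrating viscosity inequalities\<close>

text \<open>The obstacle is a lack of regularity. \<open>w i\<close> is only Lipschitz, and the
  right-hand side of its equation is discontinuous: holding rates jump, and an atom of the demand
  law may make the mean shortfall jump as the level passes it. No chain rule along paths is at hand.
  But during production the level is affine in time with positive speed, so the equation becomes a
  one-dimensional viscosity inequality for an increment, and the countably many exceptional levels
  take no time. The obstacle in the supersolution property is an optimal cost. An infimum lies below
  each particular cost, so it may be replaced by \<open>w j\<close>; this closes the system of
  inequalities for the pair \<open>w 1\<close>, \<open>w 2\<close> before anything is known about
  the optimal costs. A competing strategy may have infinite cost, so expectations are taken in
  \<open>ennreal\<close>, where nothing can be subtracted. Signed terms are therefore shifted by a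
  constant whose discounted sum over all arrivals is finite, and the shift is cancelled at the very
  end.\<close>

lemma nn_integral_le_add_nonmeasurable:
  fixes f b g :: "'a \<Rightarrow> ennreal"
  assumes [measurable]: "f \<in> borel_measurable M" "g \<in> borel_measurable M"
    and le: "\<And>x. x \<in> space M \<Longrightarrow> f x \<le> b x + g x"
  shows "(\<integral>\<^sup>+x. f x \<partial>M) \<le> (\<integral>\<^sup>+x. b x \<partial>M) + (\<integral>\<^sup>+x. g x \<partial>M)"
proof -
  \<comment> \<open>The integral of the possibly nonmeasurable \<open>b\<close> is a lower integral.
    The difference of \<open>f\<close> and \<open>g\<close>, set to 0 where \<open>g\<close> is
    infinite, is a measurable function below \<open>b\<close>, and that is all a lower integral can
    see.\<close>
  define r where "r x = (if g x = \<infinity> then 0 else f x - g x)" for x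
  have [measurable]: "r \<in> borel_measurable M" unfolding r_def by measurable
  have 1: "f x \<le> r x + g x" for x
    by (cases "g x = \<infinity>") (auto simp: r_def diff_add_self_ennreal not_le intro: less_imp_le)
  have 2: "r x \<le> b x" if "x \<in> space M" for x
    using le[OF that] by (auto simp: r_def ennreal_minus_le_iff add.commute less_top)
  have "(\<integral>\<^sup>+x. f x \<partial>M) \<le> (\<integral>\<^sup>+x. r x + g x \<partial>M)" by (intro nn_integral_mono 1)
  also have "\<dots> = (\<integral>\<^sup>+x. r x \<partial>M) + (\<integral>\<^sup>+x. g x \<partial>M)" by (rule nn_integral_add) auto
  also have "\<dots> \<le> (\<integral>\<^sup>+x. b x \<partial>M) + (\<integral>\<^sup>+x. g x \<partial>M)" by (intro add_right_mono nn_integral_mono 2)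
  finally show ?thesis .
qed

text \<open>If the increment were too small, \<open>u\<close> minus the primitive \<open>K\<close>
  of \<open>k\<close> would fall from \<open>x\<close> to \<open>y\<close>; the slope \<delta> eats
  up half of the deficit, and the tilted function \<open>f\<close> still falls by
  \<open>4 * e\<close>. A steep exponential barrier at \<open>x\<close> keeps the maximum of
  \<open>f - \<theta>\<close> away from \<open>x\<close>, the fall keeps it away from
  \<open>y\<close>, and at an interior maximum the touching function has a derivative strictly below
  \<open>k\<close>.\<close>

lemma viscosity_increment_continuous:
  fixes u k :: "real \<Rightarrow> real"
  assumes xy: "x < y" and u: "continuous_on {x..y} u" and k: "continuous_on UNIV k"
    and visc: "\<And>z \<phi> \<phi>'. x < z \<Longrightarrow> z < y \<Longrightarrow> (\<And>s. (\<phi> has_real_derivative \<phi>' s) (at s)) \<Longrightarrow>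
       continuous_on UNIV \<phi>' \<Longrightarrow> \<phi> z = u z \<Longrightarrow> (\<And>s. s \<in> {x..y} \<Longrightarrow> u s \<le> \<phi> s) \<Longrightarrow> k z \<le> \<phi>' z"
  shows "integral {x..y} k \<le> u y - u x"
proof (rule ccontr)
  assume neg: "\<not> ?thesis"
  define K where "K s = (LBINT t=ereal x..ereal s. k t)" for s
  have K: "(K has_real_derivative k s) (at s)" for s
  proof -
    have "(K has_vector_derivative k s) (at s within {min x s - 1..max x s + 1})"
      unfolding K_def by (rule interval_integral_FTC2[OF _ _ continuous_on_subset[OF k]]) auto
    then have "(K has_vector_derivative k s) (at s within {min x s - 1<..<max x s + 1})"
      by (rule has_vector_derivative_within_subset) auto
    then show ?thesis
      by (subst (asm) at_within_open) (auto simp: has_real_derivative_iff_has_vector_derivative)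
  qed
  have "(k has_integral (K y - K x)) {x..y}"
    using xy K by (intro fundamental_theorem_of_calculus)
      (auto simp: has_real_derivative_iff_has_vector_derivative[symmetric] intro: has_field_derivative_at_within)
  then have int: "integral {x..y} k = K y - K x" by (rule integral_unique)
  define \<delta> where "\<delta> = (K y - K x - (u y - u x)) / (2 * (y - x))"
  have \<delta>: "0 < \<delta>" using neg xy by (simp add: \<delta>_def int)
  have \<delta>2: "\<delta> * (y - x) = (K y - K x - (u y - u x)) / 2" using xy by (simp add: \<delta>_def field_simps)
  define f where "f s = u s - K s + \<delta> * (s - x)" for s
  define e where "e = (f x - f y) / 4"
  have e: "0 < e" using neg \<delta>2 by (simp add: e_def f_def int)
  have Kc: "continuous_on A K" for A
    by (intro continuous_at_imp_continuous_on ballI) (rule DERIV_isCont[OF K])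
  have fc: "continuous_on {x..y} f" unfolding f_def by (intro continuous_intros u Kc)
  obtain d where d: "d > 0" "\<And>s. s \<in> {x..y} \<Longrightarrow> \<bar>s - x\<bar> < d \<Longrightarrow> \<bar>f s - f x\<bar> < e"
    using fc e xy unfolding continuous_on_iff dist_real_def by (metis atLeastAtMost_iff less_imp_le order_refl)
  define r where "r = min (d/2) ((y - x)/2)"
  have r: "0 < r" "x + r < y" "r < d" using d xy by (auto simp: r_def min_def field_simps)
  \<comment> \<open>The barrier drops from \<open>2 * e\<close> at \<open>x\<close> to
    \<open>e / 2\<close> at \<open>x + r\<close>, where \<open>f\<close> has lost less than
    \<open>e\<close>; so \<open>x + r\<close> beats \<open>x\<close>.\<close>
  define \<kappa> where "\<kappa> = ln 4 / r"
  have \<kappa>: "0 < \<kappa>" using r by (simp add: \<kappa>_def)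
  define \<theta> where "\<theta> s = 2 * e * exp (- \<kappa> * (s - x))" for s
  have \<theta>r: "\<theta> (x + r) = e / 2" using r by (simp add: \<theta>_def \<kappa>_def exp_minus)
  have "continuous_on {x..y} (\<lambda>s. f s - \<theta> s)" unfolding \<theta>_def by (intro continuous_intros fc)
  then obtain z where z: "z \<in> {x..y}" "\<And>s. s \<in> {x..y} \<Longrightarrow> f s - \<theta> s \<le> f z - \<theta> z"
    using continuous_attains_sup[of "{x..y}" "\<lambda>s. f s - \<theta> s"] xy by auto
  have "f x - 3/2 * e < f (x + r) - \<theta> (x + r)"
    using d(2)[of "x + r"] r \<theta>r by auto
  also have "\<dots> \<le> f z - \<theta> z" using r by (intro z) auto
  finally have big: "f x - 3/2 * e < f z - \<theta> z" .
  have "z \<noteq> x" using big e by (auto simp: \<theta>_def)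
  moreover have "z \<noteq> y"
  proof
    assume "z = y"
    then have "f x - 3/2 * e < f y - \<theta> y" using big by simp
    moreover have "0 \<le> \<theta> y" using e by (simp add: \<theta>_def)
    moreover have "f x - f y = 4 * e" by (simp add: e_def)
    ultimately show False using e by linarith
  qed
  ultimately have zi: "x < z" "z < y" using z by auto
  define \<phi> where "\<phi> s = K s - \<delta> * (s - x) + \<theta> s + (f z - \<theta> z)" for s
  define \<phi>' where "\<phi>' s = k s - \<delta> - 2 * e * \<kappa> * exp (- \<kappa> * (s - x))" for s
  have "k z \<le> \<phi>' z"
  proof (rule visc[OF zi, of \<phi>])
    show "(\<phi> has_real_derivative \<phi>' s) (at s)" for s
      unfolding \<phi>_def \<phi>'_def \<theta>_def by (auto intro!: derivative_eq_intros K)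
    show "continuous_on UNIV \<phi>'" unfolding \<phi>'_def by (intro continuous_intros k)
    show "\<phi> z = u z" by (simp add: \<phi>_def f_def)
    show "u s \<le> \<phi> s" if "s \<in> {x..y}" for s using z(2)[OF that] by (simp add: \<phi>_def f_def)
  qed
  moreover have "0 < 2 * e * \<kappa> * exp (- \<kappa> * (z - x))" using e \<kappa> by simp
  ultimately show False using \<delta> unfolding \<phi>'_def by linarith
qed

text \<open>The discontinuous right-hand side is approximated from below by its inf-convolutions with
  \<open>n * \<bar>s - z\<bar>\<close>, which are Lipschitz and converge at the points of continuity.\<close>

lemma viscosity_increment:
  fixes u k :: "real \<Rightarrow> real"
  assumes xy: "x < y" and u: "continuous_on {x..y} u"
    and k[measurable]: "k \<in> borel_measurable borel" and kM: "\<And>s. \<bar>k s\<bar> \<le> M"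
    and N: "countable N" and kc: "\<And>s. x < s \<Longrightarrow> s < y \<Longrightarrow> s \<notin> N \<Longrightarrow> isCont k s"
    and visc: "\<And>z \<phi> \<phi>'. x < z \<Longrightarrow> z < y \<Longrightarrow> (\<And>s. (\<phi> has_real_derivative \<phi>' s) (at s)) \<Longrightarrow>
       continuous_on UNIV \<phi>' \<Longrightarrow> \<phi> z = u z \<Longrightarrow> (\<And>s. s \<in> {x..y} \<Longrightarrow> u s \<le> \<phi> s) \<Longrightarrow> k z \<le> \<phi>' z"
  shows "set_lebesgue_integral lborel {x..y} k \<le> u y - u x"
proof -
  define kn where "kn n s = (INF z\<in>{x<..<y}. k z + real n * \<bar>s - z\<bar>)" for n :: nat and s
  have ne: "{x<..<y} \<noteq> {}" using xy by simp
  have bdd: "bdd_below ((\<lambda>z. k z + real n * \<bar>s - z\<bar>) ` {x<..<y})" for n s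
  proof (rule bdd_belowI2)
    fix z
    have "0 \<le> real n * \<bar>s - z\<bar>" by simp
    then show "- M \<le> k z + real n * \<bar>s - z\<bar>" using kM[of z] by linarith
  qed
  have lb: "- M \<le> kn n s" for n s
    unfolding kn_def
  proof (rule cINF_greatest[OF ne])
    fix z
    have "0 \<le> real n * \<bar>s - z\<bar>" by simp
    then show "- M \<le> k z + real n * \<bar>s - z\<bar>" using kM[of z] by linarith
  qed
  have ub: "kn n s \<le> k s" if "s \<in> {x<..<y}" for n s
    using cINF_lower[OF bdd that, of n s] by (simp add: kn_def)
  have lip: "kn n s \<le> kn n s' + real n * \<bar>s - s'\<bar>" for n s s'
  proof -
    have "kn n s - real n * \<bar>s - s'\<bar> \<le> kn n s'"
      unfolding kn_def[of n s']
    proof (rule cINF_greatest[OF ne])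
      fix z assume z: "z \<in> {x<..<y}"
      have "kn n s \<le> k z + real n * \<bar>s - z\<bar>" unfolding kn_def by (rule cINF_lower[OF bdd z])
      also have "real n * \<bar>s - z\<bar> \<le> real n * \<bar>s - s'\<bar> + real n * \<bar>s' - z\<bar>"
        unfolding distrib_left[symmetric] by (intro mult_left_mono) auto
      finally show "kn n s - real n * \<bar>s - s'\<bar> \<le> k z + real n * \<bar>s' - z\<bar>" by simp
    qed
    then show ?thesis by simp
  qed
  have knc: "continuous_on UNIV (kn n)" for n
  proof (rule lipschitz_on_continuous_on)
    show "(real n)-lipschitz_on UNIV (kn n)"
      using lip[of n] by (intro lipschitz_onI)
        (auto simp: dist_real_def abs_le_iff abs_minus_commute algebra_simps, (metis add.commute diff_le_eq abs_minus_commute)+)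
  qed
  have [measurable]: "kn n \<in> borel_measurable borel" for n
    using knc by (rule borel_measurable_continuous_onI)
  have conv: "(\<lambda>n. kn n s) \<longlonglongrightarrow> k s" if s: "s \<in> {x<..<y}" "s \<notin> N" for s
  proof (rule LIMSEQ_I)
    fix e :: real assume e: "0 < e"
    obtain d where d: "d > 0" "\<And>z. \<bar>z - s\<bar> < d \<Longrightarrow> \<bar>k z - k s\<bar> < e/2"
      using kc[of s] s e unfolding isCont_def LIM_def dist_real_def
      by (metis abs_zero cancel_comm_monoid_add_class.diff_cancel greaterThanLessThan_iff half_gt_zero)
    \<comment> \<open>From \<open>n0\<close> on the penalty at distance \<open>d\<close> is at least
      \<open>2 * M\<close> and outweighs any variation of \<open>k\<close>, so only points close to
      \<open>s\<close> compete in the infimum.\<close>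
    obtain n0 :: nat where n0: "2 * M / d < real n0" using reals_Archimedean2 by blast
    have "k s - e/2 \<le> kn n s" if n: "n \<ge> n0" for n
      unfolding kn_def
    proof (rule cINF_greatest[OF ne])
      fix z
      show "k s - e/2 \<le> k z + real n * \<bar>s - z\<bar>"
      proof (cases "\<bar>z - s\<bar> < d")
        case True
        moreover have "0 \<le> real n * \<bar>s - z\<bar>" by simp
        ultimately show ?thesis using d(2)[of z] by linarith
      next
        case False
        have "2 * M \<le> real n * d" using n0 n d(1) by (simp add: field_simps)
          (metis less_eq_real_def mult.commute mult_left_mono of_nat_le_iff order_trans)
        also have "\<dots> \<le> real n * \<bar>s - z\<bar>" using False by (intro mult_left_mono) auto
        finally show ?thesis using kM[of s] kM[of z] e by linarith
      qed
    qed
    then have "norm (kn n s - k s) < e" if "n \<ge> n0" for n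
      using that ub[OF s(1), of n] e by (fastforce simp: abs_if)
    then show "\<exists>no. \<forall>n\<ge>no. norm (kn n s - k s) < e" by blast
  qed
  have "countable (N \<union> {x, y})" using N by simp
  then have AE: "AE s in lborel. s \<notin> N \<union> {x, y}"
    by (intro AE_not_in countable_imp_null_set_lborel)
  have M0: "0 \<le> M" using kM[of 0] by linarith
  have "(\<lambda>n. set_lebesgue_integral lborel {x..y} (kn n)) \<longlonglongrightarrow> set_lebesgue_integral lborel {x..y} k"
    unfolding set_lebesgue_integral_def
  proof (rule integral_dominated_convergence)
    show "integrable lborel (\<lambda>s. indicator {x..y} s *\<^sub>R M)" using xy by simp
    show "AE s in lborel. (\<lambda>n. indicator {x..y} s *\<^sub>R kn n s) \<longlonglongrightarrow> indicator {x..y} s *\<^sub>R k s"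
      using AE by eventually_elim (auto simp: indicator_def intro!: conv)
    show "AE s in lborel. norm (indicator {x..y} s *\<^sub>R kn n s) \<le> indicator {x..y} s *\<^sub>R M" for n
      using AE
    proof eventually_elim
      case (elim s)
      show ?case
      proof (cases "s \<in> {x..y}")
        case True
        then have "s \<in> {x<..<y}" using elim by auto
        from ub[OF this, of n] lb[of n s] kM[of s] show ?thesis by (auto simp: indicator_def abs_le_iff)
      qed simp
    qed
  qed auto
  moreover have "set_lebesgue_integral lborel {x..y} (kn n) \<le> u y - u x" for n
  proof -
    have "set_integrable lborel {x..y} (kn n)"
      by (rule borel_integrable_atLeastAtMost')  (rule continuous_on_subset[OF knc], simp)
    then have "set_lebesgue_integral lborel {x..y} (kn n) = integral {x..y} (kn n)"
      by (rule set_borel_integral_eq_integral)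
    also have "\<dots> \<le> u y - u x"
    proof (rule viscosity_increment_continuous[OF xy u knc])
      fix z \<phi> \<phi>'
      assume a: "x < z" "z < y" "\<And>s. (\<phi> has_real_derivative \<phi>' s) (at s)"
        "continuous_on UNIV \<phi>'" "\<phi> z = u z" "\<And>s. s \<in> {x..y} \<Longrightarrow> u s \<le> \<phi> s"
      have "kn n z \<le> k z" using a by (intro ub) auto
      also have "k z \<le> \<phi>' z" using a by (rule visc)
      finally show "kn n z \<le> \<phi>' z" .
    qed
    finally show ?thesis .
  qed
  ultimately show ?thesis by (intro LIMSEQ_le_const2) auto
qed

text \<open>Squaring removes the kink of the positive part; this provides the continuously
  differentiable cutoff for the gluing of test functions.\<close>

lemma has_real_derivative_max0_square:
  "((\<lambda>u::real. (max 0 u)\<^sup>2) has_real_derivative 2 * max 0 u) (at u)"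
proof -
  consider "u < 0" | "0 < u" | "u = 0" by linarith
  then show ?thesis
  proof cases
    case 1
    have "((\<lambda>u::real. 0) has_real_derivative 0) (at u)" by simp
    then have "((\<lambda>u::real. (max 0 u)\<^sup>2) has_real_derivative 0) (at u)"
      by (rule DERIV_cong_ev[THEN iffD1, rotated -1])
        (use 1 in \<open>auto intro!: eventually_mono[OF eventually_nhds_in_open[of "{..<0}"]]\<close>)
    then show ?thesis using 1 by simp
  next
    case 2
    have "((\<lambda>u::real. u\<^sup>2) has_real_derivative 2 * u) (at u)" by (auto intro!: derivative_eq_intros)
    then have "((\<lambda>u::real. (max 0 u)\<^sup>2) has_real_derivative 2 * u) (at u)"
      by (rule DERIV_cong_ev[THEN iffD1, rotated -1])
        (use 2 in \<open>auto intro!: eventually_mono[OF eventually_nhds_in_open[of "{0<..}"]]\<close>)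
    then show ?thesis using 2 by simp
  next
    case 3
    have "((\<lambda>h::real. (max 0 h)\<^sup>2 / h) \<longlongrightarrow> 0) (at 0)"
    proof (rule Lim_null_comparison)
      show "\<forall>\<^sub>F h::real in at 0. norm ((max 0 h)\<^sup>2 / h) \<le> \<bar>h\<bar>"
        by (intro always_eventually) (auto simp: max_def power2_eq_square)
      show "((\<lambda>h::real. \<bar>h\<bar>) \<longlongrightarrow> 0) (at 0)" by real_asymp
    qed
    then show ?thesis using 3 by (simp add: DERIV_def)
  qed
qed

text \<open>The operator is nonlocal, so a function that touches \<open>w\<close> locally is replaced by one that is in
  addition uniformly close to \<open>w\<close>.\<close>

lemma test_function_near:
  fixes w \<phi> \<phi>' :: "real \<Rightarrow> real"
  assumes z: "l < z" "z < b" and w: "continuous_on {l..b} w"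
    and \<phi>: "\<And>s. (\<phi> has_real_derivative \<phi>' s) (at s)" "continuous_on UNIV \<phi>'"
    and r: "0 < r" and touch: "\<phi> z = w z" "\<And>s. s \<in> {l..b} \<Longrightarrow> \<bar>s - z\<bar> < r \<Longrightarrow> w s \<le> \<phi> s"
    and e: "0 < e"
  obtains \<Phi> where "C1_on l b \<Phi>" "\<Phi> z = w z" "(\<Phi> has_real_derivative \<phi>' z) (at z)"
    "\<And>s. s \<in> {l..b} \<Longrightarrow> w s \<le> \<Phi> s" "\<And>s. s \<in> {l..b} \<Longrightarrow> \<Phi> s \<le> w s + e"
proof -
  have \<phi>c: "continuous_on A \<phi>" for A
    by (intro continuous_at_imp_continuous_on ballI) (rule DERIV_isCont[OF \<phi>(1)])
  have "continuous_on {l..b} (\<lambda>s. \<phi> s - w s)" by (intro continuous_intros \<phi>c w)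
  then obtain d where d: "d > 0" "\<And>s. s \<in> {l..b} \<Longrightarrow> \<bar>s - z\<bar> < d \<Longrightarrow> \<bar>\<phi> s - w s - (\<phi> z - w z)\<bar> < e"
    using e z unfolding continuous_on_iff dist_real_def by (metis atLeastAtMost_iff less_imp_le)
  define \<rho> where "\<rho> = min r d"
  have \<rho>: "0 < \<rho>" using r d by (simp add: \<rho>_def)
  have near: "w s \<le> \<phi> s" "\<phi> s \<le> w s + e" if "s \<in> {l..b}" "\<bar>s - z\<bar> < \<rho>" for s
    using d(2)[of s] touch(2)[of s] that touch(1) by (auto simp: \<rho>_def)
  \<comment> \<open>Away from \<open>z\<close> any smooth function in the band between
    \<open>w\<close> and \<open>w + e\<close> will do: a polynomial that approximates
    \<open>w\<close> up to \<open>e/2\<close>, raised by \<open>e/2\<close>.\<close>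
  obtain g where g: "real_polynomial_function g" "\<And>s. s \<in> {l..b} \<Longrightarrow> \<bar>w s - g s\<bar> < e/2"
    using Stone_Weierstrass_real_polynomial_function[OF _ w, of "e/2"] e by auto
  obtain g' where g': "real_polynomial_function g'" "\<And>s. (g has_real_derivative g' s) (at s)"
    using has_real_derivative_polynomial_function[OF g(1)] by metis
  define \<psi> where "\<psi> s = g s + e/2" for s
  \<comment> \<open>The cutoff \<open>\<eta>\<close> vanishes from distance \<open>\<rho>\<close> on
    and equals 1 with derivative 0 at \<open>z\<close>, so the glued function inherits value and
    derivative of \<open>\<phi>\<close> there. As a convex combination it stays in the band.\<close>
  define q where "q s = 1 - ((s - z)/\<rho>)\<^sup>2" for s
  define \<eta> where "\<eta> s = (max 0 (q s))\<^sup>2" for s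
  define \<eta>' where "\<eta>' s = 2 * max 0 (q s) * (- 2 * (s - z) / \<rho>\<^sup>2)" for s
  have q': "(q has_real_derivative (- 2 * (s - z) / \<rho>\<^sup>2)) (at s)" for s
    unfolding q_def using \<rho> by (auto intro!: derivative_eq_intros simp: power2_eq_square field_simps)
  have \<eta>': "(\<eta> has_real_derivative \<eta>' s) (at s)" for s
    unfolding \<eta>_def \<eta>'_def by (rule DERIV_chain2[OF has_real_derivative_max0_square q'])
  have qle: "q s \<le> 1" for s by (simp add: q_def)
  have \<eta>01: "0 \<le> \<eta> s" "\<eta> s \<le> 1" for s
    using qle[of s] by (auto simp: \<eta>_def power_le_one_iff)
  have \<eta>z: "\<eta> z = 1" "\<eta>' z = 0" by (auto simp: \<eta>_def \<eta>'_def q_def)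
  have \<eta>0: "\<eta> s = 0" if "\<not> \<bar>s - z\<bar> < \<rho>" for s
  proof -
    have "\<rho>\<^sup>2 \<le> (s - z)\<^sup>2" using that \<rho> by (simp flip: abs_le_square_iff)
    then have "q s \<le> 0" using \<rho> by (simp add: q_def power_divide)
    then show ?thesis by (simp add: \<eta>_def)
  qed
  define \<Phi> where "\<Phi> s = \<eta> s * \<phi> s + (1 - \<eta> s) * \<psi> s" for s
  define \<Phi>' where "\<Phi>' s = \<eta>' s * \<phi> s + \<eta> s * \<phi>' s + (- \<eta>' s * \<psi> s + (1 - \<eta> s) * g' s)" for s
  have \<psi>': "(\<psi> has_real_derivative g' s) (at s)" for s
    unfolding \<psi>_def by (auto intro!: derivative_eq_intros g'(2))
  have \<Phi>': "(\<Phi> has_real_derivative \<Phi>' s) (at s)" for s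
    unfolding \<Phi>_def \<Phi>'_def by (auto intro!: derivative_eq_intros \<eta>' \<psi>' \<phi>(1) simp: algebra_simps)
  have cont: "continuous_on A \<eta>" "continuous_on A \<psi>" "continuous_on A q" for A
    using \<eta>' \<psi>' q' by (auto intro!: continuous_at_imp_continuous_on DERIV_isCont)
  have "continuous_on {l..b} \<Phi>'"
    unfolding \<Phi>'_def \<eta>'_def using \<rho>
    by (intro continuous_intros cont \<phi>c continuous_on_subset[OF \<phi>(2)] 
        continuous_on_polymonial_function[OF g'(1)[unfolded real_polynomial_function_eq]]) auto
  then have "C1_on l b \<Phi>"
    unfolding C1_on_def using \<Phi>' by (blast intro: has_field_derivative_at_within)
  moreover have "\<Phi> z = w z" using \<eta>z touch by (simp add: \<Phi>_def)
  moreover have "(\<Phi> has_real_derivative \<phi>' z) (at z)"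
    using \<Phi>'[of z] \<eta>z by (simp add: \<Phi>'_def)
  moreover have "w s \<le> \<Phi> s \<and> \<Phi> s \<le> w s + e" if s: "s \<in> {l..b}" for s
  proof (cases "\<bar>s - z\<bar> < \<rho>")
    case True
    have p: "w s \<le> \<psi> s" "\<psi> s \<le> w s + e" using g(2)[OF s] by (auto simp: \<psi>_def abs_if split: if_splits)
    have "\<eta> s * w s + (1 - \<eta> s) * w s \<le> \<Phi> s"
      unfolding \<Phi>_def using near[OF s True] p \<eta>01[of s] by (intro add_mono mult_left_mono) auto
    moreover have "\<Phi> s \<le> \<eta> s * (w s + e) + (1 - \<eta> s) * (w s + e)"
      unfolding \<Phi>_def using near[OF s True] p \<eta>01[of s] by (intro add_mono mult_left_mono) auto
    ultimately show ?thesis by (simp add: algebra_simps)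
  next
    case False
    then show ?thesis using g(2)[OF s] by (auto simp: \<Phi>_def \<eta>0 \<psi>_def abs_if split: if_splits)
  qed
  ultimately show ?thesis using that by blast
qed

section \<open>The equation along a production period\<close>

definition shortfall_cost :: "('w, 'z) inventory_model_scheme \<Rightarrow> real \<Rightarrow> real \<Rightarrow> real" where
  "shortfall_cost P z y = (if z - lmin P < y then pen P (y - (z - lmin P)) else 0)"

definition served :: "('w, 'z) inventory_model_scheme \<Rightarrow> real \<Rightarrow> real \<Rightarrow> real" where
  "served P z y = z - min y (z - lmin P)"

text \<open>Extended by 0, the rate is nonnegative, bounded and measurable on the whole line. In the
  idle phase only the level \<open>cap P\<close> occurs, whence the constant.\<close>

definition hold_rate :: "('w, 'z) inventory_model_scheme \<Rightarrow> nat \<Rightarrow> real \<Rightarrow> real" where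
  "hold_rate P i z = (if i = 0 then hold P 0 (cap P)
     else if i \<in> {1, 2} \<and> z \<in> {lmin P..<cap P} then hold P i z else 0)"

definition jump_mean :: "('w, 'z) inventory_model_scheme \<Rightarrow> (real \<Rightarrow> real) \<Rightarrow> real \<Rightarrow> real" where
  "jump_mean P v z = (\<integral>y. v (served P z y) \<partial>dlaw P)"

definition shortfall_mean :: "('w, 'z) inventory_model_scheme \<Rightarrow> real \<Rightarrow> real" where
  "shortfall_mean P z = (\<integral>y. shortfall_cost P z y \<partial>dlaw P)"

text \<open>The terms of \<open>hjb_op\<close> other than the derivative and
  \<open>- (lam P + disc P) * u x\<close>. Here \<open>v\<close> is the value after a jump; it is
  kept apart from the value before the jump because an arrival forces the idle phase to be left, and
  then the two functions differ.\<close>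

definition running :: "('w, 'z) inventory_model_scheme \<Rightarrow> nat \<Rightarrow> (real \<Rightarrow> real) \<Rightarrow> real \<Rightarrow> real" where
  "running P i v z = lam P * (jump_mean P v z + shortfall_mean P z) + hold_rate P i z"

section \<open>Penalties, served demand and holding rate: measurability and bounds\<close>

context production_inventory
begin

lemma lmin_less_cap: "lmin P < cap P"
  using levels by simp

lemma dem_measurable [measurable]: "dem P (Suc n) \<in> borel_measurable (pspace P)"
  using indep unfolding indep_vars_def by (auto split: sum.split dest!: spec[of _ "Inr n"])

lemma sets_dlaw [measurable_cong, simp]: "sets (dlaw P) = sets borel"
  using dem_law[of 1] by (metis order_refl sets_distr)

lemma space_dlaw [simp]: "space (dlaw P) = UNIV"
  using sets_eq_imp_space_eq[OF sets_dlaw] by simp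

lemma prob_space_dlaw: "prob_space (dlaw P)"
  using dem_law[of 1] prob_space_distr[OF dem_measurable[of 0]] by simp

sublocale demand: prob_space "dlaw P"
  by (rule prob_space_dlaw)

lemma AE_dlaw_pos: "AE y in dlaw P. 0 < y"
proof -
  have "AE y in distr (pspace P) borel (dem P 1). 0 < y"
    using dem_measurable[of 0] by (subst AE_distr_iff) (auto intro!: AE_I2 dem_pos)
  then show ?thesis by (subst (asm) dem_law) simp_all
qed

text \<open>\<open>pen P\<close> is known to be measurable on the nonnegative half-line only; cut
  off there, it is measurable everywhere.\<close>

definition pen_pos :: "real \<Rightarrow> real" where
  "pen_pos y = indicator {0..} y * pen P y"

lemma pen_pos_measurable [measurable]: "pen_pos \<in> borel_measurable borel"
  using pen_integrable unfolding set_integrable_def pen_pos_def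
  by (auto dest!: borel_measurable_integrable simp: measurable_cong_sets[OF sets_dlaw refl])

lemma pen_pos_integrable: "integrable (dlaw P) pen_pos"
  using pen_integrable unfolding set_integrable_def pen_pos_def by simp

lemma pen_pos_nonneg: "0 \<le> pen_pos y"
  by (auto simp: pen_pos_def indicator_def pen_nonneg)

lemma shortfall_cost_pen_pos:
  "shortfall_cost P z y = (if z - lmin P < y then pen_pos (y - (z - lmin P)) else 0)"
  by (auto simp: shortfall_cost_def pen_pos_def)

lemma shortfall_cost_measurable [measurable]:
  assumes [measurable]: "f \<in> borel_measurable M" "g \<in> borel_measurable M"
  shows "(\<lambda>x. shortfall_cost P (f x) (g x)) \<in> borel_measurable M"
  unfolding shortfall_cost_pen_pos by measurable

lemma served_measurable [measurable]:
  assumes [measurable]: "f \<in> borel_measurable M" "g \<in> borel_measurable M"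
  shows "(\<lambda>x. served P (f x) (g x)) \<in> borel_measurable M"
  unfolding served_def by measurable

lemma shortfall_cost_nonneg: "0 \<le> shortfall_cost P z y"
  by (auto simp: shortfall_cost_pen_pos pen_pos_nonneg)

lemma shortfall_cost_antimono:
  assumes "z \<le> z'" shows "shortfall_cost P z' y \<le> shortfall_cost P z y"
  using assms monotone_onD[OF pen_mono, of "y - (z' - lmin P)" "y - (z - lmin P)"]
  by (auto simp: shortfall_cost_def intro!: pen_nonneg)

lemma shortfall_cost_le:
  assumes "lmin P \<le> z" shows "shortfall_cost P z y \<le> pen_pos y"
proof -
  have "shortfall_cost P z y \<le> shortfall_cost P (lmin P) y" by (rule shortfall_cost_antimono[OF assms])
  also have "\<dots> \<le> pen_pos y" using pen_pos_nonneg[of y] by (simp add: shortfall_cost_pen_pos)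
  finally show ?thesis .
qed

lemma shortfall_cost_integrable: "lmin P \<le> z \<Longrightarrow> integrable (dlaw P) (shortfall_cost P z)"
  by (rule Bochner_Integration.integrable_bound[OF pen_pos_integrable])
    (auto simp: shortfall_cost_le shortfall_cost_nonneg pen_pos_nonneg)

lemma shortfall_mean_nonneg: "0 \<le> shortfall_mean P z"
  unfolding shortfall_mean_def by (intro Bochner_Integration.integral_nonneg shortfall_cost_nonneg)

lemma shortfall_mean_antimono:
  "lmin P \<le> z \<Longrightarrow> z \<le> z' \<Longrightarrow> shortfall_mean P z' \<le> shortfall_mean P z"
  unfolding shortfall_mean_def by (intro integral_mono shortfall_cost_integrable shortfall_cost_antimono) auto

lemma served_bounds: "lmin P \<le> z \<Longrightarrow> lmin P \<le> served P z y" "0 \<le> y \<Longrightarrow> lmin P \<le> z \<Longrightarrow> served P z y \<le> z"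
  by (auto simp: served_def)

lemma jump_mean_bounded:
  assumes [measurable]: "v \<in> borel_measurable borel" and "\<And>z. \<bar>v z\<bar> \<le> M"
  shows "integrable (dlaw P) (\<lambda>y. v (served P z y))" "\<bar>jump_mean P v z\<bar> \<le> M"
proof -
  show i: "integrable (dlaw P) (\<lambda>y. v (served P z y))"
    by (rule demand.integrable_const_bound[of _ M]) (auto simp: assms)
  have "\<bar>jump_mean P v z\<bar> \<le> (\<integral>y. \<bar>v (served P z y)\<bar> \<partial>dlaw P)"
    unfolding jump_mean_def by (rule integral_abs_bound)
  also have "\<dots> \<le> (\<integral>y. M \<partial>dlaw P)" using i by (intro integral_mono) (auto simp: assms)
  finally show "\<bar>jump_mean P v z\<bar> \<le> M" using demand.prob_space by simp
qed

text \<open>The served level depends continuously on the level before the demand, so dominated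
  convergence applies whatever atoms the demand law has. For the mean shortfall only monotonicity is
  available.\<close>

lemma isCont_jump_mean:
  assumes v: "continuous_on UNIV v" and M: "\<And>z. \<bar>v z\<bar> \<le> M"
  shows "isCont (jump_mean P v) z"
proof (rule continuous_at_sequentiallyI)
  have [measurable]: "v \<in> borel_measurable borel" using v by (rule borel_measurable_continuous_onI)
  fix X assume X: "X \<longlonglongrightarrow> z"
  show "(\<lambda>n. jump_mean P v (X n)) \<longlonglongrightarrow> jump_mean P v z"
    unfolding jump_mean_def
  proof (rule integral_dominated_convergence[where w="\<lambda>_. M"])
    show "AE y in dlaw P. (\<lambda>n. v (served P (X n) y)) \<longlonglongrightarrow> v (served P z y)"
    proof (intro AE_I2 isCont_tendsto_compose[of _ v])
      show "isCont v (served P z y)" for y using v by (simp add: continuous_on_eq_continuous_at)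
      show "(\<lambda>n. served P (X n) y) \<longlonglongrightarrow> served P z y" for y
        unfolding served_def by (intro tendsto_intros X)
    qed
  qed (auto simp: M)
qed

lemma hold_measurable:
  assumes i: "i \<in> {1, 2}"
  shows "(\<lambda>z. if z \<in> {lmin P..<cap P} then hold P i z else 0) \<in> borel_measurable borel"
proof (rule borel_measurable_continuous_countable_exceptions)
  let ?h = "\<lambda>z. if z \<in> {lmin P..<cap P} then hold P i z else 0"
  show "countable (hold_discont P i \<union> {lmin P, cap P})"
    using hold_discont[OF i] by (simp add: countable_finite)
  show "continuous_on (- (hold_discont P i \<union> {lmin P, cap P})) ?h"
  proof (intro continuous_at_imp_continuous_on ballI)
    fix s assume s: "s \<in> - (hold_discont P i \<union> {lmin P, cap P})"
    consider "s < lmin P" | "s > cap P" | "lmin P < s" "s < cap P" using s by fastforce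
    then show "isCont ?h s"
    proof cases
      case 1
      have "isCont (\<lambda>_::real. 0::real) s" by simp
      then show ?thesis
        by (rule isCont_cong[THEN iffD1, rotated])
         (use 1 in \<open>auto intro!: eventually_mono[OF eventually_nhds_in_open[of "{..<lmin P}"]]\<close>)
    next
      case 2
      have "isCont (\<lambda>_::real. 0::real) s" by simp
      then show ?thesis
        by (rule isCont_cong[THEN iffD1, rotated])
         (use 2 in \<open>auto intro!: eventually_mono[OF eventually_nhds_in_open[of "{cap P<..}"]]\<close>)
    next
      case 3
      then have "continuous (at s within {lmin P..<cap P}) (hold P i)"
        using s by (auto simp: hold_discont_def)
      then have "isCont (hold P i) s"
        using 3 at_within_interior[of s "{lmin P..<cap P}"] by simp
      then show ?thesis
        by (rule isCont_cong[THEN iffD1, rotated])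
         (use 3 in \<open>auto intro!: eventually_mono[OF eventually_nhds_in_open[of "{lmin P<..<cap P}"]]\<close>)
    qed
  qed
qed

lemma hold_rate_measurable [measurable]: "hold_rate P i \<in> borel_measurable borel"
proof (cases "i \<in> {1, 2}")
  case True
  then have "hold_rate P i = (\<lambda>z. if z \<in> {lmin P..<cap P} then hold P i z else 0)"
    by (auto simp: hold_rate_def fun_eq_iff)
  then show ?thesis using hold_measurable[OF True] by simp
next
  case False
  then have "hold_rate P i = (\<lambda>z. if i = 0 then hold P 0 (cap P) else 0)"
    by (auto simp: hold_rate_def fun_eq_iff)
  then show ?thesis by simp
qed

lemma hold_rate_nonneg: "0 \<le> hold_rate P i z"
  using hold_0 hold_nonneg[of i z] by (auto simp: hold_rate_def)

lemma hold_rate_bound: obtains H where "0 \<le> H" "\<And>i z. hold_rate P i z \<le> H"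
proof -
  obtain B1 B2 where B: "\<forall>x\<in>{lmin P..<cap P}. \<bar>hold P 1 x\<bar> \<le> B1"
      "\<forall>x\<in>{lmin P..<cap P}. \<bar>hold P 2 x\<bar> \<le> B2"
    using hold_bounded[of 1] hold_bounded[of 2] unfolding bounded_iff by auto
  show ?thesis
  proof (rule that[of "hold P 0 (cap P) + \<bar>B1\<bar> + \<bar>B2\<bar>"])
    show "0 \<le> hold P 0 (cap P) + \<bar>B1\<bar> + \<bar>B2\<bar>" using hold_0 by simp
    show "hold_rate P i z \<le> hold P 0 (cap P) + \<bar>B1\<bar> + \<bar>B2\<bar>" for i z
      using B(1)[rule_format, of z] B(2)[rule_format, of z] hold_0 by (auto simp: hold_rate_def)
  qed
qed

lemma shortfall_mean_measurable [measurable]: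
  assumes [measurable]: "f \<in> borel_measurable M"
  shows "(\<lambda>x. shortfall_mean P (f x)) \<in> borel_measurable M"
proof -
  show ?thesis unfolding shortfall_mean_def by measurable
qed

lemma jump_mean_measurable [measurable]:
  assumes [measurable]: "v \<in> borel_measurable borel" "f \<in> borel_measurable M"
  shows "(\<lambda>x. jump_mean P v (f x)) \<in> borel_measurable M"
proof -
  show ?thesis unfolding jump_mean_def by measurable
qed

lemma running_measurable [measurable]:
  assumes [measurable]: "v \<in> borel_measurable borel"
  shows "running P i v \<in> borel_measurable borel"
  unfolding running_def by measurable

lemma shortfall_mean_le: "lmin P \<le> z \<Longrightarrow> shortfall_mean P z \<le> (\<integral>y. pen_pos y \<partial>dlaw P)"
  unfolding shortfall_mean_def
  by (intro integral_mono shortfall_cost_integrable pen_pos_integrable shortfall_cost_le) auto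

lemma running_bound:
  assumes [measurable]: "v \<in> borel_measurable borel" and M: "\<And>z. \<bar>v z\<bar> \<le> M"
  obtains R where "\<And>i z. lmin P \<le> z \<Longrightarrow> \<bar>running P i v z\<bar> \<le> R"
proof -
  obtain H where H: "0 \<le> H" "\<And>i z. hold_rate P i z \<le> H" using hold_rate_bound by blast
  show ?thesis
  proof (rule that)
    fix i z assume z: "lmin P \<le> z"
    have "\<bar>running P i v z\<bar> \<le> \<bar>lam P * (jump_mean P v z + shortfall_mean P z)\<bar> + \<bar>hold_rate P i z\<bar>"
      unfolding running_def by (rule abs_triangle_ineq)
    also have "\<dots> \<le> lam P * (M + (\<integral>y. pen_pos y \<partial>dlaw P)) + H"
      unfolding abs_mult using lam_pos jump_mean_bounded(2)[of v M z] M shortfall_mean_le[OF z]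
        shortfall_mean_nonneg[of z] H hold_rate_nonneg[of i z]
      by (intro add_mono mult_mono) auto
    finally show "\<bar>running P i v z\<bar> \<le> lam P * (M + (\<integral>y. pen_pos y \<partial>dlaw P)) + H" .
  qed
qed

text \<open>The test function enters the jump terms only through an average over the demand, and
  \<open>\<phi>\<close> exceeds \<open>v\<close> by at most \<open>e\<close>; since the law has mass
  one, replacing it by \<open>v\<close> there costs at most \<open>lam P * e\<close>. Derivative and
  discount term keep \<open>\<phi>\<close>.\<close>

lemma hjb_op_le:
  assumes \<phi>: "continuous_on {lmin P..cap P} \<phi>" and z: "z \<in> {lmin P..<cap P}" and i: "i \<in> {1, 2}"
    and d: "(\<phi> has_real_derivative d) (at z within {lmin P..cap P})"
    and [measurable]: "v \<in> borel_measurable borel" and vM: "\<And>z. \<bar>v z\<bar> \<le> M"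
    and le: "\<And>s. s \<in> {lmin P..cap P} \<Longrightarrow> \<phi> s \<le> v s + e"
  shows "hjb_op P i \<phi> z \<le> rate P i * d - (lam P + disc P) * \<phi> z + running P i v z + lam P * e"
proof -
  let ?c = "z - lmin P"
  have vd: "vector_derivative \<phi> (at z within {lmin P..cap P}) = d"
  proof (rule vector_derivative_within)
    show "at z within {lmin P..cap P} \<noteq> bot"
      using z lmin_less_cap by (simp add: trivial_limit_within islimpt_Icc)
  qed (use d in \<open>simp add: has_real_derivative_iff_has_vector_derivative\<close>)
  have c1: "continuous_on {0..?c} (\<lambda>a. \<phi> (z - a))"
    using z by (intro continuous_on_compose2[OF \<phi>] continuous_intros) auto
  have m1[measurable]: "(\<lambda>a. indicator {0..?c} a *\<^sub>R \<phi> (z - a)) \<in> borel_measurable borel"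
    by (rule borel_measurable_continuous_on_indicator[OF _ c1]) simp
  obtain B where B: "\<forall>x\<in>{lmin P..cap P}. \<bar>\<phi> x\<bar> \<le> B"
    using compact_imp_bounded[OF compact_continuous_image[OF \<phi>]] unfolding bounded_iff by auto
  have i1: "integrable (dlaw P) (\<lambda>a. indicator {0..?c} a *\<^sub>R \<phi> (z - a))"
  proof (rule demand.integrable_const_bound[of _ "\<bar>B\<bar>"])
    have "norm (indicator {0..?c} a *\<^sub>R \<phi> (z - a)) \<le> \<bar>B\<bar>" for a
      using B[rule_format, of "z - a"] z by (auto simp: indicator_def)
    then show "AE a in dlaw P. norm (indicator {0..?c} a *\<^sub>R \<phi> (z - a)) \<le> \<bar>B\<bar>" by simp
  qed (subst measurable_cong_sets[OF sets_dlaw refl], rule m1)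
  have i2: "integrable (dlaw P) (\<lambda>a. indicator {?c<..} a * \<phi> (lmin P))"
    by (rule demand.integrable_const_bound[of _ "\<bar>\<phi> (lmin P)\<bar>"]) (auto simp: indicator_def)
  have "1 - cdf (dlaw P) ?c = measure (dlaw P) {?c<..}"
    using demand.prob_compl[of "{..?c}"] by (simp add: cdf_def Compl_eq_Diff_UNIV[symmetric])
  then have tail: "\<phi> (lmin P) * (1 - cdf (dlaw P) ?c) = (\<integral>a. indicator {?c<..} a * \<phi> (lmin P) \<partial>dlaw P)"
    by simp
  have "set_lebesgue_integral (dlaw P) {0..?c} (\<lambda>a. \<phi> (z - a)) + \<phi> (lmin P) * (1 - cdf (dlaw P) ?c)
     = (\<integral>a. indicator {0..?c} a *\<^sub>R \<phi> (z - a) + indicator {?c<..} a * \<phi> (lmin P) \<partial>dlaw P)"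
    unfolding set_lebesgue_integral_def tail
    by (rule Bochner_Integration.integral_add[OF i1 i2, symmetric])
  also have "\<dots> \<le> (\<integral>a. v (served P z a) + e \<partial>dlaw P)"
  proof (rule integral_mono_AE)
    show "integrable (dlaw P) (\<lambda>a. v (served P z a) + e)"
      using jump_mean_bounded(1)[of v M z] vM by simp
    \<comment> \<open>For positive demands the two indicators separate the fully served ones from
      those that empty the storage; nonpositive demands form a null set.\<close>
    show "AE a in dlaw P. indicator {0..?c} a *\<^sub>R \<phi> (z - a) + indicator {?c<..} a * \<phi> (lmin P)
       \<le> v (served P z a) + e"
      using AE_dlaw_pos
    proof eventually_elim
      case (elim a)
      show ?case
      proof (cases "a \<le> ?c")
        case True
        then show ?thesis using elim z le[of "z - a"] by (auto simp: served_def)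
      next
        case False
        then show ?thesis using elim z le[of "lmin P"] by (auto simp: served_def)
      qed
    qed
  qed (use i1 i2 in simp)
  also have "\<dots> = jump_mean P v z + e"
    using jump_mean_bounded(1)[of v M z] vM demand.prob_space unfolding jump_mean_def by simp
  finally have 1: "set_lebesgue_integral (dlaw P) {0..?c} (\<lambda>a. \<phi> (z - a)) + \<phi> (lmin P) * (1 - cdf (dlaw P) ?c)
    \<le> jump_mean P v z + e" .
  have 2: "set_lebesgue_integral (dlaw P) {?c<..} (\<lambda>a. pen P (a - z + lmin P)) = shortfall_mean P z"
    unfolding set_lebesgue_integral_def shortfall_mean_def
    by (intro Bochner_Integration.integral_cong refl) (auto simp: shortfall_cost_def algebra_simps)
  have 3: "hold_rate P i z = hold P i z" using i z by (auto simp: hold_rate_def)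
  have "hjb_op P i \<phi> z = rate P i * d - (lam P + disc P) * \<phi> z
     + lam P * (set_lebesgue_integral (dlaw P) {0..?c} (\<lambda>a. \<phi> (z - a)) + \<phi> (lmin P) * (1 - cdf (dlaw P) ?c))
     + lam P * shortfall_mean P z + hold P i z"
    unfolding hjb_op_def vd 2 by (simp add: algebra_simps)
  also have "\<dots> \<le> rate P i * d - (lam P + disc P) * \<phi> z
     + lam P * (jump_mean P v z + e) + lam P * shortfall_mean P z + hold P i z"
    using 1 lam_pos by simp
  also have "\<dots> = rate P i * d - (lam P + disc P) * \<phi> z + running P i v z + lam P * e"
    unfolding running_def 3 by (simp add: algebra_simps)
  finally show ?thesis .
qed

lemma rate_pos: "i \<in> {1, 2} \<Longrightarrow> 0 < rate P i"
  using rates by auto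

text \<open>The weight is the discount factor expressed in the level variable; it absorbs the term
  \<open>- disc P * v z\<close> of the operator.\<close>

lemma hjb_integral_inequality:
  assumes i: "i \<in> {1, 2}" and v: "continuous_on UNIV v" and M: "\<And>z. \<bar>v z\<bar> \<le> M"
    and super: "\<And>x \<phi>. x \<in> {lmin P<..<cap P} \<Longrightarrow> C1_on (lmin P) (cap P) \<phi> \<Longrightarrow> \<phi> x = v x \<Longrightarrow>
       (\<And>y. y \<in> {lmin P..cap P} \<Longrightarrow> v y \<le> \<phi> y) \<Longrightarrow> 0 \<le> hjb_op P i \<phi> x"
    and xy: "lmin P \<le> x" "x \<le> y" "y \<le> cap P"
  shows "set_lebesgue_integral lborel {x..y}
      (\<lambda>z. exp (- disc P * z / rate P i) * (lam P * v z - running P i v z) / rate P i)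
    \<le> exp (- disc P * y / rate P i) * v y - exp (- disc P * x / rate P i) * v x"
proof (cases "x = y")
  case True
  have "AE z in lborel. z \<noteq> y" by (rule AE_lborel_singleton)
  then have "set_lebesgue_integral lborel {x..y}
      (\<lambda>z. exp (- disc P * z / rate P i) * (lam P * v z - running P i v z) / rate P i) = 0"
    unfolding set_lebesgue_integral_def
    by (intro integral_eq_zero_AE, elim eventually_mono) (simp add: True indicator_def)
  then show ?thesis unfolding True by linarith
next
  case False
  then have xy': "x < y" using xy by simp
  let ?\<sigma> = "rate P i" and ?q = "disc P"
  have \<sigma>: "0 < ?\<sigma>" using i by (rule rate_pos)
  have [measurable]: "v \<in> borel_measurable borel" using v by (rule borel_measurable_continuous_onI)
  define k where "k z = indicator {lmin P<..<cap P} z *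
      (exp (- ?q * z / ?\<sigma>) * (lam P * v z - running P i v z) / ?\<sigma>)" for z
  \<comment> \<open>A monotone function has countably many discontinuities. Clamping at
    \<open>lmin P\<close> makes the mean shortfall antitone on the whole line, and the sign makes it
    monotone.\<close>
  define N where "N = {a. \<not> isCont (\<lambda>z. - shortfall_mean P (max (lmin P) z)) a} \<union> hold_discont P i"
  define u where "u z = exp (- ?q * z / ?\<sigma>) * v z" for z
  obtain R where R: "\<And>i z. lmin P \<le> z \<Longrightarrow> \<bar>running P i v z\<bar> \<le> R" using running_bound[of v M] M by auto
  have "set_lebesgue_integral lborel {x..y} k \<le> u y - u x"
  proof (rule viscosity_increment[OF xy'])
    show "continuous_on {x..y} u" unfolding u_def
      using \<sigma> by (intro continuous_intros continuous_on_subset[OF v]) auto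
    show "k \<in> borel_measurable borel" unfolding k_def by measurable
    show "\<bar>k s\<bar> \<le> exp (- ?q * lmin P / ?\<sigma>) * (lam P * M + \<bar>R\<bar>) / ?\<sigma>" for s
    proof (cases "s \<in> {lmin P<..<cap P}")
      case True
      have "\<bar>lam P * v s - running P i v s\<bar> \<le> \<bar>lam P * v s\<bar> + \<bar>running P i v s\<bar>" by simp
      also have "\<dots> \<le> lam P * M + \<bar>R\<bar>"
        unfolding abs_mult using lam_pos M[of s] R[of s i] True by (intro add_mono mult_mono) auto
      finally have 1: "\<bar>lam P * v s - running P i v s\<bar> \<le> lam P * M + \<bar>R\<bar>" .
      have 2: "exp (- ?q * s / ?\<sigma>) \<le> exp (- ?q * lmin P / ?\<sigma>)"
        using True \<sigma> disc_pos by (simp add: field_simps)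
      have "\<bar>k s\<bar> = exp (- ?q * s / ?\<sigma>) * \<bar>lam P * v s - running P i v s\<bar> / ?\<sigma>"
        using True \<sigma> by (simp add: k_def abs_mult)
      also have "\<dots> \<le> exp (- ?q * lmin P / ?\<sigma>) * (lam P * M + \<bar>R\<bar>) / ?\<sigma>"
        using 1 2 \<sigma> by (intro divide_right_mono mult_mono) auto
      finally show ?thesis .
    next
      case False
      have "0 \<le> M" using M[of 0] by linarith
      then show ?thesis using False \<sigma> lam_pos by (simp add: k_def)
    qed
    have "mono (\<lambda>z. - shortfall_mean P (max (lmin P) z))"
      by (intro monoI) (auto intro!: shortfall_mean_antimono)
    then show "countable N"
      unfolding N_def using hold_discont[OF i] by (simp add: mono_ctble_discont countable_finite)
    show "isCont k s" if s: "x < s" "s < y" "s \<notin> N" for s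
    proof -
      have s': "s \<in> {lmin P<..<cap P}" using s xy by auto
      have "isCont (\<lambda>z. - shortfall_mean P (max (lmin P) z)) s" using s by (auto simp: N_def)
      then have c1: "isCont (\<lambda>z. shortfall_mean P (max (lmin P) z)) s"
        using continuous_minus[of "at s" "\<lambda>z. - shortfall_mean P (max (lmin P) z)"] by simp
      have "continuous (at s within {lmin P..<cap P}) (hold P i)"
        using s s' by (auto simp: N_def hold_discont_def)
      then have c2: "isCont (hold P i) s"
        using s' at_within_interior[of s "{lmin P..<cap P}"] by simp
      have c3: "isCont v s" using v by (simp add: continuous_on_eq_continuous_at)
      have "isCont (\<lambda>z. exp (- ?q * z / ?\<sigma>) * (lam P * v z - (lam P * (jump_mean P v z
         + shortfall_mean P (max (lmin P) z)) + hold P i z)) / ?\<sigma>) s"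
        using \<sigma> by (intro continuous_intros c1 c2 c3 isCont_jump_mean[OF v, of M] M) auto
      then show ?thesis
        by (rule isCont_cong[THEN iffD1, rotated])
         (use s' i in \<open>auto simp: k_def running_def hold_rate_def max_def
           intro!: eventually_mono[OF eventually_nhds_in_open[of "{lmin P<..<cap P}"]]\<close>)
    qed
    fix z \<phi> \<phi>'
    assume z: "x < z" "z < y" and \<phi>: "\<And>s. (\<phi> has_real_derivative \<phi>' s) (at s)" "continuous_on UNIV \<phi>'"
      and touch: "\<phi> z = u z" "\<And>s. s \<in> {x..y} \<Longrightarrow> u s \<le> \<phi> s"
    have z': "lmin P < z" "z < cap P" using z xy by auto
    \<comment> \<open>Divided by the weight, the touching function touches \<open>v\<close>; the
      term with \<open>?q\<close> that the product rule puts into \<open>\<theta>'\<close> cancels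
      the discount term of the operator.\<close>
    define \<theta> where "\<theta> s = exp (?q * s / ?\<sigma>) * \<phi> s" for s
    define \<theta>' where "\<theta>' s = exp (?q * s / ?\<sigma>) * (\<phi>' s + ?q / ?\<sigma> * \<phi> s)" for s
    have cancel: "exp (?q * s / ?\<sigma>) * exp (- ?q * s / ?\<sigma>) = 1" for s by (simp flip: exp_add)
    have \<phi>c: "continuous_on A \<phi>" for A
      by (intro continuous_at_imp_continuous_on ballI) (rule DERIV_isCont[OF \<phi>(1)])
    have \<theta>: "(\<theta> has_real_derivative \<theta>' s) (at s)" for s
      unfolding \<theta>_def \<theta>'_def using \<sigma> by (auto intro!: derivative_eq_intros \<phi>(1) simp: field_simps)
    have \<theta>c: "continuous_on UNIV \<theta>'"
      unfolding \<theta>'_def using \<sigma> by (intro continuous_intros \<phi>(2) \<phi>c) auto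
    have \<theta>v: "\<theta> z = v z" using cancel[of z] touch(1) by (simp add: \<theta>_def u_def mult.assoc[symmetric])
    define r where "r = min (z - x) (y - z)"
    have r: "0 < r" using z by (simp add: r_def)
    have \<theta>le: "v s \<le> \<theta> s" if "\<bar>s - z\<bar> < r" for s
    proof -
      have "exp (?q * s / ?\<sigma>) * u s \<le> \<theta> s"
        unfolding \<theta>_def using that by (intro mult_left_mono touch(2)) (auto simp: r_def)
      then show ?thesis using cancel[of s] by (simp add: u_def mult.assoc[symmetric])
    qed
    \<comment> \<open>\<open>\<theta>\<close> bounds \<open>v\<close> only near \<open>z\<close>.
      The glued test function stays within \<open>\<epsilon> / lam P\<close> of \<open>v\<close> on
      the whole interval, so the jump terms are off by at most \<open>\<epsilon>\<close>, which is
      arbitrary.\<close>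
    have "0 \<le> (?\<sigma> * \<theta>' z - (lam P + ?q) * v z + running P i v z) + \<epsilon>" if "0 < \<epsilon>" for \<epsilon>
    proof -
      have e: "0 < \<epsilon> / lam P" using that lam_pos by simp
      obtain \<Phi> where \<Phi>: "C1_on (lmin P) (cap P) \<Phi>" "\<Phi> z = v z" "(\<Phi> has_real_derivative \<theta>' z) (at z)"
         "\<And>s. s \<in> {lmin P..cap P} \<Longrightarrow> v s \<le> \<Phi> s" "\<And>s. s \<in> {lmin P..cap P} \<Longrightarrow> \<Phi> s \<le> v s + \<epsilon> / lam P"
        using test_function_near[OF z' continuous_on_subset[OF v] \<theta> \<theta>c r \<theta>v \<theta>le e] by auto
      have "0 \<le> hjb_op P i \<Phi> z" using z' \<Phi> by (intro super) auto
      also have "\<dots> \<le> ?\<sigma> * \<theta>' z - (lam P + ?q) * \<Phi> z + running P i v z + lam P * (\<epsilon> / lam P)"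
      proof (rule hjb_op_le[OF _ _ i])
        show "continuous_on {lmin P..cap P} \<Phi>"
          using \<Phi>(1) unfolding C1_on_def by (auto intro: DERIV_continuous_on)
      qed (use z' \<Phi> M in \<open>auto intro: has_field_derivative_at_within\<close>)
      finally show ?thesis using lam_pos \<Phi>(2) by simp
    qed
    then have "0 \<le> ?\<sigma> * \<theta>' z - (lam P + ?q) * v z + running P i v z"
      by (rule field_le_epsilon)
    then have "lam P * v z - running P i v z \<le> ?\<sigma> * (exp (?q * z / ?\<sigma>) * \<phi>' z) + ?q * (\<theta> z - v z)"
      using \<sigma> by (simp add: \<theta>'_def \<theta>_def algebra_simps)
    then have "lam P * v z - running P i v z \<le> ?\<sigma> * (exp (?q * z / ?\<sigma>) * \<phi>' z)"
      using \<theta>v by simp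
    then have "exp (- ?q * z / ?\<sigma>) * (lam P * v z - running P i v z)
       \<le> exp (- ?q * z / ?\<sigma>) * (?\<sigma> * (exp (?q * z / ?\<sigma>) * \<phi>' z))"
      by (intro mult_left_mono) auto
    also have "\<dots> = ?\<sigma> * \<phi>' z" using cancel[of z] by (simp add: mult_ac)
    finally show "k z \<le> \<phi>' z" using z' \<sigma> by (simp add: k_def field_simps)
  qed
  also have "set_lebesgue_integral lborel {x..y} k = set_lebesgue_integral lborel {x..y}
      (\<lambda>z. exp (- disc P * z / rate P i) * (lam P * v z - running P i v z) / rate P i)"
  proof (rule set_lebesgue_integral_cong_AE)
    have "AE s in lborel. s \<notin> {lmin P, cap P}"
      by (intro AE_not_in countable_imp_null_set_lborel) simp
    then show "AE s in lborel. s \<in> {x..y} \<longrightarrow> k s =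
       exp (- disc P * s / rate P i) * (lam P * v s - running P i v s) / rate P i"
      by eventually_elim (use xy in \<open>auto simp: k_def\<close>)
  qed (auto simp: k_def)
  finally show ?thesis unfolding u_def .
qed

text \<open>The substitution \<open>z = x + rate P i * (r - s)\<close> turns levels into times.
  Multiplication by \<open>?E\<close> normalizes the weight in the level variable to the discount
  factor in time.\<close>

lemma hjb_time_inequality:
  assumes i: "i \<in> {1, 2}" and v: "continuous_on UNIV v" and M: "\<And>z. \<bar>v z\<bar> \<le> M"
    and super: "\<And>x \<phi>. x \<in> {lmin P<..<cap P} \<Longrightarrow> C1_on (lmin P) (cap P) \<phi> \<Longrightarrow> \<phi> x = v x \<Longrightarrow>
       (\<And>y. y \<in> {lmin P..cap P} \<Longrightarrow> v y \<le> \<phi> y) \<Longrightarrow> 0 \<le> hjb_op P i \<phi> x"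
    and st: "s \<le> t" and x: "lmin P \<le> x" "x + rate P i * (t - s) \<le> cap P"
  shows "exp (- disc P * s) * v x \<le> exp (- disc P * t) * v (x + rate P i * (t - s)) +
    set_lebesgue_integral lborel {s..t} (\<lambda>r. exp (- disc P * r) *
      (running P i v (x + rate P i * (r - s)) - lam P * v (x + rate P i * (r - s))))"
proof -
  let ?\<sigma> = "rate P i" and ?q = "disc P"
  have \<sigma>: "0 < ?\<sigma>" using i by (rule rate_pos)
  let ?y = "x + ?\<sigma> * (t - s)"
  let ?E = "exp (?q * x / ?\<sigma> - ?q * s)"
  define g where "g z = lam P * v z - running P i v z" for z
  have le: "set_lebesgue_integral lborel {x..?y} (\<lambda>z. exp (- ?q * z / ?\<sigma>) * g z / ?\<sigma>)
    \<le> exp (- ?q * ?y / ?\<sigma>) * v ?y - exp (- ?q * x / ?\<sigma>) * v x"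
    unfolding g_def using st \<sigma> x by (intro hjb_integral_inequality[OF i v M super]) auto
  have "set_lebesgue_integral lborel {x..?y} (\<lambda>z. exp (- ?q * z / ?\<sigma>) * g z / ?\<sigma>)
     = ?\<sigma> * (\<integral>r. indicator {x..?y} ((x - ?\<sigma> * s) + ?\<sigma> * r) *
          (exp (- ?q * ((x - ?\<sigma> * s) + ?\<sigma> * r) / ?\<sigma>) * g ((x - ?\<sigma> * s) + ?\<sigma> * r) / ?\<sigma>) \<partial>lborel)"
    unfolding set_lebesgue_integral_def
    using \<sigma> by (subst lborel_integral_real_affine[of ?\<sigma> _ "x - ?\<sigma> * s"]) auto
  also have "\<dots> = (\<integral>r. indicator {s..t} r *\<^sub>R (exp (- ?q * r) * exp (?q * s - ?q * x / ?\<sigma>) *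
       g (x + ?\<sigma> * (r - s))) \<partial>lborel)"
    unfolding integral_mult_right_zero[symmetric]
  proof (intro Bochner_Integration.integral_cong refl)
    fix r
    have a1: "indicator {x..?y} ((x - ?\<sigma> * s) + ?\<sigma> * r) = (indicator {s..t} r :: real)"
      using \<sigma> by (auto simp: indicator_def algebra_simps)
    have a2: "exp (- ?q * ((x - ?\<sigma> * s) + ?\<sigma> * r) / ?\<sigma>) = exp (- ?q * r) * exp (?q * s - ?q * x / ?\<sigma>)"
      using \<sigma> by (simp add: field_simps flip: exp_add)
    have a3: "(x - ?\<sigma> * s) + ?\<sigma> * r = x + ?\<sigma> * (r - s)" by (simp add: algebra_simps)
    show "?\<sigma> * (indicator {x..?y} ((x - ?\<sigma> * s) + ?\<sigma> * r) *
          (exp (- ?q * ((x - ?\<sigma> * s) + ?\<sigma> * r) / ?\<sigma>) * g ((x - ?\<sigma> * s) + ?\<sigma> * r) / ?\<sigma>))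
      = indicator {s..t} r *\<^sub>R (exp (- ?q * r) * exp (?q * s - ?q * x / ?\<sigma>) * g (x + ?\<sigma> * (r - s)))"
      unfolding a1 unfolding a2 unfolding a3 using \<sigma> by simp
  qed
  also have "\<dots> = exp (?q * s - ?q * x / ?\<sigma>) *
      set_lebesgue_integral lborel {s..t} (\<lambda>r. exp (- ?q * r) * g (x + ?\<sigma> * (r - s)))"
    unfolding set_lebesgue_integral_def integral_mult_right_zero[symmetric]
    by (intro Bochner_Integration.integral_cong refl) simp
  finally have sub: "?E * set_lebesgue_integral lborel {x..?y} (\<lambda>z. exp (- ?q * z / ?\<sigma>) * g z / ?\<sigma>)
     = set_lebesgue_integral lborel {s..t} (\<lambda>r. exp (- ?q * r) * g (x + ?\<sigma> * (r - s)))"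
    by (simp add: mult.assoc[symmetric] flip: exp_add)
  have "?E * set_lebesgue_integral lborel {x..?y} (\<lambda>z. exp (- ?q * z / ?\<sigma>) * g z / ?\<sigma>)
     \<le> ?E * (exp (- ?q * ?y / ?\<sigma>) * v ?y - exp (- ?q * x / ?\<sigma>) * v x)"
    using le by (intro mult_left_mono) auto
  also have "\<dots> = (?E * exp (- ?q * ?y / ?\<sigma>)) * v ?y - (?E * exp (- ?q * x / ?\<sigma>)) * v x"
    by (simp add: algebra_simps)
  also have "?E * exp (- ?q * ?y / ?\<sigma>) = exp (- ?q * t)"
    using \<sigma> by (simp add: field_simps flip: exp_add)
  also have "?E * exp (- ?q * x / ?\<sigma>) = exp (- ?q * s)"
    using \<sigma> by (simp add: field_simps flip: exp_add)
  finally have "set_lebesgue_integral lborel {s..t} (\<lambda>r. exp (- ?q * r) * g (x + ?\<sigma> * (r - s)))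
    \<le> exp (- ?q * t) * v ?y - exp (- ?q * s) * v x" unfolding sub .
  moreover have "set_lebesgue_integral lborel {s..t} (\<lambda>r. exp (- ?q * r) * g (x + ?\<sigma> * (r - s)))
     = - set_lebesgue_integral lborel {s..t} (\<lambda>r. exp (- ?q * r) *
      (running P i v (x + ?\<sigma> * (r - s)) - lam P * v (x + ?\<sigma> * (r - s))))"
    unfolding set_lebesgue_integral_def integral_minus[symmetric]
    by (intro Bochner_Integration.integral_cong refl) (simp add: g_def algebra_simps)
  ultimately show ?thesis by simp
qed

end

section \<open>Paths of an admissible strategy\<close>

text \<open>Left limits of phase and inventory. \<open>prelevel P S x n t\<close> is the left limit only for
  \<open>t\<close> between the arrivals \<open>n\<close> (excluded) and \<open>Suc n\<close> (included).\<close>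

definition prephase :: "'w strategy \<Rightarrow> real \<Rightarrow> 'w \<Rightarrow> nat" where
  "prephase S t \<omega> = swphase S (LEAST k. ereal t \<le> swtime S (Suc k) \<omega>) \<omega>"

definition prelevel ::
    "('w, 'z) inventory_model_scheme \<Rightarrow> 'w strategy \<Rightarrow> real \<Rightarrow> nat \<Rightarrow> real \<Rightarrow> 'w \<Rightarrow> real" where
  "prelevel P S x n t \<omega> = level_after P S x \<omega> n + produced P S (arr P n \<omega>) t \<omega>"

lemma level_before_Suc: "level_before P S x \<omega> (Suc n) = prelevel P S x n (arr P (Suc n) \<omega>) \<omega>"
  by (simp add: level_before_def prelevel_def)

lemma level_after_Suc:
  "level_after P S x \<omega> (Suc n) = served P (level_before P S x \<omega> (Suc n)) (dem P (Suc n) \<omega>)"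
  by (simp add: level_before_def served_def Let_def)

section \<open>Arrival counting and integrals over time\<close>

context production_inventory
begin

lemma arr_strict: "\<omega> \<in> space (pspace P) \<Longrightarrow> m < n \<Longrightarrow> arr P m \<omega> < arr P n \<omega>"
  using strict_mono_Suc_iff[of "\<lambda>n. arr P n \<omega>"] arr_mono by (auto simp: strict_mono_def)

lemma arr_le_iff: "\<omega> \<in> space (pspace P) \<Longrightarrow> arr P m \<omega> \<le> arr P n \<omega> \<longleftrightarrow> m \<le> n"
  using arr_strict[of \<omega> m n] arr_strict[of \<omega> n m] by (metis linorder_not_less nle_le order_less_imp_le)

lemma arr_nonneg: "\<omega> \<in> space (pspace P) \<Longrightarrow> 0 \<le> arr P n \<omega>"
  using arr_le_iff[of \<omega> 0 n] arr_0[of \<omega>] by simp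

lemma num_arrivals_eqI:
  assumes \<omega>: "\<omega> \<in> space (pspace P)" and t: "arr P n \<omega> \<le> t" "t < arr P (Suc n) \<omega>"
  shows "num_arrivals P t \<omega> = n"
proof -
  have "{m. 1 \<le> m \<and> arr P m \<omega> \<le> t} = {1..n}"
  proof (intro set_eqI iffI)
    fix m assume "m \<in> {m. 1 \<le> m \<and> arr P m \<omega> \<le> t}"
    then have "1 \<le> m" "arr P m \<omega> < arr P (Suc n) \<omega>" using t by auto
    then show "m \<in> {1..n}" using arr_le_iff[OF \<omega>, of "Suc n" m] by (auto simp: not_le[symmetric])
  next
    fix m assume "m \<in> {1..n}"
    then show "m \<in> {m. 1 \<le> m \<and> arr P m \<omega> \<le> t}" using arr_le_iff[OF \<omega>, of m n] t by auto
  qed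
  then show ?thesis by (simp add: num_arrivals_def)
qed

lemma arrival_interval:
  assumes \<omega>: "\<omega> \<in> space (pspace P)" and t: "0 \<le> t"
  obtains n where "arr P n \<omega> \<le> t" "t < arr P (Suc n) \<omega>"
proof -
  have "\<exists>n. t < arr P n \<omega>"
    using arr_unbounded[OF \<omega>] unfolding filterlim_at_top_dense eventually_sequentially by blast
  then obtain n where n: "t < arr P n \<omega>" "\<And>m. m < n \<Longrightarrow> \<not> t < arr P m \<omega>"
    using exists_least_iff[of "\<lambda>n. t < arr P n \<omega>"] by blast
  have "n \<noteq> 0" using n(1) t arr_0[OF \<omega>] by (metis not_less)
  then obtain m where "n = Suc m" by (cases n) auto
  then show ?thesis using n(1) n(2)[of m] by (intro that[of m]) auto
qed

lemma exp_set_integral: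
  assumes "s \<le> t"
  shows "set_lebesgue_integral lborel {s..t} (\<lambda>r. exp (- disc P * r)) =
     (exp (- disc P * s) - exp (- disc P * t)) / disc P"
proof -
  have "(LBINT r. indicator {s..t} r *\<^sub>R exp (- disc P * r)) =
     - exp (- disc P * t) / disc P - (- exp (- disc P * s) / disc P)"
    using assms disc_pos
    by (intro integral_FTC_Icc)
      (auto intro!: derivative_eq_intros continuous_intros simp: has_real_derivative_iff_has_vector_derivative[symmetric])
  then show ?thesis by (simp add: set_lebesgue_integral_def diff_divide_distrib)
qed

lemma set_integrable_bounded:
  fixes f :: "real \<Rightarrow> real"
  assumes [measurable]: "f \<in> borel_measurable borel" and B: "\<And>r. r \<in> {s..t} \<Longrightarrow> \<bar>f r\<bar> \<le> B"
  shows "set_integrable lborel {s..t} f"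
  unfolding set_integrable_def
proof (rule Bochner_Integration.integrable_bound)
  show "integrable lborel (\<lambda>r. indicator {s..t} r *\<^sub>R B)" by (cases "s \<le> t") auto
  show "AE r in lborel. norm (indicator {s..t} r *\<^sub>R f r) \<le> norm (indicator {s..t} r *\<^sub>R B)"
    using B by (intro AE_I2) (auto simp: indicator_def intro: order_trans[OF _ abs_ge_self])
qed measurable

lemma set_integral_split:
  fixes f :: "real \<Rightarrow> real"
  assumes "set_integrable lborel {s..t} f" "s \<le> r" "r \<le> t"
  shows "set_lebesgue_integral lborel {s..t} f =
    set_lebesgue_integral lborel {s..r} f + set_lebesgue_integral lborel {r..t} f"
proof -
  have 1: "set_integrable lborel {s..r} f" "set_integrable lborel {r..t} f"
    using assms by (auto intro: set_integrable_subset)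
  have "AE x in lborel. x \<noteq> r" by (rule AE_lborel_singleton)
  then have "AE x in lborel. \<not> (x \<in> {s..r} \<and> x \<in> {r..t})" by eventually_elim auto
  then have "set_lebesgue_integral lborel ({s..r} \<union> {r..t}) f =
    set_lebesgue_integral lborel {s..r} f + set_lebesgue_integral lborel {r..t} f"
    by (intro set_integral_Un_AE 1) auto
  moreover have "{s..r} \<union> {r..t} = {s..t}" using assms by auto
  ultimately show ?thesis by simp
qed

end

locale admissible_strategy = production_inventory P for P :: "'w inventory_model" +
  fixes S :: "'w strategy" and x :: real and i :: nat
  assumes adm: "S \<in> admissible P x i"
    and start: "i \<in> {1, 2} \<and> x \<in> {lmin P..<cap P} \<or> i = 0 \<and> x = cap P"
begin

context
  fixes \<omega> assumes \<omega>: "\<omega> \<in> space (pspace P)"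
begin

lemma swtime_0: "swtime S 0 \<omega> = 0"
  and swphase_0: "swphase S 0 \<omega> = i"
  and swtime_Suc_le: "swtime S k \<omega> \<le> swtime S (Suc k) \<omega>"
  and swtime_less_Suc: "1 \<le> k \<Longrightarrow> swtime S k \<omega> < \<infinity> \<Longrightarrow> swtime S k \<omega> < swtime S (Suc k) \<omega>"
  and swtime_unbounded: "\<exists>k. ereal t < swtime S k \<omega>"
  and swphase_range: "swphase S k \<omega> \<in> {0, 1, 2}"
  and swphase_neq: "swtime S (Suc k) \<omega> < \<infinity> \<Longrightarrow> swphase S (Suc k) \<omega> \<noteq> swphase S k \<omega>"
  and inventory_le: "0 \<le> t \<Longrightarrow> inventory P S x t \<omega> \<le> cap P"
  and phase_below: "0 \<le> t \<Longrightarrow> inventory P S x t \<omega> < cap P \<Longrightarrow> phase S t \<omega> \<in> {1, 2}"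
  and phase_full: "0 \<le> t \<Longrightarrow> inventory P S x t \<omega> = cap P \<Longrightarrow> phase S t \<omega> = 0"
  and idle_until: "swtime S k \<omega> = ereal t \<Longrightarrow> swphase S k \<omega> = 0 \<Longrightarrow>
        swtime S (Suc k) \<omega> = ereal (arr P (Suc (num_arrivals P t \<omega>)) \<omega>)"
  using adm \<omega> unfolding admissible_def by auto

lemma swtime_mono: "j \<le> k \<Longrightarrow> swtime S j \<omega> \<le> swtime S k \<omega>"
  by (rule lift_Suc_mono_le[of "\<lambda>k. swtime S k \<omega>"]) (use swtime_Suc_le in auto)

lemma swtime_nonneg: "0 \<le> swtime S k \<omega>"
  using swtime_mono[of 0 k] swtime_0 by simp

lemma phase_eqI:
  assumes "swtime S k \<omega> \<le> ereal t" "ereal t < swtime S (Suc k) \<omega>"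
  shows "phase S t \<omega> = swphase S k \<omega>"
proof -
  have "(LEAST k. ereal t < swtime S (Suc k) \<omega>) = k"
  proof (rule Least_equality)
    fix j assume "ereal t < swtime S (Suc j) \<omega>"
    then have "\<not> Suc j \<le> k" using swtime_mono[of "Suc j" k] assms by auto
    then show "k \<le> j" by simp
  qed fact
  then show ?thesis by (simp add: phase_def)
qed

lemma prephase_eqI:
  assumes "swtime S k \<omega> < ereal t" "ereal t \<le> swtime S (Suc k) \<omega>"
  shows "prephase S t \<omega> = swphase S k \<omega>"
proof -
  have "(LEAST k. ereal t \<le> swtime S (Suc k) \<omega>) = k"
  proof (rule Least_equality)
    fix j assume "ereal t \<le> swtime S (Suc j) \<omega>"
    then have "\<not> Suc j \<le> k" using swtime_mono[of "Suc j" k] assms by auto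
    then show "k \<le> j" by simp
  qed fact
  then show ?thesis by (simp add: prephase_def)
qed

lemma switch_interval:
  assumes "0 \<le> t"
  obtains k where "swtime S k \<omega> \<le> ereal t" "ereal t < swtime S (Suc k) \<omega>"
proof -
  obtain n where n: "ereal t < swtime S n \<omega>" "\<And>m. m < n \<Longrightarrow> \<not> ereal t < swtime S m \<omega>"
    using swtime_unbounded[of t] exists_least_iff[of "\<lambda>n. ereal t < swtime S n \<omega>"] by blast
  have "n \<noteq> 0" using n(1) assms swtime_0 by (metis ereal_less_eq(5) not_less)
  then obtain m where "n = Suc m" by (cases n) auto
  then show ?thesis using n(1) n(2)[of m] by (intro that[of m]) auto
qed

lemma switch_interval_left:
  assumes "0 < t"
  obtains k where "swtime S k \<omega> < ereal t" "ereal t \<le> swtime S (Suc k) \<omega>"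
proof -
  have "\<exists>k. ereal t \<le> swtime S k \<omega>" using swtime_unbounded[of t] less_imp_le by blast
  then obtain n where n: "ereal t \<le> swtime S n \<omega>" "\<And>m. m < n \<Longrightarrow> \<not> ereal t \<le> swtime S m \<omega>"
    using exists_least_iff[of "\<lambda>n. ereal t \<le> swtime S n \<omega>"] by blast
  have "n \<noteq> 0" using n(1) assms swtime_0 by (metis ereal_less_eq(4) not_less zero_ereal_def ereal_less_eq(3))
  then obtain m where "n = Suc m" by (cases n) auto
  then show ?thesis using n(1) n(2)[of m] by (intro that[of m]) auto
qed

lemma finite_switches: "finite {k. swtime S (Suc k) \<omega> \<le> ereal t}"
proof -
  obtain n where "ereal t < swtime S n \<omega>" using swtime_unbounded by blast
  then have "\<not> n \<le> Suc k" if "swtime S (Suc k) \<omega> \<le> ereal t" for k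
    using swtime_mono[of n "Suc k"] that by auto
  then have "{k. swtime S (Suc k) \<omega> \<le> ereal t} \<subseteq> {..n}" by fastforce
  then show ?thesis by (rule finite_subset) simp
qed

lemma phase_range: "phase S t \<omega> \<in> {0, 1, 2}"
  unfolding phase_def by (rule swphase_range)

lemma prephase_range: "prephase S t \<omega> \<in> {0, 1, 2}"
  unfolding prephase_def by (rule swphase_range)

lemma phase_measurable_time [measurable]: "(\<lambda>t. phase S t \<omega>) \<in> measurable borel (count_space UNIV)"
  unfolding phase_def by measurable

lemma prephase_measurable_time [measurable]: "(\<lambda>t. prephase S t \<omega>) \<in> measurable borel (count_space UNIV)"
  unfolding prephase_def by measurable

lemma rate_bounds: "0 \<le> rate P (phase S t \<omega>)" "rate P (phase S t \<omega>) \<le> rate P 1"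
  using phase_range[of t] rates by auto

lemma rate_integrable: "set_integrable lborel {s..t} (\<lambda>u. rate P (phase S u \<omega>))"
  using rate_bounds by (intro set_integrable_bounded[of _ _ _ "rate P 1"]) auto

lemma produced_nonneg: "0 \<le> produced P S s t \<omega>"
  unfolding produced_def set_lebesgue_integral_def
  by (intro Bochner_Integration.integral_nonneg) (auto simp: rate_bounds)

lemma produced_le: "s \<le> t \<Longrightarrow> produced P S s t \<omega> \<le> rate P 1 * (t - s)"
proof -
  assume st: "s \<le> t"
  have "produced P S s t \<omega> \<le> set_lebesgue_integral lborel {s..t} (\<lambda>_. rate P 1)"
    unfolding produced_def
    by (intro set_integral_mono rate_integrable set_integrable_bounded[of _ _ _ "\<bar>rate P 1\<bar>"] rate_bounds) auto
  also have "\<dots> = rate P 1 * (t - s)" using st by (simp add: set_lebesgue_integral_def)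
  finally show ?thesis .
qed

lemma produced_split: "s \<le> r \<Longrightarrow> r \<le> t \<Longrightarrow> produced P S s t \<omega> = produced P S s r \<omega> + produced P S r t \<omega>"
  unfolding produced_def by (rule set_integral_split[OF rate_integrable])

lemma produced_const:
  assumes st: "s \<le> t" and c: "\<And>u. s \<le> u \<Longrightarrow> u < t \<Longrightarrow> phase S u \<omega> = j"
  shows "produced P S s t \<omega> = rate P j * (t - s)"
proof -
  have "AE u in lborel. u \<noteq> t" by (rule AE_lborel_singleton)
  then have "AE u in lborel. u \<in> {s..t} \<longrightarrow> rate P (phase S u \<omega>) = rate P j"
    by eventually_elim (auto simp: c)
  then have "produced P S s t \<omega> = set_lebesgue_integral lborel {s..t} (\<lambda>_. rate P j)"
    unfolding produced_def by (intro set_lebesgue_integral_cong_AE) auto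
  also have "\<dots> = rate P j * (t - s)" using st by (simp add: set_lebesgue_integral_def)
  finally show ?thesis .
qed

lemma prelevel_split:
  "arr P n \<omega> \<le> s \<Longrightarrow> s \<le> t \<Longrightarrow> prelevel P S x n t \<omega> = prelevel P S x n s \<omega> + produced P S s t \<omega>"
  by (simp add: prelevel_def produced_split[of "arr P n \<omega>" s t])

lemma prelevel_arr: "prelevel P S x n (arr P n \<omega>) \<omega> = level_after P S x \<omega> n"
  using produced_le[of "arr P n \<omega>" "arr P n \<omega>"] produced_nonneg[of "arr P n \<omega>" "arr P n \<omega>"]
  by (simp add: prelevel_def)

lemma inventory_prelevel:
  "arr P n \<omega> \<le> t \<Longrightarrow> t < arr P (Suc n) \<omega> \<Longrightarrow> inventory P S x t \<omega> = prelevel P S x n t \<omega>"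
  by (simp add: inventory_def prelevel_def num_arrivals_eqI[OF \<omega>] Let_def)

lemma level_after_ge: "lmin P \<le> level_after P S x \<omega> n"
  by (cases n) (use start lmin_less_cap in \<open>auto simp: Let_def\<close>)

lemma prelevel_ge: "lmin P \<le> prelevel P S x n t \<omega>"
  using level_after_ge[of n] produced_nonneg[of "arr P n \<omega>" t] by (simp add: prelevel_def)

text \<open>Admissibility controls the inventory itself, which at an arrival has already jumped
  down. The left limit at the arrival is reached from earlier times, over which at most
  \<open>rate P 1 * (t - s)\<close> is produced.\<close>

lemma prelevel_le:
  assumes t: "arr P n \<omega> \<le> t" "t \<le> arr P (Suc n) \<omega>"
  shows "prelevel P S x n t \<omega> \<le> cap P"
proof (cases "t = arr P (Suc n) \<omega>")
  case False
  then show ?thesis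
    using t inventory_prelevel[of n t] inventory_le[of t] arr_nonneg[OF \<omega>, of n] by auto
next
  case True
  show ?thesis
  proof (rule field_le_epsilon)
    fix e :: real assume e: "0 < e"
    define s where "s = max (arr P n \<omega>) (t - e / rate P 1)"
    have r1: "0 < rate P 1" using rates by simp
    have s: "arr P n \<omega> \<le> s" "s < t" "t - s \<le> e / rate P 1"
      using arr_mono[OF \<omega>, of n] True e r1 by (auto simp: s_def)
    have "prelevel P S x n t \<omega> = inventory P S x s \<omega> + produced P S s t \<omega>"
      unfolding prelevel_split[OF s(1) less_imp_le[OF s(2)]]
      using s True by (simp add: inventory_prelevel[of n s])
    also have "\<dots> \<le> cap P + rate P 1 * (t - s)"
      using inventory_le[of s] s arr_nonneg[OF \<omega>, of n] by (intro add_mono produced_le) auto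
    also have "\<dots> \<le> cap P + e" using s(3) r1 by (simp add: field_simps)
    finally show "prelevel P S x n t \<omega> \<le> cap P + e" .
  qed
qed

text \<open>Phase 0 prevails on a whole interval before \<open>t\<close>. A level below
  \<open>cap P\<close> would exclude phase 0 at its beginning, and with rate 0 the level does not
  move afterwards.\<close>

lemma prephase_0_imp:
  assumes t: "arr P n \<omega> < t" "t \<le> arr P (Suc n) \<omega>" and 0: "prephase S t \<omega> = 0"
  shows "prelevel P S x n t \<omega> = cap P"
proof -
  have tp: "0 < t" using t arr_nonneg[OF \<omega>, of n] by simp
  then obtain k where k: "swtime S k \<omega> < ereal t" "ereal t \<le> swtime S (Suc k) \<omega>"
    by (rule switch_interval_left)
  have J: "swphase S k \<omega> = 0" using prephase_eqI[OF k] 0 by simp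
  obtain r where r: "swtime S k \<omega> = ereal r" using k(1) swtime_nonneg[of k] by (cases "swtime S k \<omega>") auto
  define s where "s = max (arr P n \<omega>) r"
  have s: "s < t" "arr P n \<omega> \<le> s" "r \<le> s" using t k r by (auto simp: s_def)
  have c: "phase S u \<omega> = 0" if "s \<le> u" "u < t" for u
  proof -
    have "swtime S k \<omega> \<le> ereal u" using r s that by simp
    moreover have "ereal u < swtime S (Suc k) \<omega>" using that(2) k(2) by (intro less_le_trans[OF _ k(2)]) simp
    ultimately show ?thesis using phase_eqI J by simp
  qed
  have s0: "0 \<le> s" using s arr_nonneg[OF \<omega>, of n] by simp
  have i: "inventory P S x s \<omega> = prelevel P S x n s \<omega>" using s t by (intro inventory_prelevel) auto
  have "\<not> inventory P S x s \<omega> < cap P"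
    using phase_below[OF s0] c[of s] s by auto
  then have "prelevel P S x n s \<omega> = cap P" using inventory_le[OF s0] i by simp
  moreover have "produced P S s t \<omega> = 0"
    using produced_const[OF less_imp_le[OF s(1)] c] rates by simp
  ultimately show ?thesis
    using prelevel_split[of n s t] s by simp
qed

lemma level_before_le: "level_before P S x \<omega> (Suc n) \<le> cap P" "lmin P \<le> level_before P S x \<omega> (Suc n)"
  unfolding level_before_Suc using arr_mono[OF \<omega>, of n] by (auto intro!: prelevel_le prelevel_ge)

lemma level_after_less: "level_after P S x \<omega> (Suc n) < cap P"
  using level_before_le[of n] dem_pos[OF \<omega>, of "Suc n"] lmin_less_cap
  unfolding level_after_Suc served_def by auto

lemma hold_eq_hold_rate:
  assumes t: "0 \<le> t"
  shows "hold P (phase S t \<omega>) (inventory P S x t \<omega>) = hold_rate P (phase S t \<omega>) (inventory P S x t \<omega>)"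
proof (cases "inventory P S x t \<omega> = cap P")
  case True
  then show ?thesis using phase_full[OF t] by (simp add: hold_rate_def)
next
  case False
  obtain n where "arr P n \<omega> \<le> t" "t < arr P (Suc n) \<omega>" by (rule arrival_interval[OF \<omega> t])
  then have "lmin P \<le> inventory P S x t \<omega>" using prelevel_ge[of n t] inventory_prelevel[of n t] by simp
  moreover have "inventory P S x t \<omega> < cap P" using False inventory_le[OF t] by simp
  ultimately show ?thesis using phase_below[OF t] by (auto simp: hold_rate_def)
qed

text \<open>Phases attached to infinite switching times may repeat, and \<open>swc P\<close> has no
  sign on the diagonal; there the discount factor 0 saves the claim.\<close>

lemma switch_cost_nonneg:
  "0 \<le> disc_at P (swtime S (Suc k) \<omega>) * swc P (swphase S k \<omega>) (swphase S (Suc k) \<omega>)"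
proof (cases "swtime S (Suc k) \<omega> = \<infinity>")
  case True
  then show ?thesis by (simp add: disc_at_def)
next
  case False
  then have "swphase S (Suc k) \<omega> \<noteq> swphase S k \<omega>" using swphase_neq[of k] by simp
  then have "0 \<le> swc P (swphase S k \<omega>) (swphase S (Suc k) \<omega>)"
    using swphase_range by (intro swc_nonneg) auto
  then show ?thesis by (simp add: disc_at_def)
qed

text \<open>A positive demand brings the level strictly below \<open>cap P\<close>, so the idle
  phase always ends with an arrival.\<close>

lemma phase_arr: "phase S (arr P (Suc n) \<omega>) \<omega> \<in> {1, 2}"
  using level_after_less[of n] inventory_prelevel[of "Suc n" "arr P (Suc n) \<omega>"] arr_mono[OF \<omega>, of "Suc n"]
    arr_nonneg[OF \<omega>, of "Suc n"]
  by (intro phase_below) (auto simp: prelevel_arr)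

lemma phase_prephase:
  assumes "0 < t" "\<And>k. swtime S (Suc k) \<omega> \<noteq> ereal t"
  shows "phase S t \<omega> = prephase S t \<omega>"
proof -
  obtain k where k: "swtime S k \<omega> < ereal t" "ereal t \<le> swtime S (Suc k) \<omega>"
    using assms(1) by (rule switch_interval_left)
  then have "ereal t < swtime S (Suc k) \<omega>" using assms(2)[of k] by (metis order_le_less)
  then show ?thesis using phase_eqI[of k t] prephase_eqI[OF k] k by simp
qed

lemma switch_at:
  assumes t: "0 < t" "swtime S (Suc k) \<omega> = ereal t"
  shows "prephase S t \<omega> = swphase S k \<omega>" "phase S t \<omega> = swphase S (Suc k) \<omega>"
    "swtime S k \<omega> < ereal t"
proof -
  show 1: "swtime S k \<omega> < ereal t"
  proof (cases "k = 0")
    case True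
    then show ?thesis using swtime_0 t by simp
  next
    case False
    then have "1 \<le> k" by simp
    moreover have "swtime S k \<omega> < \<infinity>"
      using le_less_trans[of "swtime S k \<omega>" "ereal t" "\<infinity>"] swtime_Suc_le[of k] t(2) by simp
    ultimately show ?thesis using swtime_less_Suc[of k] unfolding t(2) by blast
  qed
  show "prephase S t \<omega> = swphase S k \<omega>" using 1 t by (intro prephase_eqI) auto
  show "phase S t \<omega> = swphase S (Suc k) \<omega>"
    using swtime_less_Suc[of "Suc k"] t by (intro phase_eqI) auto
qed

end

end

text \<open>What the lower bound uses of \<open>w\<close> and \<open>w0_cap\<close>, with
  \<open>w\<close> extended to bounded continuous functions on the whole line. The last assumption
  is a balance at full storage: \<open>disc P * v0\<close> equals the idle holding rate plus
  \<open>lam P\<close> times the mean of penalty and change of value at a demand.\<close>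

locale hjb_candidate = production_inventory P for P :: "'w inventory_model" +
  fixes v :: "nat \<Rightarrow> real \<Rightarrow> real" and v0 M :: real
  assumes v_cont: "\<And>j. j \<in> {1, 2} \<Longrightarrow> continuous_on UNIV (v j)"
    and v_bound: "\<And>j z. j \<in> {1, 2} \<Longrightarrow> \<bar>v j z\<bar> \<le> M"
    and v_super: "\<And>j x \<phi>. j \<in> {1, 2} \<Longrightarrow> x \<in> {lmin P<..<cap P} \<Longrightarrow> C1_on (lmin P) (cap P) \<phi> \<Longrightarrow> \<phi> x = v j x \<Longrightarrow>
       (\<And>y. y \<in> {lmin P..cap P} \<Longrightarrow> v j y \<le> \<phi> y) \<Longrightarrow> 0 \<le> hjb_op P j \<phi> x"
    and v_switch: "\<And>z. z \<in> {lmin P..cap P} \<Longrightarrow> v 1 z \<le> v 2 z + swc P 1 2"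
      "\<And>z. z \<in> {lmin P..cap P} \<Longrightarrow> v 2 z \<le> v 1 z + swc P 2 1"
    and v_fill: "v 1 (cap P) \<le> v0 + swc P 1 0" "v 2 (cap P) \<le> v0 + swc P 2 0"
    and v0_eq: "(disc P + lam P) * v0 = running P 0 (wbar P v) (cap P)"
begin

definition val :: "nat \<Rightarrow> real \<Rightarrow> real" where
  "val j z = (if j = 0 then v0 else if j = 1 then v 1 z else v 2 z)"

text \<open>The value just after a demand, the phase being the one before it: the idle phase has to be left.\<close>

definition restart :: "nat \<Rightarrow> real \<Rightarrow> real" where
  "restart j = (if j = 0 then wbar P v else if j = 1 then v 1 else v 2)"

lemma v_measurable [measurable]: "v 1 \<in> borel_measurable borel" "v (Suc 0) \<in> borel_measurable borel" "v 2 \<in> borel_measurable borel"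
  using v_cont[of 1] v_cont[of 2] by (auto intro: borel_measurable_continuous_onI)

lemma restart_measurable [measurable]: "restart j \<in> borel_measurable borel"
  unfolding restart_def wbar_def[abs_def] by (auto intro!: borel_measurable_min borel_measurable_add)

lemma val_measurable [measurable]: "val j \<in> borel_measurable borel"
  unfolding val_def[abs_def] by auto

definition bnd :: real where
  "bnd = \<bar>v0\<bar> + \<bar>M\<bar> + \<bar>swc P 0 1\<bar> + \<bar>swc P 0 2\<bar>"

lemma val_bound: "\<bar>val j z\<bar> \<le> bnd"
  using v_bound[of 1 z] v_bound[of 2 z] by (auto simp: val_def bnd_def)

lemma restart_bound: "\<bar>restart j z\<bar> \<le> bnd"
  using v_bound[of 1 z] v_bound[of 2 z] by (auto simp: restart_def bnd_def wbar_def min_def)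

lemma running_restart_bound: obtains R where "\<And>j z. lmin P \<le> z \<Longrightarrow> \<bar>running P j (restart j) z\<bar> \<le> R"
proof -
  have "\<exists>R. \<forall>j z. lmin P \<le> z \<longrightarrow> \<bar>running P j (restart k) z\<bar> \<le> R" for k
    by (rule running_bound[OF restart_measurable restart_bound]) blast
  then obtain R where R: "\<And>k j z. lmin P \<le> z \<Longrightarrow> \<bar>running P j (restart k) z\<bar> \<le> R k"
    by metis
  show ?thesis
  proof (rule that)
    fix j :: nat and z assume z: "lmin P \<le> z"
    have "restart j = restart 0 \<or> restart j = restart 1 \<or> restart j = restart 2"
      by (simp add: restart_def)
    then show "\<bar>running P j (restart j) z\<bar> \<le> \<bar>R 0\<bar> + \<bar>R 1\<bar> + \<bar>R 2\<bar>"
      using R[OF z, of j 0] R[OF z, of j 1] R[OF z, of j 2] by (elim disjE) simp_all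
  qed
qed

end

section \<open>The candidate along a path\<close>

locale hjb_verification = hjb_candidate P v v0 M + admissible_strategy P S x i
  for P :: "'w inventory_model" and v v0 M S x i
begin

text \<open>Holding and mean penalty rate plus \<open>lam P\<close> times the mean change of value
  at a demand, discounted. Subtracting the actual changes \<open>jump\<close> at the arrivals
  leaves, in expectation, the holding and penalty cost alone.\<close>

definition drift :: "nat \<Rightarrow> 'w \<Rightarrow> real \<Rightarrow> real" where
  "drift n \<omega> t = exp (- disc P * t) *
     (running P (prephase S t \<omega>) (restart (prephase S t \<omega>)) (prelevel P S x n t \<omega>)
      - lam P * val (prephase S t \<omega>) (prelevel P S x n t \<omega>))"

definition scost :: "'w \<Rightarrow> nat \<Rightarrow> real" where
  "scost \<omega> k = disc_at P (swtime S (Suc k) \<omega>) * swc P (swphase S k \<omega>) (swphase S (Suc k) \<omega>)"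

definition jump :: "nat \<Rightarrow> 'w \<Rightarrow> real" where
  "jump n \<omega> = restart (prephase S (arr P (Suc n) \<omega>) \<omega>)
       (served P (level_before P S x \<omega> (Suc n)) (dem P (Suc n) \<omega>))
     - val (prephase S (arr P (Suc n) \<omega>) \<omega>) (level_before P S x \<omega> (Suc n))"

context
  fixes \<omega> assumes \<omega>: "\<omega> \<in> space (pspace P)"
begin

lemma prelevel_measurable_time [measurable]: "(\<lambda>t. prelevel P S x n t \<omega>) \<in> borel_measurable borel"
proof -
  have [measurable]: "(\<lambda>t. phase S t \<omega>) \<in> measurable borel (count_space UNIV)"
    by (rule phase_measurable_time[OF \<omega>])
  have "(\<lambda>t. \<integral>u. (if arr P n \<omega> \<le> u \<and> u \<le> t then rate P (phase S u \<omega>) else 0) \<partial>lborel) \<in> borel_measurable borel"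
    by measurable
  also have "(\<lambda>t. \<integral>u. (if arr P n \<omega> \<le> u \<and> u \<le> t then rate P (phase S u \<omega>) else 0) \<partial>lborel)
     = (\<lambda>t. produced P S (arr P n \<omega>) t \<omega>)"
    unfolding produced_def set_lebesgue_integral_def
    by (intro ext Bochner_Integration.integral_cong refl) (auto simp: indicator_def)
  finally show ?thesis unfolding prelevel_def by measurable
qed

lemma drift_measurable [measurable]: "drift n \<omega> \<in> borel_measurable borel"
proof -
  have [measurable]: "(\<lambda>t. prephase S t \<omega>) \<in> measurable borel (count_space UNIV)"
    by (rule prephase_measurable_time[OF \<omega>])
  have [measurable]: "(\<lambda>t. running P (prephase S t \<omega>) (restart (prephase S t \<omega>)) (prelevel P S x n t \<omega>)) \<in> borel_measurable borel"
    by (rule measurable_compose_countable[where f="\<lambda>j t. running P j (restart j) (prelevel P S x n t \<omega>)"]) measurable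
  have [measurable]: "(\<lambda>t. val (prephase S t \<omega>) (prelevel P S x n t \<omega>)) \<in> borel_measurable borel"
    by (rule measurable_compose_countable[where f="\<lambda>j t. val j (prelevel P S x n t \<omega>)"]) measurable
  show ?thesis unfolding drift_def by measurable
qed

lemma drift_integrable: "set_integrable lborel {s..t} (drift n \<omega>)"
proof -
  obtain R where R: "\<And>j z. lmin P \<le> z \<Longrightarrow> \<bar>running P j (restart j) z\<bar> \<le> R"
    using running_restart_bound by blast
  show ?thesis
  proof (rule set_integrable_bounded[OF drift_measurable])
    fix r assume r: "r \<in> {s..t}"
    let ?j = "prephase S r \<omega>" and ?z = "prelevel P S x n r \<omega>"
    have "\<bar>running P ?j (restart ?j) ?z - lam P * val ?j ?z\<bar> \<le> \<bar>running P ?j (restart ?j) ?z\<bar> + \<bar>lam P * val ?j ?z\<bar>"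
      by simp
    also have "\<dots> \<le> R + lam P * bnd"
      unfolding abs_mult using R[OF prelevel_ge[OF \<omega>], of ?j n r] lam_pos val_bound[of ?j ?z]
      by (intro add_mono mult_mono) auto
    finally have "\<bar>running P ?j (restart ?j) ?z - lam P * val ?j ?z\<bar> \<le> R + lam P * bnd" .
    moreover have "exp (- disc P * r) \<le> exp (- disc P * s)" using r disc_pos by simp
    ultimately show "\<bar>drift n \<omega> r\<bar> \<le> exp (- disc P * s) * (R + lam P * bnd)"
      unfolding drift_def abs_mult by (intro mult_mono) auto
  qed
qed

text \<open>Without a switch in between the level is affine in time. A productive piece is the
  integrated equation; in an idle piece the level stays at \<open>cap P\<close>,
  \<open>drift\<close> is \<open>disc P * v0\<close> times the discount factor, and equality
  holds.\<close>

lemma piece_inequality: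
  assumes st: "arr P n \<omega> \<le> s" "s < t" "t \<le> arr P (Suc n) \<omega>"
    and k: "swtime S k \<omega> \<le> ereal s" "ereal t \<le> swtime S (Suc k) \<omega>"
  shows "exp (- disc P * s) * val (phase S s \<omega>) (prelevel P S x n s \<omega>)
    \<le> exp (- disc P * t) * val (prephase S t \<omega>) (prelevel P S x n t \<omega>)
      + set_lebesgue_integral lborel {s..t} (drift n \<omega>)"
proof -
  define j where "j = swphase S k \<omega>"
  have ph: "phase S u \<omega> = j" if "s \<le> u" "u < t" for u
  proof -
    have "swtime S k \<omega> \<le> ereal u" by (rule order_trans[OF k(1)]) (use that in simp)
    moreover have "ereal u < swtime S (Suc k) \<omega>" by (rule less_le_trans[OF _ k(2)]) (use that in simp)
    ultimately show ?thesis unfolding j_def by (rule phase_eqI[OF \<omega>])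
  qed
  have pre: "prephase S u \<omega> = j" if "s < u" "u \<le> t" for u
  proof -
    have "swtime S k \<omega> < ereal u" by (rule le_less_trans[OF k(1)]) (use that in simp)
    moreover have "ereal u \<le> swtime S (Suc k) \<omega>" by (rule order_trans[OF _ k(2)]) (use that in simp)
    ultimately show ?thesis unfolding j_def by (rule prephase_eqI[OF \<omega>])
  qed
  have lev: "prelevel P S x n u \<omega> = prelevel P S x n s \<omega> + rate P j * (u - s)" if "s \<le> u" "u \<le> t" for u
    using prelevel_split[OF \<omega> st(1) that(1)] produced_const[OF \<omega> that(1), of j] ph that by simp
  have j: "j \<in> {0, 1, 2}" unfolding j_def by (rule swphase_range[OF \<omega>])
  let ?x = "prelevel P S x n s \<omega>"
  \<comment> \<open>At \<open>s\<close> itself \<open>prephase\<close> may still show the phase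
    before a switch at \<open>s\<close>.\<close>
  have "AE u in lborel. u \<noteq> s" by (rule AE_lborel_singleton)
  then have "AE u in lborel. u \<in> {s..t} \<longrightarrow> drift n \<omega> u = exp (- disc P * u) *
      (running P j (restart j) (?x + rate P j * (u - s)) - lam P * val j (?x + rate P j * (u - s)))"
  proof eventually_elim
    case (elim u)
    show ?case
    proof
      assume u: "u \<in> {s..t}"
      have l: "prelevel P S x n u \<omega> = ?x + rate P j * (u - s)" by (rule lev) (use u in auto)
      have p: "prephase S u \<omega> = j" by (rule pre) (use u elim in auto)
      show "drift n \<omega> u = exp (- disc P * u) *
        (running P j (restart j) (?x + rate P j * (u - s)) - lam P * val j (?x + rate P j * (u - s)))"
        unfolding drift_def l p ..
    qed
  qed
  then have int: "set_lebesgue_integral lborel {s..t} (drift n \<omega>) =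
     set_lebesgue_integral lborel {s..t} (\<lambda>u. exp (- disc P * u) *
      (running P j (restart j) (?x + rate P j * (u - s)) - lam P * val j (?x + rate P j * (u - s))))"
    by (intro set_lebesgue_integral_cong_AE) measurable
  have ends: "phase S s \<omega> = j" "prephase S t \<omega> = j" "prelevel P S x n t \<omega> = ?x + rate P j * (t - s)"
    using ph[of s] pre[of t] lev[of t] st by auto
  show ?thesis
  proof (cases "j = 0")
    case True
    have "prelevel P S x n t \<omega> = cap P" using prephase_0_imp[OF \<omega>, of n t] st pre[of t] True by auto
    then have x: "?x = cap P" using ends(3) True rates by simp
    have "set_lebesgue_integral lborel {s..t} (drift n \<omega>)
       = set_lebesgue_integral lborel {s..t} (\<lambda>u. disc P * v0 * exp (- disc P * u))"
      unfolding int using x rates(1)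
      by (intro set_lebesgue_integral_cong) (auto simp: True restart_def val_def v0_eq[symmetric] algebra_simps)
    also have "\<dots> = v0 * (exp (- disc P * s) - exp (- disc P * t))"
      using exp_set_integral[of s t] st disc_pos by simp
    finally show ?thesis using ends True by (simp add: val_def algebra_simps)
  next
    case False
    then have j12: "j \<in> {1, 2}" using j by auto
    then have eq: "restart j = v j" "val j = v j" by (auto simp: restart_def val_def[abs_def])
    have "prelevel P S x n t \<omega> \<le> cap P" using st by (intro prelevel_le[OF \<omega>]) auto
    then show ?thesis
      unfolding ends int eq
      using st prelevel_ge[OF \<omega>, of n s] ends(3)
      by (intro hjb_time_inequality[OF j12 v_cont[OF j12] v_bound[OF j12] v_super[OF j12]]) auto
  qed
qed

lemma scost_eq: "swtime S (Suc k) \<omega> = ereal t \<Longrightarrow>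
    scost \<omega> k = exp (- disc P * t) * swc P (swphase S k \<omega>) (swphase S (Suc k) \<omega>)"
  by (simp add: scost_def disc_at_def)

text \<open>Strictly between two arrivals there are only two kinds of switches: between phases 1 and
  2, or into the idle phase at full storage. Each is covered by one of the inequalities assumed of
  the candidate.\<close>

lemma switch_inequality:
  assumes t: "arr P n \<omega> < t" "t < arr P (Suc n) \<omega>" and k: "swtime S (Suc k) \<omega> = ereal t"
  shows "exp (- disc P * t) * val (prephase S t \<omega>) (prelevel P S x n t \<omega>)
    \<le> exp (- disc P * t) * val (phase S t \<omega>) (prelevel P S x n t \<omega>) + scost \<omega> k"
proof -
  have t0: "0 < t" using t arr_nonneg[OF \<omega>, of n] by simp
  note sw = switch_at[OF \<omega> t0 k]
  let ?a = "prephase S t \<omega>" and ?c = "phase S t \<omega>" and ?z = "prelevel P S x n t \<omega>"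
  have inv: "inventory P S x t \<omega> = ?z" using t by (intro inventory_prelevel[OF \<omega>]) auto
  have z: "?z \<in> {lmin P..cap P}" using t by (auto intro!: prelevel_ge[OF \<omega>] prelevel_le[OF \<omega>])
  have ac: "?a \<noteq> ?c" "?a \<in> {0, 1, 2}" "?c \<in> {0, 1, 2}"
    using swphase_neq[OF \<omega>, of k] k sw swphase_range[OF \<omega>] by auto
  \<comment> \<open>An idle period can only end at an arrival time, and \<open>t\<close> is
    none.\<close>
  have "?a \<noteq> 0"
  proof
    assume "?a = 0"
    obtain r where r: "swtime S k \<omega> = ereal r"
      using sw(3) swtime_nonneg[OF \<omega>, of k] by (cases "swtime S k \<omega>") auto
    have "ereal t = ereal (arr P (Suc (num_arrivals P r \<omega>)) \<omega>)"
      using idle_until[OF \<omega> r] \<open>?a = 0\<close> sw k by simp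
    then have "t = arr P (Suc (num_arrivals P r \<omega>)) \<omega>" by simp
    then show False using t arr_le_iff[OF \<omega>] by (metis not_less_eq_eq not_le linorder_not_le)
  qed
  \<comment> \<open>The comparison with \<open>v0\<close> is available at full storage only.\<close>
  moreover have "?z = cap P" if "?c = 0"
    using phase_below[OF \<omega>, of t] z that inv t0 by fastforce
  ultimately have "val ?a ?z \<le> val ?c ?z + swc P ?a ?c"
    using ac v_switch[OF z] v_fill by (auto simp: val_def)
  then have "exp (- disc P * t) * val ?a ?z \<le> exp (- disc P * t) * (val ?c ?z + swc P ?a ?c)"
    by (intro mult_left_mono) auto
  then show ?thesis using scost_eq[OF k] sw by (simp add: algebra_simps)
qed

lemma finite_switches_between: "finite {k. ereal s < swtime S (Suc k) \<omega> \<and> swtime S (Suc k) \<omega> < ereal t}"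
  by (rule finite_subset[OF _ finite_switches[OF \<omega>, of t]]) auto

text \<open>Induction on the number of switches strictly inside: cut at any one of them, use the
  hypothesis on both sides and \<open>switch_inequality\<close> at the cut.\<close>

lemma interval_inequality:
  assumes "arr P n \<omega> \<le> s" "s < t" "t \<le> arr P (Suc n) \<omega>"
  shows "exp (- disc P * s) * val (phase S s \<omega>) (prelevel P S x n s \<omega>)
    \<le> exp (- disc P * t) * val (prephase S t \<omega>) (prelevel P S x n t \<omega>)
      + set_lebesgue_integral lborel {s..t} (drift n \<omega>)
      + (\<Sum>k | ereal s < swtime S (Suc k) \<omega> \<and> swtime S (Suc k) \<omega> < ereal t. scost \<omega> k)"
  using assms
proof (induction "card {k. ereal s < swtime S (Suc k) \<omega> \<and> swtime S (Suc k) \<omega> < ereal t}"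
    arbitrary: s t rule: less_induct)
  case (less s t)
  let ?A = "\<lambda>s t. {k. ereal s < swtime S (Suc k) \<omega> \<and> swtime S (Suc k) \<omega> < ereal t}"
  show ?case
  proof (cases "?A s t = {}")
    case True
    have "0 \<le> s" using less.prems arr_nonneg[OF \<omega>, of n] by simp
    then obtain k where k: "swtime S k \<omega> \<le> ereal s" "ereal s < swtime S (Suc k) \<omega>"
      by (rule switch_interval[OF \<omega>])
    then have "ereal t \<le> swtime S (Suc k) \<omega>" using True by (auto simp: not_less[symmetric])
    then show ?thesis using piece_inequality[OF less.prems k(1)] unfolding True by simp
  next
    case False
    then obtain k where k: "ereal s < swtime S (Suc k) \<omega>" "swtime S (Suc k) \<omega> < ereal t" by auto
    then obtain r where r: "swtime S (Suc k) \<omega> = ereal r" "s < r" "r < t"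
      by (cases "swtime S (Suc k) \<omega>") auto
    have r0: "0 < r" using less.prems arr_nonneg[OF \<omega>, of n] r by simp
    \<comment> \<open>Switching times after 0 are strictly increasing, so the cut removes exactly
      one index from the sum.\<close>
    have uniq: "k' = k" if "swtime S (Suc k') \<omega> = ereal r" for k'
    proof -
      have "swtime S k \<omega> < ereal r" "swtime S k' \<omega> < ereal r"
        using switch_at(3)[OF \<omega> r0] r that by auto
      then have "\<not> Suc k \<le> k'" "\<not> Suc k' \<le> k"
        using swtime_mono[OF \<omega>, of "Suc k" k'] swtime_mono[OF \<omega>, of "Suc k'" k] r that by auto
      then show ?thesis by simp
    qed
    have part: "?A s t = insert k (?A s r \<union> ?A r t)"
    proof (intro set_eqI iffI)
      fix j assume j: "j \<in> ?A s t"
      then obtain u where u: "swtime S (Suc j) \<omega> = ereal u" by (cases "swtime S (Suc j) \<omega>") auto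
      then show "j \<in> insert k (?A s r \<union> ?A r t)" using j uniq[of j] by (cases u r rule: linorder_cases) auto
    next
      fix j assume "j \<in> insert k (?A s r \<union> ?A r t)"
      then show "j \<in> ?A s t" using r k
        by (auto intro: less_trans[of "ereal s" "ereal r"] less_trans[of _ "ereal r" "ereal t"])
    qed
    have disj: "k \<notin> ?A s r \<union> ?A r t" "?A s r \<inter> ?A r t = {}" using r by auto
    have fin: "finite (?A s t)" for s t by (rule finite_switches_between)
    have sub: "?A s r \<subset> ?A s t" "?A r t \<subset> ?A s t"
      unfolding part using disj by blast+
    have sum: "sum (scost \<omega>) (?A s t) = scost \<omega> k + (sum (scost \<omega>) (?A s r) + sum (scost \<omega>) (?A r t))"
      unfolding part using disj fin by (simp add: sum.union_disjoint)
    have 1: "exp (- disc P * s) * val (phase S s \<omega>) (prelevel P S x n s \<omega>)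
      \<le> exp (- disc P * r) * val (prephase S r \<omega>) (prelevel P S x n r \<omega>)
      + set_lebesgue_integral lborel {s..r} (drift n \<omega>) + sum (scost \<omega>) (?A s r)"
      using less.prems r by (intro less.hyps psubset_card_mono fin sub) auto
    have 2: "exp (- disc P * r) * val (phase S r \<omega>) (prelevel P S x n r \<omega>)
      \<le> exp (- disc P * t) * val (prephase S t \<omega>) (prelevel P S x n t \<omega>)
      + set_lebesgue_integral lborel {r..t} (drift n \<omega>) + sum (scost \<omega>) (?A r t)"
      using less.prems r by (intro less.hyps psubset_card_mono fin sub) auto
    have 3: "exp (- disc P * r) * val (prephase S r \<omega>) (prelevel P S x n r \<omega>)
      \<le> exp (- disc P * r) * val (phase S r \<omega>) (prelevel P S x n r \<omega>) + scost \<omega> k"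
      using less.prems r by (intro switch_inequality) auto
    have 4: "set_lebesgue_integral lborel {s..t} (drift n \<omega>) =
       set_lebesgue_integral lborel {s..r} (drift n \<omega>) + set_lebesgue_integral lborel {r..t} (drift n \<omega>)"
      using r by (intro set_integral_split drift_integrable) auto
    show ?thesis unfolding 4 sum using 1 2 3 by linarith
  qed
qed

text \<open>The demand changes the level first and the strategy may react at the same instant.
  \<open>restart\<close> is the value between these two events: for phases 1 and 2 a reaction costs
  at least the gain in value, and for the idle phase the minimum in \<open>wbar\<close> already
  contains the cost of the forced switch.\<close>

lemma arrival_inequality:
  defines "t \<equiv> \<lambda>n. arr P (Suc n) \<omega>"
  shows "exp (- disc P * t n) * val (prephase S (t n) \<omega>) (level_before P S x \<omega> (Suc n))
   \<le> exp (- disc P * t n) * (val (phase S (t n) \<omega>) (level_after P S x \<omega> (Suc n)) - jump n \<omega>)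
     + (\<Sum>k | swtime S (Suc k) \<omega> = ereal (t n). scost \<omega> k)"
proof -
  let ?t = "arr P (Suc n) \<omega>"
  let ?a = "prephase S ?t \<omega>" and ?c = "phase S ?t \<omega>" and ?z = "level_after P S x \<omega> (Suc n)"
  have t0: "0 < ?t" using arr_strict[OF \<omega>, of 0 "Suc n"] arr_0[OF \<omega>] by simp
  have c: "?c \<in> {1, 2}" by (rule phase_arr[OF \<omega>])
  have z: "?z \<in> {lmin P..cap P}"
    using level_after_ge[OF \<omega>, of "Suc n"] level_after_less[OF \<omega>, of n] by simp
  have eq: "val ?a (level_before P S x \<omega> (Suc n)) = restart ?a ?z - jump n \<omega>"
    unfolding jump_def level_after_Suc by simp
  have "exp (- disc P * ?t) * restart ?a ?z \<le>
    exp (- disc P * ?t) * val ?c ?z + (\<Sum>k | swtime S (Suc k) \<omega> = ereal ?t. scost \<omega> k)"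
  proof (cases "\<exists>k. swtime S (Suc k) \<omega> = ereal ?t")
    case False
    then have "?c = ?a" by (intro phase_prephase[OF \<omega> t0]) auto
    then show ?thesis using c False by (auto simp: restart_def val_def)
  next
    case True
    then obtain k where k: "swtime S (Suc k) \<omega> = ereal ?t" by auto
    note sw = switch_at[OF \<omega> t0 k]
    have "k' = k" if "swtime S (Suc k') \<omega> = ereal ?t" for k'
    proof -
      have "swtime S k' \<omega> < ereal ?t" using switch_at(3)[OF \<omega> t0 that] .
      then have "\<not> Suc k \<le> k'" "\<not> Suc k' \<le> k"
        using swtime_mono[OF \<omega>, of "Suc k" k'] swtime_mono[OF \<omega>, of "Suc k'" k] sw(3) k that by auto
      then show ?thesis by simp
    qed
    then have set: "{k. swtime S (Suc k) \<omega> = ereal ?t} = {k}" using k by blast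
    have ac: "?a \<noteq> ?c" "?a \<in> {0, 1, 2}"
      using swphase_neq[OF \<omega>, of k] k sw swphase_range[OF \<omega>] by auto
    then have "restart ?a ?z \<le> val ?c ?z + swc P ?a ?c"
      using c v_switch[OF z] by (auto simp: val_def restart_def wbar_def)
    then have "exp (- disc P * ?t) * restart ?a ?z \<le> exp (- disc P * ?t) * (val ?c ?z + swc P ?a ?c)"
      by (intro mult_left_mono) auto
    then show ?thesis unfolding set using scost_eq[OF k] sw by (simp add: algebra_simps)
  qed
  then show ?thesis unfolding t_def eq by (simp add: algebra_simps)
qed

text \<open>Interval and arrival inequalities telescope over the arrivals. The last sum counts all
  switches up to the last arrival considered, including those that coincide with an arrival.\<close>

lemma path_inequality:
  "val i x \<le> exp (- disc P * arr P N \<omega>) * val (phase S (arr P N \<omega>) \<omega>) (level_after P S x \<omega> N)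
     + (\<Sum>n<N. set_lebesgue_integral lborel {arr P n \<omega>..arr P (Suc n) \<omega>} (drift n \<omega>)
          - exp (- disc P * arr P (Suc n) \<omega>) * jump n \<omega>)
     + (\<Sum>k | swtime S (Suc k) \<omega> \<le> ereal (arr P N \<omega>). scost \<omega> k)"
proof (induction N)
  case 0
  show ?case
  proof (cases "swtime S (Suc 0) \<omega> = 0")
    \<comment> \<open>An immediate switch at time 0 is legal and is counted already for
      \<open>N = 0\<close>. It cannot start from the idle phase, whose end is an arrival and thus
      later than 0.\<close>
    case True
    have lt: "ereal 0 < swtime S (Suc (Suc 0)) \<omega>" using swtime_less_Suc[OF \<omega>, of 1] True by (simp add: zero_ereal_def[symmetric])
    have set: "{k. swtime S (Suc k) \<omega> \<le> ereal 0} = {0}"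
    proof -
      have "k = 0" if "swtime S (Suc k) \<omega> \<le> ereal 0" for k
      proof (rule ccontr)
        assume "k \<noteq> 0"
        then have "swtime S (Suc (Suc 0)) \<omega> \<le> swtime S (Suc k) \<omega>" by (intro swtime_mono[OF \<omega>]) simp
        then show False using lt that by auto
      qed
      then show ?thesis using True by auto
    qed
    have ph: "phase S 0 \<omega> = swphase S (Suc 0) \<omega>" using True lt by (intro phase_eqI[OF \<omega>]) auto
    have inv: "inventory P S x 0 \<omega> = x"
      using inventory_prelevel[OF \<omega>, of 0 0] prelevel_arr[OF \<omega>, of 0] arr_0[OF \<omega>] arr_mono[OF \<omega>, of 0] by simp
    have "i \<noteq> 0"
    proof
      assume "i = 0"
      then have "swtime S 1 \<omega> = ereal (arr P (Suc (num_arrivals P 0 \<omega>)) \<omega>)"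
        using idle_until[OF \<omega>, of 0 0] swtime_0[OF \<omega>] swphase_0[OF \<omega>] by simp
      then show False using True arr_strict[OF \<omega>, of 0 "Suc (num_arrivals P 0 \<omega>)"] arr_0[OF \<omega>] by simp
    qed
    then have ix: "i \<in> {1, 2}" "x \<in> {lmin P..<cap P}" using start by auto
    then have c: "phase S 0 \<omega> \<in> {1, 2}" using phase_below[OF \<omega>, of 0] inv by auto
    have ne: "phase S 0 \<omega> \<noteq> i" using swphase_neq[OF \<omega>, of 0] True ph swphase_0[OF \<omega>] by simp
    have "val i x \<le> val (phase S 0 \<omega>) x + swc P i (phase S 0 \<omega>)"
      using ix c ne v_switch[of x] by (auto simp: val_def)
    then show ?thesis
      using scost_eq[of 0 0] True ph swphase_0[OF \<omega>] by (simp add: arr_0[OF \<omega>] set[unfolded zero_ereal_def[symmetric]] zero_ereal_def[symmetric])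
  next
    case False
    then have lt: "ereal 0 < swtime S (Suc 0) \<omega>" using swtime_nonneg[OF \<omega>, of "Suc 0"] by (simp add: order_le_less zero_ereal_def[symmetric])
    have "ereal 0 < swtime S (Suc k) \<omega>" for k
      using lt swtime_mono[OF \<omega>, of "Suc 0" "Suc k"] by (rule less_le_trans) simp
    then have set: "{k. swtime S (Suc k) \<omega> \<le> ereal 0} = {}" by (auto simp: not_le)
    have "phase S 0 \<omega> = i"
      using lt swtime_0[OF \<omega>] swphase_0[OF \<omega>] phase_eqI[OF \<omega>, of 0 0] by simp
    then show ?thesis by (simp add: arr_0[OF \<omega>] set)
  qed
next
  case (Suc N)
  let ?s = "arr P N \<omega>" and ?t = "arr P (Suc N) \<omega>"
  have st: "?s < ?t" by (rule arr_mono[OF \<omega>])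
  have 1: "exp (- disc P * ?s) * val (phase S ?s \<omega>) (level_after P S x \<omega> N)
    \<le> exp (- disc P * ?t) * val (prephase S ?t \<omega>) (level_before P S x \<omega> (Suc N))
      + set_lebesgue_integral lborel {?s..?t} (drift N \<omega>)
      + (\<Sum>k | ereal ?s < swtime S (Suc k) \<omega> \<and> swtime S (Suc k) \<omega> < ereal ?t. scost \<omega> k)"
    using interval_inequality[of N ?s ?t] st unfolding level_before_Suc prelevel_arr[OF \<omega>] by simp
  have fin: "finite {k. swtime S (Suc k) \<omega> \<le> ereal t}" for t by (rule finite_switches[OF \<omega>])
  let ?A = "{k. swtime S (Suc k) \<omega> \<le> ereal ?s}"
  let ?B = "{k. ereal ?s < swtime S (Suc k) \<omega> \<and> swtime S (Suc k) \<omega> < ereal ?t}"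
  let ?C = "{k. swtime S (Suc k) \<omega> = ereal ?t}"
  have set: "{k. swtime S (Suc k) \<omega> \<le> ereal ?t} = (?A \<union> ?B) \<union> ?C"
    using st by (auto intro: order_trans[of _ "ereal ?s"])
  have finC: "finite ?C" by (rule finite_subset[OF _ fin[of ?t]]) auto
  have "sum (scost \<omega>) ((?A \<union> ?B) \<union> ?C) = sum (scost \<omega>) (?A \<union> ?B) + sum (scost \<omega>) ?C"
    using fin finite_switches_between finC st by (intro sum.union_disjoint) auto
  also have "sum (scost \<omega>) (?A \<union> ?B) = sum (scost \<omega>) ?A + sum (scost \<omega>) ?B"
    using fin finite_switches_between by (intro sum.union_disjoint) auto
  finally have 2: "sum (scost \<omega>) {k. swtime S (Suc k) \<omega> \<le> ereal ?t}
    = sum (scost \<omega>) ?A + sum (scost \<omega>) ?B + sum (scost \<omega>) ?C" unfolding set .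
  show ?case
    using Suc.IH 1 arrival_inequality[of N] unfolding 2 by (simp add: algebra_simps)
qed

end

end

section \<open>The past and the compensator of the demands\<close>

context production_inventory
begin

definition gap :: "nat \<Rightarrow> 'w \<Rightarrow> real" where
  "gap n \<omega> = arr P (Suc n) \<omega> - arr P n \<omega>"

definition sources :: "nat + nat \<Rightarrow> 'w \<Rightarrow> real" where
  "sources = case_sum gap (\<lambda>n. dem P (Suc n))"

definition past :: "nat \<Rightarrow> (nat + nat) set" where
  "past n = Inl ` {..<n} \<union> Inr ` {..<n}"

text \<open>The information carried by the first \<open>n\<close> gaps and demands. As a preimage of
  a product sigma-algebra it is independent of the next gap and demand by the joint independence of
  all sources.\<close>

definition history :: "nat \<Rightarrow> 'w measure" where
  "history n = vimage_algebra (space (pspace P)) (\<lambda>\<omega>. restrict (\<lambda>k. sources k \<omega>) (past n))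
     (PiM (past n) (\<lambda>_. borel))"

lemma sources_indep: "indep_vars (\<lambda>_. borel) sources UNIV"
  using indep unfolding sources_def gap_def .

lemma sources_measurable [measurable]: "sources k \<in> borel_measurable (pspace P)"
  using sources_indep unfolding indep_vars_def by auto

lemma gap_measurable [measurable]: "gap n \<in> borel_measurable (pspace P)"
  using sources_measurable[of "Inl n"] by (simp add: sources_def)

lemma space_history [simp]: "space (history n) = space (pspace P)"
  by (simp add: history_def)

lemma history_sources:
  assumes "k \<in> past n" shows "sources k \<in> borel_measurable (history n)"
proof -
  have "(\<lambda>\<omega>. restrict (\<lambda>k. sources k \<omega>) (past n)) \<in> measurable (history n) (PiM (past n) (\<lambda>_. borel))"
    unfolding history_def by (rule measurable_vimage_algebra1) (auto simp: space_PiM)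
  from measurable_compose[OF this measurable_component_singleton[OF assms]]
  show ?thesis using assms by simp
qed

lemma history_gap [measurable (raw)]: "m < n \<Longrightarrow> gap m \<in> borel_measurable (history n)"
  using history_sources[of "Inl m" n] by (simp add: sources_def past_def)

lemma history_dem [measurable (raw)]: "m < n \<Longrightarrow> dem P (Suc m) \<in> borel_measurable (history n)"
  using history_sources[of "Inr m" n] by (simp add: sources_def past_def)

lemma arr_eq_sum: "\<omega> \<in> space (pspace P) \<Longrightarrow> arr P n \<omega> = (\<Sum>m<n. gap m \<omega>)"
  by (induction n) (auto simp: gap_def arr_0)

lemma history_arr [measurable (raw)]: "m \<le> n \<Longrightarrow> arr P m \<in> borel_measurable (history n)"
proof -
  assume "m \<le> n"
  then have "(\<lambda>\<omega>. \<Sum>m<m. gap m \<omega>) \<in> borel_measurable (history n)"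
    by (intro borel_measurable_sum history_gap) auto
  then show ?thesis by (subst measurable_cong[OF arr_eq_sum]) auto
qed

lemma history_subset_Suc: "f \<in> measurable (history n) N \<Longrightarrow> f \<in> measurable (history (Suc n)) N"
proof -
  assume f: "f \<in> measurable (history n) N"
  have "(\<lambda>\<omega>. \<omega>) \<in> measurable (history (Suc n)) (history n)"
    unfolding history_def[of n]
    by (rule measurable_vimage_algebra2) (auto intro!: measurable_restrict history_sources simp: past_def)
  from measurable_compose[OF this f] show ?thesis by simp
qed

lemma id_measurable_history [measurable]: "(\<lambda>\<omega>. \<omega>) \<in> measurable (pspace P) (history n)"
  unfolding history_def by (rule measurable_vimage_algebra2) (auto intro!: measurable_restrict)

lemma history_measurable: "f \<in> measurable (history n) N \<Longrightarrow> f \<in> measurable (pspace P) N"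
  using measurable_compose[OF id_measurable_history] by simp

lemma arr_measurable [measurable]: "arr P n \<in> borel_measurable (pspace P)"
  by (rule history_measurable[OF history_arr[OF order_refl]])

text \<open>The probability restricted to the smaller sigma-algebra, so that past and next arrival
  form a genuine product measure.\<close>

definition past_law :: "nat \<Rightarrow> 'w measure" where
  "past_law n = distr (pspace P) (history n) (\<lambda>\<omega>. \<omega>)"

lemma prob_history_next:
  assumes A: "A \<in> sets (history n)" and B: "B \<in> sets (borel \<Otimes>\<^sub>M borel)"
  shows "prob {\<omega> \<in> A. (gap n \<omega>, dem P (Suc n) \<omega>) \<in> B} = prob A *
     prob {\<omega> \<in> space (pspace P). (gap n \<omega>, dem P (Suc n) \<omega>) \<in> B}"
proof -
  let ?K = "{Inl n, Inr n} :: (nat + nat) set"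
  let ?H = "\<lambda>\<omega>. restrict (\<lambda>k. sources k \<omega>) (past n)"
  let ?N = "\<lambda>\<omega>. restrict (\<lambda>k. sources k \<omega>) ?K"
  have ind: "indep_var (PiM (past n) (\<lambda>_. borel)) ?H (PiM ?K (\<lambda>_. borel)) ?N"
    by (rule indep_var_restrict[OF sources_indep]) (auto simp: past_def)
  obtain A' where A': "A' \<in> sets (PiM (past n) (\<lambda>_. borel))" "A = ?H -` A' \<inter> space (pspace P)"
    using A unfolding history_def by (subst (asm) sets_vimage_algebra2) (auto simp: space_PiM)
  define B' where "B' = (\<lambda>f. (f (Inl n), f (Inr n))) -` B \<inter> space (PiM ?K (\<lambda>_. borel :: real measure))"
  have "(\<lambda>f. (f (Inl n), f (Inr n))) \<in> measurable (PiM ?K (\<lambda>_. borel :: real measure)) (borel \<Otimes>\<^sub>M borel)"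
    by measurable
  then have B': "B' \<in> sets (PiM ?K (\<lambda>_. borel))"
    unfolding B'_def using B by (rule measurable_sets)
  have N: "?N -` B' \<inter> space (pspace P) = {\<omega> \<in> space (pspace P). (gap n \<omega>, dem P (Suc n) \<omega>) \<in> B}"
    by (auto simp: B'_def space_PiM sources_def)
  have "prob ((\<lambda>\<omega>. (?H \<omega>, ?N \<omega>)) -` (A' \<times> B') \<inter> space (pspace P))
     = prob (?H -` A' \<inter> space (pspace P)) * prob (?N -` B' \<inter> space (pspace P))"
    by (rule indep_varD[OF ind A'(1) B'])
  moreover have "(\<lambda>\<omega>. (?H \<omega>, ?N \<omega>)) -` (A' \<times> B') \<inter> space (pspace P)
     = A \<inter> (?N -` B' \<inter> space (pspace P))"
    unfolding A'(2) by auto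
  moreover have "A \<inter> {\<omega> \<in> space (pspace P). (gap n \<omega>, dem P (Suc n) \<omega>) \<in> B} =
     {\<omega> \<in> A. (gap n \<omega>, dem P (Suc n) \<omega>) \<in> B}"
    unfolding A'(2) by auto
  ultimately show ?thesis unfolding N A'(2)[symmetric] by simp
qed

lemma indep_gap_dem: "indep_var borel (gap n) borel (dem P (Suc n))"
proof -
  have "indep_var (PiM {Inl n} (\<lambda>_. borel)) (\<lambda>\<omega>. restrict (\<lambda>k. sources k \<omega>) {Inl n})
      (PiM {Inr n} (\<lambda>_. borel)) (\<lambda>\<omega>. restrict (\<lambda>k. sources k \<omega>) {Inr n})"
    by (rule indep_var_restrict[OF sources_indep]) auto
  then have "indep_var borel ((\<lambda>f. f (Inl n)) \<circ> (\<lambda>\<omega>. restrict (\<lambda>k. sources k \<omega>) {Inl n}))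
     borel ((\<lambda>f. f (Inr n)) \<circ> (\<lambda>\<omega>. restrict (\<lambda>k. sources k \<omega>) {Inr n}))"
    by (rule indep_var_compose) measurable
  then show ?thesis by (simp add: comp_def sources_def)
qed

abbreviation gap_law :: "real measure" where
  "gap_law \<equiv> density lborel (exponential_density (lam P))"

lemma distr_gap: "distr (pspace P) borel (gap n) = gap_law"
proof -
  have "distr (pspace P) lborel (gap n) = gap_law"
    using arr_gaps[of n] unfolding gap_def by (rule distributed_distr_eq_density)
  moreover have "distr (pspace P) lborel (gap n) = distr (pspace P) borel (gap n)"
    by (intro distr_cong) auto
  ultimately show ?thesis by simp
qed

lemma prob_space_gap_law: "prob_space gap_law"
  using prob_space_distr[OF gap_measurable[of 0]] by (simp add: distr_gap)

lemma sets_past_law [simp, measurable_cong]: "sets (past_law n) = sets (history n)"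
  by (simp add: past_law_def)

text \<open>Both measures agree on rectangles, by independence of the past from the next pair and of
  gap and demand within the pair; for sigma-finite factors this determines the product.\<close>

lemma joint_law: "past_law n \<Otimes>\<^sub>M (gap_law \<Otimes>\<^sub>M dlaw P) =
   distr (pspace P) (history n \<Otimes>\<^sub>M (borel \<Otimes>\<^sub>M borel)) (\<lambda>\<omega>. (\<omega>, gap n \<omega>, dem P (Suc n) \<omega>))"
proof (rule pair_measure_eqI)
  have eq: "gap_law \<Otimes>\<^sub>M dlaw P = distr (pspace P) (borel \<Otimes>\<^sub>M borel) (\<lambda>\<omega>. (gap n \<omega>, dem P (Suc n) \<omega>))"
    using indep_gap_dem[of n] unfolding indep_var_distribution_eq by (simp add: distr_gap dem_law)
  show "sigma_finite_measure (past_law n)"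
    unfolding past_law_def by (intro prob_space_imp_sigma_finite prob_space_distr) measurable
  show "sigma_finite_measure (gap_law \<Otimes>\<^sub>M dlaw P)"
    unfolding eq by (intro prob_space_imp_sigma_finite prob_space_distr) measurable
  show "sets (past_law n \<Otimes>\<^sub>M (gap_law \<Otimes>\<^sub>M dlaw P)) = sets (distr (pspace P)
     (history n \<Otimes>\<^sub>M (borel \<Otimes>\<^sub>M borel)) (\<lambda>\<omega>. (\<omega>, gap n \<omega>, dem P (Suc n) \<omega>)))"
    unfolding sets_distr by (intro sets_pair_measure_cong) auto
  fix A B assume "A \<in> sets (past_law n)" "B \<in> sets (gap_law \<Otimes>\<^sub>M dlaw P)"
  then have A: "A \<in> sets (history n)" and B[measurable]: "B \<in> sets (borel \<Otimes>\<^sub>M borel)"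
    unfolding eq by auto
  have AP: "A \<subseteq> space (pspace P)" using sets.sets_into_space[OF A] by simp
  have [measurable]: "A \<in> sets (pspace P)"
    using measurable_sets[OF id_measurable_history A] AP by (simp add: Int_absorb2)
  have [simp]: "{x \<in> A. x \<in> space (pspace P)} = A" using AP by auto
  have "emeasure (past_law n) A * emeasure (gap_law \<Otimes>\<^sub>M dlaw P) B
    = ennreal (prob A) * ennreal (prob {\<omega> \<in> space (pspace P). (gap n \<omega>, dem P (Suc n) \<omega>) \<in> B})"
    unfolding eq past_law_def using A B AP
    by (simp add: emeasure_distr emeasure_eq_measure Int_absorb2 vimage_def Int_def conj_commute)
  also have "\<dots> = ennreal (prob {\<omega> \<in> A. (gap n \<omega>, dem P (Suc n) \<omega>) \<in> B})"
    unfolding prob_history_next[OF A B] by (simp add: ennreal_mult)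
  also have "\<dots> = emeasure (distr (pspace P)
     (history n \<Otimes>\<^sub>M (borel \<Otimes>\<^sub>M borel)) (\<lambda>\<omega>. (\<omega>, gap n \<omega>, dem P (Suc n) \<omega>))) (A \<times> B)"
  proof (subst emeasure_distr)
    show "A \<times> B \<in> sets (history n \<Otimes>\<^sub>M (borel \<Otimes>\<^sub>M borel))" using A B by (rule pair_measureI)
    have "(\<lambda>\<omega>. (\<omega>, gap n \<omega>, dem P (Suc n) \<omega>)) -` (A \<times> B) \<inter> space (pspace P)
      = {\<omega> \<in> A. (gap n \<omega>, dem P (Suc n) \<omega>) \<in> B}" using AP by auto
    then show "ennreal (prob {\<omega> \<in> A. (gap n \<omega>, dem P (Suc n) \<omega>) \<in> B}) =
       emeasure (pspace P) ((\<lambda>\<omega>. (\<omega>, gap n \<omega>, dem P (Suc n) \<omega>)) -` (A \<times> B) \<inter> space (pspace P))"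
      by (simp add: emeasure_eq_measure)
  qed measurable
  finally show "emeasure (past_law n) A * emeasure (gap_law \<Otimes>\<^sub>M dlaw P) B = \<dots>" .
qed

lemma nn_integral_joint:
  assumes [measurable]: "f \<in> borel_measurable (history n \<Otimes>\<^sub>M (borel \<Otimes>\<^sub>M borel))"
  shows "(\<integral>\<^sup>+\<omega>. f (\<omega>, gap n \<omega>, dem P (Suc n) \<omega>) \<partial>pspace P) =
    (\<integral>\<^sup>+\<omega>. (\<integral>\<^sup>+t. ennreal (exponential_density (lam P) t) * (\<integral>\<^sup>+y. f (\<omega>, t, y) \<partial>dlaw P) \<partial>lborel) \<partial>past_law n)"
proof -
  interpret G: prob_space gap_law by (rule prob_space_gap_law)
  interpret GD: pair_prob_space gap_law "dlaw P" ..
  have "(\<integral>\<^sup>+\<omega>. f (\<omega>, gap n \<omega>, dem P (Suc n) \<omega>) \<partial>pspace P)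
     = (\<integral>\<^sup>+z. f z \<partial>distr (pspace P) (history n \<Otimes>\<^sub>M (borel \<Otimes>\<^sub>M borel)) (\<lambda>\<omega>. (\<omega>, gap n \<omega>, dem P (Suc n) \<omega>)))"
    by (subst nn_integral_distr) measurable
  also have "\<dots> = (\<integral>\<^sup>+z. f z \<partial>(past_law n \<Otimes>\<^sub>M (gap_law \<Otimes>\<^sub>M dlaw P)))"
    unfolding joint_law[symmetric] ..
  also have "\<dots> = (\<integral>\<^sup>+\<omega>. (\<integral>\<^sup>+p. f (\<omega>, p) \<partial>(gap_law \<Otimes>\<^sub>M dlaw P)) \<partial>past_law n)"
    by (rule GD.P.nn_integral_fst[symmetric]) measurable
  also have "\<dots> = (\<integral>\<^sup>+\<omega>. (\<integral>\<^sup>+t. (\<integral>\<^sup>+y. f (\<omega>, t, y) \<partial>dlaw P) \<partial>gap_law) \<partial>past_law n)"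
    by (intro nn_integral_cong, subst demand.nn_integral_fst[symmetric]) (auto simp: past_law_def)
  also have "\<dots> = (\<integral>\<^sup>+\<omega>. (\<integral>\<^sup>+t. ennreal (exponential_density (lam P) t) * (\<integral>\<^sup>+y. f (\<omega>, t, y) \<partial>dlaw P) \<partial>lborel) \<partial>past_law n)"
    by (intro nn_integral_cong nn_integral_density) (auto simp: past_law_def)
  finally show ?thesis .
qed

lemma exponential_tail:
  assumes "0 \<le> t"
  shows "(\<integral>\<^sup>+g. ennreal (exponential_density (lam P) g) * indicator {t<..} g \<partial>lborel) = ennreal (exp (- t * lam P))"
proof -
  have "(\<integral>\<^sup>+g. ennreal (exponential_density (lam P) g) * indicator {t<..} g \<partial>lborel) = emeasure gap_law {t<..}"
    by (subst emeasure_density) auto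
  also have "\<dots> = emeasure (distr (pspace P) borel (gap 0)) {t<..}" by (simp add: distr_gap)
  also have "\<dots> = emeasure (pspace P) {\<omega> \<in> space (pspace P). t < gap 0 \<omega>}"
    by (subst emeasure_distr) (auto intro!: arg_cong[where f="emeasure (pspace P)"])
  also have "\<dots> = ennreal (exp (- t * lam P))"
    using exponential_distributedD_gt[OF arr_gaps[of 0] assms lam_pos]
    unfolding gap_def by (simp add: emeasure_eq_measure)
  finally show ?thesis .
qed

text \<open>The exponential density at \<open>t\<close> is \<open>lam P\<close> times the
  probability that the gap exceeds \<open>t\<close>. Fubini therefore trades evaluation at the end
  of the gap for \<open>lam P\<close> times the integral over the gap.\<close>

lemma compensator_step:
  assumes f[measurable]: "f \<in> borel_measurable (history n \<Otimes>\<^sub>M (borel \<Otimes>\<^sub>M borel))"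
  shows "(\<integral>\<^sup>+\<omega>. f (\<omega>, gap n \<omega>, dem P (Suc n) \<omega>) \<partial>pspace P) =
    (\<integral>\<^sup>+\<omega>. (\<integral>\<^sup>+t. indicator {0<..<gap n \<omega>} t * (ennreal (lam P) * (\<integral>\<^sup>+y. f (\<omega>, t, y) \<partial>dlaw P)) \<partial>lborel) \<partial>pspace P)"
proof -
  define F where "F = (\<lambda>(\<omega>, t). \<integral>\<^sup>+y. f (\<omega>, t, y) \<partial>dlaw P)"
  have F[measurable]: "F \<in> borel_measurable (history n \<Otimes>\<^sub>M borel)"
    unfolding F_def by measurable
  have [measurable]: "(\<lambda>z. \<integral>\<^sup>+t. indicator {0<..<fst (snd z)} t * (ennreal (lam P) * F (fst z, t)) \<partial>lborel)
      \<in> borel_measurable (history n \<Otimes>\<^sub>M (borel \<Otimes>\<^sub>M borel))"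
  proof -
    have "(\<lambda>z. \<integral>\<^sup>+t. (if 0 < t \<and> t < fst (snd z) then ennreal (lam P) * F (fst z, t) else 0) \<partial>lborel)
      \<in> borel_measurable (history n \<Otimes>\<^sub>M (borel \<Otimes>\<^sub>M borel))" by measurable
    also have "(\<lambda>z. \<integral>\<^sup>+t. (if 0 < t \<and> t < fst (snd z) then ennreal (lam P) * F (fst z, t) else 0) \<partial>lborel)
       = (\<lambda>z. \<integral>\<^sup>+t. indicator {0<..<fst (snd z)} t * (ennreal (lam P) * F (fst z, t)) \<partial>lborel)"
      by (intro ext nn_integral_cong) (auto simp: indicator_def)
    finally show ?thesis .
  qed
  have "(\<integral>\<^sup>+\<omega>. (\<integral>\<^sup>+t. indicator {0<..<gap n \<omega>} t * (ennreal (lam P) * F (\<omega>, t)) \<partial>lborel) \<partial>pspace P)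
     = (\<integral>\<^sup>+\<omega>. (\<integral>\<^sup>+g. ennreal (exponential_density (lam P) g) *
          (\<integral>\<^sup>+y. (\<integral>\<^sup>+t. indicator {0<..<g} t * (ennreal (lam P) * F (\<omega>, t)) \<partial>lborel) \<partial>dlaw P) \<partial>lborel) \<partial>past_law n)"
    using nn_integral_joint[of "\<lambda>z. \<integral>\<^sup>+t. indicator {0<..<fst (snd z)} t * (ennreal (lam P) * F (fst z, t)) \<partial>lborel" n]
    by simp
  also have "\<dots> = (\<integral>\<^sup>+\<omega>. (\<integral>\<^sup>+t. ennreal (exponential_density (lam P) t) * F (\<omega>, t) \<partial>lborel) \<partial>past_law n)"
  proof (rule nn_integral_cong)
    fix \<omega> assume "\<omega> \<in> space (past_law n)"
    then have \<omega>[measurable]: "\<omega> \<in> space (history n)" by (simp add: past_law_def)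
    have [measurable]: "(\<lambda>t. F (\<omega>, t)) \<in> borel_measurable borel" using \<omega> by measurable
    have "(\<integral>\<^sup>+g. ennreal (exponential_density (lam P) g) *
          (\<integral>\<^sup>+y. (\<integral>\<^sup>+t. indicator {0<..<g} t * (ennreal (lam P) * F (\<omega>, t)) \<partial>lborel) \<partial>dlaw P) \<partial>lborel)
      = (\<integral>\<^sup>+g. (\<integral>\<^sup>+t. ennreal (exponential_density (lam P) g) *
           ((if 0 < t \<and> t < g then 1 else 0) * (ennreal (lam P) * F (\<omega>, t))) \<partial>lborel) \<partial>lborel)"
    proof (intro nn_integral_cong)
      fix g
      have "(\<integral>\<^sup>+y. (\<integral>\<^sup>+t. indicator {0<..<g} t * (ennreal (lam P) * F (\<omega>, t)) \<partial>lborel) \<partial>dlaw P)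
        = (\<integral>\<^sup>+t. indicator {0<..<g} t * (ennreal (lam P) * F (\<omega>, t)) \<partial>lborel)"
        by (simp add: demand.emeasure_space_1[simplified])
      also have "\<dots> = (\<integral>\<^sup>+t. (if 0 < t \<and> t < g then 1 else 0) * (ennreal (lam P) * F (\<omega>, t)) \<partial>lborel)"
        by (intro nn_integral_cong) (auto simp: indicator_def)
      finally show "ennreal (exponential_density (lam P) g) *
          (\<integral>\<^sup>+y. (\<integral>\<^sup>+t. indicator {0<..<g} t * (ennreal (lam P) * F (\<omega>, t)) \<partial>lborel) \<partial>dlaw P)
        = (\<integral>\<^sup>+t. ennreal (exponential_density (lam P) g) *
           ((if 0 < t \<and> t < g then 1 else 0) * (ennreal (lam P) * F (\<omega>, t))) \<partial>lborel)"
        by (simp add: nn_integral_cmult)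
    qed
    also have "\<dots> = (\<integral>\<^sup>+t. (\<integral>\<^sup>+g. ennreal (exponential_density (lam P) g) *
           ((if 0 < t \<and> t < g then 1 else 0) * (ennreal (lam P) * F (\<omega>, t))) \<partial>lborel) \<partial>lborel)"
      by (rule lborel_pair.Fubini') measurable
    also have "\<dots> = (\<integral>\<^sup>+t. ennreal (exponential_density (lam P) t) * F (\<omega>, t) \<partial>lborel)"
    proof (rule nn_integral_cong_AE)
      have "AE t in lborel. t \<noteq> (0::real)" by (rule AE_lborel_singleton)
      then show "AE t in lborel. (\<integral>\<^sup>+g. ennreal (exponential_density (lam P) g) *
           ((if 0 < t \<and> t < g then 1 else 0) * (ennreal (lam P) * F (\<omega>, t))) \<partial>lborel)
         = ennreal (exponential_density (lam P) t) * F (\<omega>, t)"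
      proof eventually_elim
        case (elim t)
        show ?case
        proof (cases "0 < t")
          case True
          have "(\<integral>\<^sup>+g. ennreal (exponential_density (lam P) g) *
             ((if 0 < t \<and> t < g then 1 else 0) * (ennreal (lam P) * F (\<omega>, t))) \<partial>lborel)
            = (\<integral>\<^sup>+g. ennreal (exponential_density (lam P) g) * indicator {t<..} g * (ennreal (lam P) * F (\<omega>, t)) \<partial>lborel)"
            using True by (intro nn_integral_cong) (auto simp: indicator_def)
          also have "\<dots> = ennreal (exp (- t * lam P)) * (ennreal (lam P) * F (\<omega>, t))"
            using True by (simp add: nn_integral_multc exponential_tail)
          also have "\<dots> = ennreal (exponential_density (lam P) t) * F (\<omega>, t)"
            using True lam_pos by (simp add: exponential_density_def ennreal_mult mult_ac)
          finally show ?thesis .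
        next
          case False
          then show ?thesis using elim by (simp add: exponential_density_def)
        qed
      qed
    qed
    finally show "(\<integral>\<^sup>+g. ennreal (exponential_density (lam P) g) *
          (\<integral>\<^sup>+y. (\<integral>\<^sup>+t. indicator {0<..<g} t * (ennreal (lam P) * F (\<omega>, t)) \<partial>lborel) \<partial>dlaw P) \<partial>lborel)
        = (\<integral>\<^sup>+t. ennreal (exponential_density (lam P) t) * F (\<omega>, t) \<partial>lborel)" .
  qed
  also have "\<dots> = (\<integral>\<^sup>+\<omega>. f (\<omega>, gap n \<omega>, dem P (Suc n) \<omega>) \<partial>pspace P)"
    unfolding nn_integral_joint[OF f] by (simp add: F_def)
  finally show ?thesis by (simp add: F_def)
qed

end

section \<open>The demand filtration between two arrivals\<close>

context production_inventory
begin

lemma total_demand_history: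
  assumes \<omega>: "\<omega> \<in> space (pspace P)" and s: "0 \<le> s" "s \<le> r"
    and r: "arr P n \<omega> \<le> r" "r < arr P (Suc n) \<omega>"
  shows "total_demand P s \<omega> = (\<Sum>m<n. if arr P (Suc m) \<omega> \<le> s then dem P (Suc m) \<omega> else 0)"
proof -
  obtain k where k: "arr P k \<omega> \<le> s" "s < arr P (Suc k) \<omega>" by (rule arrival_interval[OF \<omega> s(1)])
  have "arr P k \<omega> < arr P (Suc n) \<omega>" using k s r by simp
  then have kn: "k \<le> n" using arr_le_iff[OF \<omega>, of "Suc n" k] by (simp add: not_le[symmetric])
  have iff: "arr P (Suc m) \<omega> \<le> s \<longleftrightarrow> m < k" for m
  proof
    assume "arr P (Suc m) \<omega> \<le> s"
    then have "arr P (Suc m) \<omega> < arr P (Suc k) \<omega>" using k by simp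
    then show "m < k" using arr_le_iff[OF \<omega>, of "Suc k" "Suc m"] by (simp add: not_le[symmetric])
  next
    assume "m < k"
    then show "arr P (Suc m) \<omega> \<le> s" using arr_le_iff[OF \<omega>, of "Suc m" k] k by simp
  qed
  have "total_demand P s \<omega> = (\<Sum>m<k. dem P (Suc m) \<omega>)"
    unfolding total_demand_def num_arrivals_eqI[OF \<omega> k] by (simp add: sum.atLeast1_atMost_eq)
  also have "\<dots> = (\<Sum>m | m < n \<and> m < k. dem P (Suc m) \<omega>)"
    using kn by (intro sum.cong) auto
  also have "\<dots> = (\<Sum>m<n. if arr P (Suc m) \<omega> \<le> s then dem P (Suc m) \<omega> else 0)"
    unfolding iff by (subst sum.inter_filter[symmetric]) (auto simp: lessThan_def)
  finally show ?thesis .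
qed

lemma sets_demand_filtration: "sets (demand_filtration P t) = sigma_sets (space (pspace P))
     {total_demand P s -` A \<inter> space (pspace P) | s A. 0 \<le> s \<and> s \<le> t \<and> A \<in> sets borel}"
  unfolding demand_filtration_def by (rule sets_measure_of) auto

lemma space_demand_filtration [simp]: "space (demand_filtration P t) = space (pspace P)"
  unfolding demand_filtration_def by (rule space_measure_of) auto

text \<open>As long as exactly \<open>n\<close> arrivals have occurred, the total demand at any
  earlier time is a function of the first \<open>n\<close> gaps and demands. This settles the
  generating events, and the property survives complements and countable unions.\<close>

lemma filtration_history:
  assumes "A \<in> sets (demand_filtration P r)"
  obtains B where "B \<in> sets (history n)"
    "\<And>\<omega>. \<omega> \<in> space (pspace P) \<Longrightarrow> arr P n \<omega> \<le> r \<Longrightarrow> r < arr P (Suc n) \<omega> \<Longrightarrow> \<omega> \<in> A \<longleftrightarrow> \<omega> \<in> B"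
proof -
  have "\<exists>B\<in>sets (history n). \<forall>\<omega>\<in>space (pspace P). arr P n \<omega> \<le> r \<longrightarrow> r < arr P (Suc n) \<omega> \<longrightarrow> (\<omega> \<in> A \<longleftrightarrow> \<omega> \<in> B)"
    using assms unfolding sets_demand_filtration
  proof (induction rule: sigma_sets.induct)
    case (Basic A)
    then obtain s D where s: "0 \<le> s" "s \<le> r" "D \<in> sets borel" "A = total_demand P s -` D \<inter> space (pspace P)"
      by auto
    define g where "g \<omega> = (\<Sum>m<n. if arr P (Suc m) \<omega> \<le> s then dem P (Suc m) \<omega> else 0)" for \<omega>
    have g: "g \<in> borel_measurable (history n)"
      unfolding g_def
    proof (rule borel_measurable_sum)
      fix m assume m: "m \<in> {..<n}"
      have [measurable]: "arr P (Suc m) \<in> borel_measurable (history n)" "dem P (Suc m) \<in> borel_measurable (history n)"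
        using m by (auto intro: history_arr history_dem)
      show "(\<lambda>\<omega>. if arr P (Suc m) \<omega> \<le> s then dem P (Suc m) \<omega> else 0) \<in> borel_measurable (history n)"
        by measurable
    qed
    show ?case
      using measurable_sets[OF g s(3)] s
      by (intro bexI[of _ "g -` D \<inter> space (history n)"]) (auto simp: g_def total_demand_history)
  next
    case Empty
    then show ?case by (intro bexI[of _ "{}"]) auto
  next
    case (Compl A)
    then obtain B where "B \<in> sets (history n)"
      "\<forall>\<omega>\<in>space (pspace P). arr P n \<omega> \<le> r \<longrightarrow> r < arr P (Suc n) \<omega> \<longrightarrow> (\<omega> \<in> A \<longleftrightarrow> \<omega> \<in> B)" by blast
    then show ?case
      using sets.compl_sets[of B "history n"]
      by (intro bexI[of _ "space (history n) - B"]) auto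
  next
    case (Union A)
    then have "\<forall>i. \<exists>B\<in>sets (history n). \<forall>\<omega>\<in>space (pspace P). arr P n \<omega> \<le> r \<longrightarrow> r < arr P (Suc n) \<omega> \<longrightarrow> (\<omega> \<in> A i \<longleftrightarrow> \<omega> \<in> B)"
      by blast
    then obtain B where "\<And>i. B i \<in> sets (history n)"
      "\<And>i. \<forall>\<omega>\<in>space (pspace P). arr P n \<omega> \<le> r \<longrightarrow> r < arr P (Suc n) \<omega> \<longrightarrow> (\<omega> \<in> A i \<longleftrightarrow> \<omega> \<in> B i)"
      by metis
    then show ?case by (intro bexI[of _ "\<Union>i. B i"]) auto
  qed
  then show ?thesis using that by blast
qed

end

section \<open>Phase and level as functions of past and time\<close>

context admissible_strategy
begin

lemma phase_adapted: "0 \<le> t \<Longrightarrow> phase S t \<in> measurable (demand_filtration P t) (count_space UNIV)"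
  using adm unfolding admissible_def by auto

lemma phase_history:
  obtains C where "\<And>r. C r \<in> measurable (history n) (count_space UNIV)"
    "\<And>r \<omega>. \<omega> \<in> space (pspace P) \<Longrightarrow> arr P n \<omega> \<le> r \<Longrightarrow> r < arr P (Suc n) \<omega> \<Longrightarrow> phase S r \<omega> = C r \<omega>"
proof -
  have "\<exists>C\<in>measurable (history n) (count_space UNIV).
     \<forall>\<omega>\<in>space (pspace P). arr P n \<omega> \<le> r \<longrightarrow> r < arr P (Suc n) \<omega> \<longrightarrow> phase S r \<omega> = C \<omega>" for r
  proof (cases "0 \<le> r")
    case True
    have "\<exists>B. B \<in> sets (history n) \<and> (\<forall>\<omega>\<in>space (pspace P). arr P n \<omega> \<le> r \<longrightarrow> r < arr P (Suc n) \<omega> \<longrightarrow>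
       (phase S r \<omega> = j \<longleftrightarrow> \<omega> \<in> B))" for j
    proof -
      have "phase S r -` {j} \<inter> space (demand_filtration P r) \<in> sets (demand_filtration P r)"
        using phase_adapted[OF True] by (rule measurable_sets) simp
      then obtain B where "B \<in> sets (history n)"
        "\<And>\<omega>. \<omega> \<in> space (pspace P) \<Longrightarrow> arr P n \<omega> \<le> r \<Longrightarrow> r < arr P (Suc n) \<omega> \<Longrightarrow>
           \<omega> \<in> phase S r -` {j} \<inter> space (demand_filtration P r) \<longleftrightarrow> \<omega> \<in> B"
        by (rule filtration_history[where n=n]) blast
      then show ?thesis by (intro exI[of _ B]) auto
    qed
    then obtain B where B: "\<And>j. B j \<in> sets (history n)" "\<And>j \<omega>. \<omega> \<in> space (pspace P) \<Longrightarrow>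
        arr P n \<omega> \<le> r \<Longrightarrow> r < arr P (Suc n) \<omega> \<Longrightarrow> phase S r \<omega> = j \<longleftrightarrow> \<omega> \<in> B j"
      by metis
    have [measurable]: "B j \<in> sets (history n)" for j by (rule B(1))
    show ?thesis
    proof (intro bexI[of _ "\<lambda>\<omega>. if \<omega> \<in> B 1 then 1 else if \<omega> \<in> B 2 then 2 else 0"] ballI impI)
      fix \<omega> assume \<omega>: "\<omega> \<in> space (pspace P)" and r: "arr P n \<omega> \<le> r" "r < arr P (Suc n) \<omega>"
      show "phase S r \<omega> = (if \<omega> \<in> B 1 then 1 else if \<omega> \<in> B 2 then 2 else 0)"
        using B(2)[OF \<omega> r, of 1] B(2)[OF \<omega> r, of 2] phase_range[OF \<omega>, of r] by auto
    qed measurable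
  next
    case False
    then show ?thesis
      by (intro bexI[of _ "\<lambda>_. 0"]) (auto dest: order_trans[OF arr_nonneg])
  qed
  then show ?thesis using that by metis
qed

lemma prephase_left:
  assumes \<omega>: "\<omega> \<in> space (pspace P)" and s: "0 < s"
  obtains a where "a < s" "0 \<le> a" "\<And>q. a < q \<Longrightarrow> q < s \<Longrightarrow> phase S q \<omega> = prephase S s \<omega>"
proof -
  obtain k where k: "swtime S k \<omega> < ereal s" "ereal s \<le> swtime S (Suc k) \<omega>"
    using s by (rule switch_interval_left[OF \<omega>])
  obtain a where a: "swtime S k \<omega> = ereal a"
    using k swtime_nonneg[OF \<omega>, of k] by (cases "swtime S k \<omega>") auto
  show ?thesis
  proof (rule that[of a])
    show "a < s" using k a by simp
    show "0 \<le> a" using swtime_nonneg[OF \<omega>, of k] a by simp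
    fix q assume q: "a < q" "q < s"
    have "ereal q < swtime S (Suc k) \<omega>" by (rule less_le_trans[OF _ k(2)]) (use q in simp)
    then show "phase S q \<omega> = prephase S s \<omega>"
      using phase_eqI[OF \<omega>, of k q] prephase_eqI[OF \<omega> k] a q by simp
  qed
qed

text \<open>Adaptedness gives measurability in the path for each fixed time; the compensator needs
  it jointly in path and time. The left limit of the phase is the value taken at all rational times
  in some left neighbourhood, which is a countable condition and hence jointly measurable.\<close>

lemma prephase_representation:
  obtains c where "c \<in> measurable (history n \<Otimes>\<^sub>M borel) (count_space UNIV)"
    "\<And>\<omega> s. \<omega> \<in> space (pspace P) \<Longrightarrow> arr P n \<omega> < s \<Longrightarrow> s \<le> arr P (Suc n) \<omega> \<Longrightarrow> prephase S s \<omega> = c (\<omega>, s)"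
proof -
  obtain C where C[measurable]: "\<And>r. C r \<in> measurable (history n) (count_space UNIV)"
    and Cph: "\<And>r \<omega>. \<omega> \<in> space (pspace P) \<Longrightarrow> arr P n \<omega> \<le> r \<Longrightarrow> r < arr P (Suc n) \<omega> \<Longrightarrow> phase S r \<omega> = C r \<omega>"
    by (rule phase_history[where n=n]) blast
  define Q where "Q j z \<longleftrightarrow> (\<exists>a::rat. of_rat a < snd z \<and>
      (\<forall>q::rat. of_rat a < (of_rat q :: real) \<and> of_rat q < snd z \<longrightarrow> C (of_rat q) (fst z) = j))"
      for j :: nat and z :: "'w \<times> real"
  have [measurable]: "Measurable.pred (history n \<Otimes>\<^sub>M borel) (Q j)" for j
    unfolding Q_def by measurable
  have Q: "Q j (\<omega>, s) \<longleftrightarrow> prephase S s \<omega> = j"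
    if \<omega>: "\<omega> \<in> space (pspace P)" and s: "arr P n \<omega> < s" "s \<le> arr P (Suc n) \<omega>" for \<omega> s j
  proof -
    have s0: "0 < s" using s arr_nonneg[OF \<omega>, of n] by simp
    obtain a where a: "a < s" "0 \<le> a" "\<And>q. a < q \<Longrightarrow> q < s \<Longrightarrow> phase S q \<omega> = prephase S s \<omega>"
      using prephase_left[OF \<omega> s0] by blast
    define b where "b = max a (arr P n \<omega>)"
    have b: "b < s" using a s by (simp add: b_def)
    have eq: "C q \<omega> = prephase S s \<omega>" if "b < q" "q < s" for q
      using Cph[OF \<omega>, of q] a(3)[of q] that s by (auto simp: b_def)
    \<comment> \<open>Rational times after \<open>a0\<close> lie beyond both the last switch and the
      last arrival before \<open>s\<close>, where the history version \<open>C\<close> is the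
      constant \<open>prephase\<close>.\<close>
    obtain a0 where a0: "b < real_of_rat a0" "real_of_rat a0 < s" using of_rat_dense[OF b] by blast
    show ?thesis
    proof
      assume "Q j (\<omega>, s)"
      then obtain a' where a': "real_of_rat a' < s"
        "\<And>q. real_of_rat a' < real_of_rat q \<Longrightarrow> real_of_rat q < s \<Longrightarrow> C (real_of_rat q) \<omega> = j"
        unfolding Q_def by auto
      have "max b (real_of_rat a') < s" using b a' by simp
      then obtain q where "max b (real_of_rat a') < real_of_rat q" "real_of_rat q < s"
        using of_rat_dense by blast
      then show "prephase S s \<omega> = j" using a'(2)[of q] eq[of "real_of_rat q"] by simp
    next
      assume "prephase S s \<omega> = j"
      then show "Q j (\<omega>, s)"
        unfolding Q_def using a0 eq by (intro exI[of _ a0]) (auto simp del: of_rat_less)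
    qed
  qed
  show ?thesis
  proof (rule that[of "\<lambda>z. if Q 1 z then 1 else if Q 2 z then 2 else 0"])
    show "(\<lambda>z. if Q 1 z then 1 else if Q 2 z then 2 else 0) \<in> measurable (history n \<Otimes>\<^sub>M borel) (count_space UNIV)"
      by measurable
    fix \<omega> s assume \<omega>: "\<omega> \<in> space (pspace P)" and s: "arr P n \<omega> < s" "s \<le> arr P (Suc n) \<omega>"
    show "prephase S s \<omega> = (if Q 1 (\<omega>, s) then 1 else if Q 2 (\<omega>, s) then 2 else 0)"
      using Q[OF \<omega> s] prephase_range[OF \<omega>, of s] by auto
  qed
qed

lemma AE_phase_prephase:
  assumes \<omega>: "\<omega> \<in> space (pspace P)"
  shows "AE u in lborel. 0 < u \<longrightarrow> phase S u \<omega> = prephase S u \<omega>"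
proof -
  let ?N = "range (\<lambda>k. real_of_ereal (swtime S (Suc k) \<omega>))"
  have "AE u in lborel. u \<notin> ?N" by (intro AE_not_in countable_imp_null_set_lborel) simp
  then show ?thesis
  proof eventually_elim
    case (elim u)
    have "swtime S (Suc k) \<omega> \<noteq> ereal u" for k
    proof
      assume "swtime S (Suc k) \<omega> = ereal u"
      then have "u = real_of_ereal (swtime S (Suc k) \<omega>)" by simp
      then show False using elim by blast
    qed
    then show ?case using phase_prephase[OF \<omega>, of u] by auto
  qed
qed

text \<open>Production integrates the phase over time, and the phase differs from its left limit at
  countably many times only; so the representation of \<open>prephase\<close> may be put under the
  integral.\<close>

lemma prelevel_representation:
  assumes L[measurable]: "(\<lambda>\<omega>. level_after P S x \<omega> n) \<in> borel_measurable (history n)"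
  obtains \<xi> where "\<xi> \<in> borel_measurable (history n \<Otimes>\<^sub>M borel)"
    "\<And>\<omega> s. \<omega> \<in> space (pspace P) \<Longrightarrow> arr P n \<omega> < s \<Longrightarrow> s \<le> arr P (Suc n) \<omega> \<Longrightarrow> prelevel P S x n s \<omega> = \<xi> (\<omega>, s)"
proof -
  obtain c where c[measurable]: "c \<in> measurable (history n \<Otimes>\<^sub>M borel) (count_space UNIV)"
    and cp: "\<And>\<omega> s. \<omega> \<in> space (pspace P) \<Longrightarrow> arr P n \<omega> < s \<Longrightarrow> s \<le> arr P (Suc n) \<omega> \<Longrightarrow> prephase S s \<omega> = c (\<omega>, s)"
    using prephase_representation[of n] by blast
  have [measurable]: "arr P n \<in> borel_measurable (history n)" by (rule history_arr) simp
  define \<xi> where "\<xi> z = level_after P S x (fst z) n +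
     (\<integral>u. (if arr P n (fst z) \<le> u \<and> u \<le> snd z then rate P (c (fst z, u)) else 0) \<partial>lborel)" for z
  show ?thesis
  proof (rule that[of \<xi>])
    show "\<xi> \<in> borel_measurable (history n \<Otimes>\<^sub>M borel)" unfolding \<xi>_def by measurable
    fix \<omega> s assume \<omega>: "\<omega> \<in> space (pspace P)" and s: "arr P n \<omega> < s" "s \<le> arr P (Suc n) \<omega>"
    have [measurable]: "(\<lambda>u. phase S u \<omega>) \<in> measurable borel (count_space UNIV)"
      by (rule phase_measurable_time[OF \<omega>])
    have [measurable]: "(\<lambda>u. c (\<omega>, u)) \<in> measurable borel (count_space UNIV)"
      using \<omega> by (intro measurable_compose[OF measurable_Pair1' c]) simp
    have "AE u in lborel. u \<noteq> arr P n \<omega>" by (rule AE_lborel_singleton)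
    then have "AE u in lborel. indicator {arr P n \<omega>..s} u *\<^sub>R rate P (phase S u \<omega>)
       = (if arr P n \<omega> \<le> u \<and> u \<le> s then rate P (c (\<omega>, u)) else 0)"
      using AE_phase_prephase[OF \<omega>]
    proof eventually_elim
      case (elim u)
      show ?case
      proof (cases "u \<in> {arr P n \<omega>..s}")
        case True
        then have "0 < u" "arr P n \<omega> < u" using elim arr_nonneg[OF \<omega>, of n] by auto
        then show ?thesis using elim cp[OF \<omega>, of u] True s by auto
      qed auto
    qed
    then have "produced P S (arr P n \<omega>) s \<omega> =
      (\<integral>u. (if arr P n \<omega> \<le> u \<and> u \<le> s then rate P (c (\<omega>, u)) else 0) \<partial>lborel)"
      unfolding produced_def set_lebesgue_integral_def by (intro integral_cong_AE) measurable
    then show "prelevel P S x n s \<omega> = \<xi> (\<omega>, s)" by (simp add: prelevel_def \<xi>_def cong: if_cong)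
  qed
qed

text \<open>Induction over the arrivals: the level before the next demand depends on the past and on
  the length of the next gap, and these, together with the next demand, are known to
  \<open>history (Suc n)\<close>.\<close>

lemma history_level_after: "(\<lambda>\<omega>. level_after P S x \<omega> n) \<in> borel_measurable (history n)"
proof (induction n)
  case 0
  show ?case by simp
next
  case (Suc n)
  obtain \<xi> where \<xi>: "\<xi> \<in> borel_measurable (history n \<Otimes>\<^sub>M borel)"
    "\<And>\<omega> s. \<omega> \<in> space (pspace P) \<Longrightarrow> arr P n \<omega> < s \<Longrightarrow> s \<le> arr P (Suc n) \<omega> \<Longrightarrow> prelevel P S x n s \<omega> = \<xi> (\<omega>, s)"
    using prelevel_representation[OF Suc] by blast
  have [measurable]: "arr P (Suc n) \<in> borel_measurable (history (Suc n))" "dem P (Suc n) \<in> borel_measurable (history (Suc n))"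
    by (auto intro: history_arr history_dem)
  have "(\<lambda>\<omega>. \<omega>) \<in> measurable (history (Suc n)) (history n)"
    by (rule history_subset_Suc) simp
  then have "(\<lambda>\<omega>. (\<omega>, arr P (Suc n) \<omega>)) \<in> measurable (history (Suc n)) (history n \<Otimes>\<^sub>M borel)"
    by measurable
  from measurable_compose[OF this \<xi>(1)]
  have [measurable]: "(\<lambda>\<omega>. \<xi> (\<omega>, arr P (Suc n) \<omega>)) \<in> borel_measurable (history (Suc n))" .
  have "(\<lambda>\<omega>. served P (\<xi> (\<omega>, arr P (Suc n) \<omega>)) (dem P (Suc n) \<omega>)) \<in> borel_measurable (history (Suc n))"
    by measurable
  then show ?case
    by (subst measurable_cong) (auto simp: level_after_Suc level_before_Suc \<xi>(2) arr_mono simp del: level_after.simps)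
qed

lemma representation:
  obtains c \<xi> where "c \<in> measurable (history n \<Otimes>\<^sub>M borel) (count_space UNIV)"
    "\<xi> \<in> borel_measurable (history n \<Otimes>\<^sub>M borel)"
    "\<And>\<omega> s. \<omega> \<in> space (pspace P) \<Longrightarrow> arr P n \<omega> < s \<Longrightarrow> s \<le> arr P (Suc n) \<omega> \<Longrightarrow> prephase S s \<omega> = c (\<omega>, s)"
    "\<And>\<omega> s. \<omega> \<in> space (pspace P) \<Longrightarrow> arr P n \<omega> < s \<Longrightarrow> s \<le> arr P (Suc n) \<omega> \<Longrightarrow> prelevel P S x n s \<omega> = \<xi> (\<omega>, s)"
  using prephase_representation[of n] prelevel_representation[OF history_level_after, of n] by metis

lemma before_arrival_measurable:
  fixes f :: "nat \<Rightarrow> real \<Rightarrow> real \<Rightarrow> ennreal"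
  assumes f[measurable]: "\<And>j. (\<lambda>z. f j (fst z) (snd z)) \<in> borel_measurable (borel \<Otimes>\<^sub>M borel)"
  shows "(\<lambda>\<omega>. f (prephase S (arr P (Suc n) \<omega>) \<omega>) (level_before P S x \<omega> (Suc n)) (dem P (Suc n) \<omega>))
     \<in> borel_measurable (pspace P)"
proof -
  obtain c \<xi> where [measurable]: "c \<in> measurable (history n \<Otimes>\<^sub>M borel) (count_space UNIV)"
    "\<xi> \<in> borel_measurable (history n \<Otimes>\<^sub>M borel)"
   and rep: "\<And>\<omega> s. \<omega> \<in> space (pspace P) \<Longrightarrow> arr P n \<omega> < s \<Longrightarrow> s \<le> arr P (Suc n) \<omega> \<Longrightarrow> prephase S s \<omega> = c (\<omega>, s)"
    "\<And>\<omega> s. \<omega> \<in> space (pspace P) \<Longrightarrow> arr P n \<omega> < s \<Longrightarrow> s \<le> arr P (Suc n) \<omega> \<Longrightarrow> prelevel P S x n s \<omega> = \<xi> (\<omega>, s)"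
    using representation[of n] by metis
  have 1[measurable]: "(\<lambda>\<omega>. f j (\<xi> (\<omega>, arr P (Suc n) \<omega>)) (dem P (Suc n) \<omega>)) \<in> borel_measurable (pspace P)" for j
    using measurable_compose[OF _ f[of j], of "\<lambda>\<omega>. (\<xi> (\<omega>, arr P (Suc n) \<omega>), dem P (Suc n) \<omega>)"] by simp
  have "(\<lambda>\<omega>. f (c (\<omega>, arr P (Suc n) \<omega>)) (\<xi> (\<omega>, arr P (Suc n) \<omega>)) (dem P (Suc n) \<omega>)) \<in> borel_measurable (pspace P)"
    by (rule measurable_compose_countable[OF 1]) measurable
  then show ?thesis
    by (subst measurable_cong) (auto simp: level_before_Suc rep arr_mono)
qed

lemma between_arrivals_measurable:
  fixes g :: "nat \<Rightarrow> real \<Rightarrow> real \<Rightarrow> ennreal"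
  assumes g[measurable]: "\<And>j. (\<lambda>z. g j (fst z) (snd z)) \<in> borel_measurable (borel \<Otimes>\<^sub>M borel)"
  shows "(\<lambda>\<omega>. \<integral>\<^sup>+s. indicator {arr P n \<omega><..<arr P (Suc n) \<omega>} s * g (prephase S s \<omega>) (prelevel P S x n s \<omega>) s \<partial>lborel)
     \<in> borel_measurable (pspace P)"
proof -
  obtain c \<xi> where [measurable]: "c \<in> measurable (history n \<Otimes>\<^sub>M borel) (count_space UNIV)"
    "\<xi> \<in> borel_measurable (history n \<Otimes>\<^sub>M borel)"
   and rep: "\<And>\<omega> s. \<omega> \<in> space (pspace P) \<Longrightarrow> arr P n \<omega> < s \<Longrightarrow> s \<le> arr P (Suc n) \<omega> \<Longrightarrow> prephase S s \<omega> = c (\<omega>, s)"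
    "\<And>\<omega> s. \<omega> \<in> space (pspace P) \<Longrightarrow> arr P n \<omega> < s \<Longrightarrow> s \<le> arr P (Suc n) \<omega> \<Longrightarrow> prelevel P S x n s \<omega> = \<xi> (\<omega>, s)"
    using representation[of n] by metis
  have [measurable]: "(\<lambda>z. z) \<in> measurable (pspace P \<Otimes>\<^sub>M lborel) (history n \<Otimes>\<^sub>M borel)"
  proof -
    have "(\<lambda>z. (fst z, snd z)) \<in> measurable (pspace P \<Otimes>\<^sub>M lborel) (history n \<Otimes>\<^sub>M borel)"
      by (intro measurable_Pair measurable_compose[OF measurable_fst id_measurable_history]) auto
    then show ?thesis by simp
  qed
  have cm: "c \<in> measurable (pspace P \<Otimes>\<^sub>M lborel) (count_space UNIV)" "\<xi> \<in> borel_measurable (pspace P \<Otimes>\<^sub>M lborel)"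
    by (rule measurable_compose[of "\<lambda>z. z" _ "history n \<Otimes>\<^sub>M borel"]; measurable)+
  note [measurable] = cm
  have 1[measurable]: "(\<lambda>z. g j (\<xi> z) (snd z)) \<in> borel_measurable (pspace P \<Otimes>\<^sub>M lborel)" for j
    using measurable_compose[OF _ g[of j], of "\<lambda>z. (\<xi> z, snd z)"] by simp
  have [measurable]: "(\<lambda>z. g (c z) (\<xi> z) (snd z)) \<in> borel_measurable (pspace P \<Otimes>\<^sub>M lborel)"
    by (rule measurable_compose_countable[OF 1]) measurable
  have "(\<lambda>\<omega>. \<integral>\<^sup>+s. (if arr P n \<omega> < s \<and> s < arr P (Suc n) \<omega> then 1 else 0) * g (c (\<omega>, s)) (\<xi> (\<omega>, s)) s \<partial>lborel)
     \<in> borel_measurable (pspace P)"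
  proof -
    have "(\<lambda>z. (if arr P n (fst z) < snd z \<and> snd z < arr P (Suc n) (fst z) then 1 else 0) * g (c z) (\<xi> z) (snd z))
      \<in> borel_measurable (pspace P \<Otimes>\<^sub>M lborel)" by measurable
    from lborel.borel_measurable_nn_integral_fst[OF this] show ?thesis by simp
  qed
  also have "?this \<longleftrightarrow> ?thesis"
    by (intro measurable_cong nn_integral_cong) (auto simp: rep indicator_def)
  finally show ?thesis .
qed

text \<open>This is \<open>compensator_step\<close> in absolute time. It is essential that phase and
  level are left limits: they depend on the past and the elapsed time alone, whereas the phase at
  the arrival may already react to the demand.\<close>

lemma compensator:
  fixes f :: "nat \<Rightarrow> real \<Rightarrow> real \<Rightarrow> ennreal"
  assumes f[measurable]: "\<And>j. (\<lambda>z. f j (fst z) (snd z)) \<in> borel_measurable (borel \<Otimes>\<^sub>M borel)"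
  shows "(\<integral>\<^sup>+\<omega>. ennreal (exp (- disc P * arr P (Suc n) \<omega>)) *
        f (prephase S (arr P (Suc n) \<omega>) \<omega>) (level_before P S x \<omega> (Suc n)) (dem P (Suc n) \<omega>) \<partial>pspace P)
    = (\<integral>\<^sup>+\<omega>. (\<integral>\<^sup>+s. indicator {arr P n \<omega><..<arr P (Suc n) \<omega>} s * (ennreal (lam P * exp (- disc P * s)) *
         (\<integral>\<^sup>+y. f (prephase S s \<omega>) (prelevel P S x n s \<omega>) y \<partial>dlaw P)) \<partial>lborel) \<partial>pspace P)"
proof -
  obtain c \<xi> where cm[measurable]: "c \<in> measurable (history n \<Otimes>\<^sub>M borel) (count_space UNIV)"
    "\<xi> \<in> borel_measurable (history n \<Otimes>\<^sub>M borel)"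
   and rep: "\<And>\<omega> s. \<omega> \<in> space (pspace P) \<Longrightarrow> arr P n \<omega> < s \<Longrightarrow> s \<le> arr P (Suc n) \<omega> \<Longrightarrow> prephase S s \<omega> = c (\<omega>, s)"
    "\<And>\<omega> s. \<omega> \<in> space (pspace P) \<Longrightarrow> arr P n \<omega> < s \<Longrightarrow> s \<le> arr P (Suc n) \<omega> \<Longrightarrow> prelevel P S x n s \<omega> = \<xi> (\<omega>, s)"
    using representation[of n] by metis
  have [measurable]: "arr P n \<in> borel_measurable (history n)" by (rule history_arr) simp
  define \<phi> where "\<phi> z = ennreal (exp (- disc P * (arr P n (fst z) + fst (snd z)))) *
     f (c (fst z, arr P n (fst z) + fst (snd z))) (\<xi> (fst z, arr P n (fst z) + fst (snd z))) (snd (snd z))" for z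
  have 1[measurable]: "(\<lambda>z. f j (\<xi> (fst z, arr P n (fst z) + fst (snd z))) (snd (snd z)))
     \<in> borel_measurable (history n \<Otimes>\<^sub>M (borel \<Otimes>\<^sub>M borel))" for j
    using measurable_compose[OF _ f[of j], of "\<lambda>z. (\<xi> (fst z, arr P n (fst z) + fst (snd z)), snd (snd z))"
      "history n \<Otimes>\<^sub>M (borel \<Otimes>\<^sub>M borel)"] by simp
  have [measurable]: "(\<lambda>z. f (c (fst z, arr P n (fst z) + fst (snd z))) (\<xi> (fst z, arr P n (fst z) + fst (snd z))) (snd (snd z)))
     \<in> borel_measurable (history n \<Otimes>\<^sub>M (borel \<Otimes>\<^sub>M borel))"
    by (rule measurable_compose_countable[OF 1]) measurable
  have \<phi>[measurable]: "\<phi> \<in> borel_measurable (history n \<Otimes>\<^sub>M (borel \<Otimes>\<^sub>M borel))"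
    unfolding \<phi>_def by measurable
  have "(\<integral>\<^sup>+\<omega>. ennreal (exp (- disc P * arr P (Suc n) \<omega>)) *
        f (prephase S (arr P (Suc n) \<omega>) \<omega>) (level_before P S x \<omega> (Suc n)) (dem P (Suc n) \<omega>) \<partial>pspace P)
     = (\<integral>\<^sup>+\<omega>. \<phi> (\<omega>, gap n \<omega>, dem P (Suc n) \<omega>) \<partial>pspace P)"
    by (intro nn_integral_cong) (auto simp: \<phi>_def gap_def level_before_Suc rep arr_mono)
  also have "\<dots> = (\<integral>\<^sup>+\<omega>. (\<integral>\<^sup>+t. indicator {0<..<gap n \<omega>} t * (ennreal (lam P) * (\<integral>\<^sup>+y. \<phi> (\<omega>, t, y) \<partial>dlaw P)) \<partial>lborel) \<partial>pspace P)"
    by (rule compensator_step[OF \<phi>])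
  also have "\<dots> = (\<integral>\<^sup>+\<omega>. (\<integral>\<^sup>+s. indicator {arr P n \<omega><..<arr P (Suc n) \<omega>} s * (ennreal (lam P * exp (- disc P * s)) *
         (\<integral>\<^sup>+y. f (prephase S s \<omega>) (prelevel P S x n s \<omega>) y \<partial>dlaw P)) \<partial>lborel) \<partial>pspace P)"
  proof (rule nn_integral_cong)
    fix \<omega> assume \<omega>: "\<omega> \<in> space (pspace P)"
    have c\<omega>[measurable]: "(\<lambda>u. c (\<omega>, u)) \<in> measurable borel (count_space UNIV)" "(\<lambda>u. \<xi> (\<omega>, u)) \<in> borel_measurable borel"
      using \<omega> by (auto intro!: measurable_compose[OF measurable_Pair1' cm(1)] measurable_compose[OF measurable_Pair1' cm(2)])
    have 2: "(\<lambda>z. f j (\<xi> (\<omega>, fst z)) (snd z)) \<in> borel_measurable (borel \<Otimes>\<^sub>M dlaw P)" for j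
      using measurable_compose[OF _ f[of j], of "\<lambda>z. (\<xi> (\<omega>, fst z), snd z)" "borel \<Otimes>\<^sub>M dlaw P"] by simp
    have "(\<lambda>z. f (c (\<omega>, fst z)) (\<xi> (\<omega>, fst z)) (snd z)) \<in> borel_measurable (borel \<Otimes>\<^sub>M dlaw P)"
      by (rule measurable_compose_countable[OF 2]) measurable
    from demand.borel_measurable_nn_integral_fst[OF this]
    have [measurable]: "(\<lambda>s. \<integral>\<^sup>+y. f (c (\<omega>, s)) (\<xi> (\<omega>, s)) y \<partial>dlaw P) \<in> borel_measurable borel" by simp
    have 3: "(\<lambda>y. f j z y) \<in> borel_measurable (dlaw P)" for j z
      using measurable_compose[OF _ f[of j], of "\<lambda>y. (z, y)" "dlaw P"] by simp
    have "(\<integral>\<^sup>+t. indicator {0<..<gap n \<omega>} t * (ennreal (lam P) * (\<integral>\<^sup>+y. \<phi> (\<omega>, t, y) \<partial>dlaw P)) \<partial>lborel)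
      = (\<integral>\<^sup>+t. indicator {arr P n \<omega><..<arr P (Suc n) \<omega>} (arr P n \<omega> + 1 * t) *
         (ennreal (lam P * exp (- disc P * (arr P n \<omega> + 1 * t))) *
         (\<integral>\<^sup>+y. f (c (\<omega>, arr P n \<omega> + 1 * t)) (\<xi> (\<omega>, arr P n \<omega> + 1 * t)) y \<partial>dlaw P)) \<partial>lborel)"
    proof (rule nn_integral_cong)
      fix t
      have "indicator {0<..<gap n \<omega>} t = (indicator {arr P n \<omega><..<arr P (Suc n) \<omega>} (arr P n \<omega> + 1 * t) :: ennreal)"
        by (auto simp: indicator_def gap_def)
      then show "indicator {0<..<gap n \<omega>} t * (ennreal (lam P) * (\<integral>\<^sup>+y. \<phi> (\<omega>, t, y) \<partial>dlaw P))
        = indicator {arr P n \<omega><..<arr P (Suc n) \<omega>} (arr P n \<omega> + 1 * t) *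
         (ennreal (lam P * exp (- disc P * (arr P n \<omega> + 1 * t))) *
         (\<integral>\<^sup>+y. f (c (\<omega>, arr P n \<omega> + 1 * t)) (\<xi> (\<omega>, arr P n \<omega> + 1 * t)) y \<partial>dlaw P))"
        using lam_pos by (simp add: \<phi>_def nn_integral_cmult 3 ennreal_mult mult.assoc)
    qed
    also have "\<dots> = (\<integral>\<^sup>+s. indicator {arr P n \<omega><..<arr P (Suc n) \<omega>} s * (ennreal (lam P * exp (- disc P * s)) *
         (\<integral>\<^sup>+y. f (c (\<omega>, s)) (\<xi> (\<omega>, s)) y \<partial>dlaw P)) \<partial>lborel)"
      by (subst nn_integral_real_affine[of _ 1 "arr P n \<omega>"]) auto
    also have "\<dots> = (\<integral>\<^sup>+s. indicator {arr P n \<omega><..<arr P (Suc n) \<omega>} s * (ennreal (lam P * exp (- disc P * s)) *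
         (\<integral>\<^sup>+y. f (prephase S s \<omega>) (prelevel P S x n s \<omega>) y \<partial>dlaw P)) \<partial>lborel)"
      by (rule nn_integral_cong) (auto simp: indicator_def rep[OF \<omega>])
    finally show "(\<integral>\<^sup>+t. indicator {0<..<gap n \<omega>} t * (ennreal (lam P) * (\<integral>\<^sup>+y. \<phi> (\<omega>, t, y) \<partial>dlaw P)) \<partial>lborel) = \<dots>" .
  qed
  finally show ?thesis .
qed

end

section \<open>From the path inequality to expected cost\<close>

context hjb_verification
begin

lemma scost_nonneg: "\<omega> \<in> space (pspace P) \<Longrightarrow> 0 \<le> scost \<omega> k"
  unfolding scost_def by (rule switch_cost_nonneg)

definition segment :: "nat \<Rightarrow> 'w \<Rightarrow> (nat \<Rightarrow> real \<Rightarrow> ennreal) \<Rightarrow> ennreal" where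
  "segment n \<omega> g = (\<integral>\<^sup>+s. indicator {arr P n \<omega><..<arr P (Suc n) \<omega>} s *
      (ennreal (exp (- disc P * s)) * g (prephase S s \<omega>) (prelevel P S x n s \<omega>)) \<partial>lborel)"

lemma segment_measurable:
  assumes [measurable]: "\<And>j. g j \<in> borel_measurable borel"
  shows "(\<lambda>\<omega>. segment n \<omega> g) \<in> borel_measurable (pspace P)"
  unfolding segment_def
  by (rule between_arrivals_measurable[of "\<lambda>j z s. ennreal (exp (- disc P * s)) * g j z"]) measurable

lemma segment_real:
  fixes g :: "nat \<Rightarrow> real \<Rightarrow> real"
  assumes \<omega>: "\<omega> \<in> space (pspace P)" and [measurable]: "\<And>j. g j \<in> borel_measurable borel"
    and g: "\<And>j z. lmin P \<le> z \<Longrightarrow> 0 \<le> g j z" "\<And>j z. lmin P \<le> z \<Longrightarrow> g j z \<le> B"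
  shows "segment n \<omega> (\<lambda>j z. ennreal (g j z)) = ennreal (set_lebesgue_integral lborel
      {arr P n \<omega>..arr P (Suc n) \<omega>} (\<lambda>s. exp (- disc P * s) * g (prephase S s \<omega>) (prelevel P S x n s \<omega>)))"
    and "set_integrable lborel {arr P n \<omega>..arr P (Suc n) \<omega>}
        (\<lambda>s. exp (- disc P * s) * g (prephase S s \<omega>) (prelevel P S x n s \<omega>))"
    and "0 \<le> set_lebesgue_integral lborel {arr P n \<omega>..arr P (Suc n) \<omega>}
        (\<lambda>s. exp (- disc P * s) * g (prephase S s \<omega>) (prelevel P S x n s \<omega>))"
proof -
  let ?h = "\<lambda>s. exp (- disc P * s) * g (prephase S s \<omega>) (prelevel P S x n s \<omega>)"
  let ?I = "{arr P n \<omega>..arr P (Suc n) \<omega>}"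
  have [measurable]: "(\<lambda>t. prephase S t \<omega>) \<in> measurable borel (count_space UNIV)"
    "(\<lambda>t. prelevel P S x n t \<omega>) \<in> borel_measurable borel"
    using prephase_measurable_time[OF \<omega>] prelevel_measurable_time[OF \<omega>] by auto
  have [measurable]: "(\<lambda>t. g (prephase S t \<omega>) (prelevel P S x n t \<omega>)) \<in> borel_measurable borel"
    by (rule measurable_compose_countable[where f="\<lambda>j t. g j (prelevel P S x n t \<omega>)"]) measurable
  note ge = prelevel_ge[OF \<omega>]
  show int: "set_integrable lborel ?I ?h"
  proof (rule set_integrable_bounded)
    fix r assume "r \<in> ?I"
    then have "exp (- disc P * r) \<le> exp (- disc P * arr P n \<omega>)" using disc_pos by simp
    then show "\<bar>?h r\<bar> \<le> exp (- disc P * arr P n \<omega>) * B"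
      unfolding abs_mult using g[OF ge] by (intro mult_mono) auto
  qed measurable
  show "0 \<le> set_lebesgue_integral lborel ?I ?h"
    unfolding set_lebesgue_integral_def using g(1)[OF ge] by (intro Bochner_Integration.integral_nonneg) auto
  have "AE s in lborel. s \<notin> {arr P n \<omega>, arr P (Suc n) \<omega>}"
    by (intro AE_not_in countable_imp_null_set_lborel) simp
  then have "AE s in lborel. indicator {arr P n \<omega><..<arr P (Suc n) \<omega>} s *
      (ennreal (exp (- disc P * s)) * ennreal (g (prephase S s \<omega>) (prelevel P S x n s \<omega>)))
      = ennreal (indicator ?I s *\<^sub>R ?h s)"
    by eventually_elim (use g(1)[OF ge] in \<open>auto simp: indicator_def ennreal_mult\<close>)
  then have "segment n \<omega> (\<lambda>j z. ennreal (g j z)) = (\<integral>\<^sup>+s. ennreal (indicator ?I s *\<^sub>R ?h s) \<partial>lborel)"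
    unfolding segment_def by (rule nn_integral_cong_AE)
  also have "\<dots> = ennreal (set_lebesgue_integral lborel ?I ?h)"
    unfolding set_lebesgue_integral_def
    using int g(1)[OF ge] by (intro nn_integral_eq_integral) (auto simp: set_integrable_def)
  finally show "segment n \<omega> (\<lambda>j z. ennreal (g j z)) = ennreal (set_lebesgue_integral lborel ?I ?h)" .
qed

text \<open>Shifted by \<open>2 * bnd\<close> to be nonnegative, so that the compensator formula applies.\<close>

definition gain :: "nat \<Rightarrow> real \<Rightarrow> real \<Rightarrow> real" where
  "gain j z y = restart j (served P z y) - val j z + 2 * bnd"

definition gain_mean :: "nat \<Rightarrow> real \<Rightarrow> real" where
  "gain_mean j z = jump_mean P (restart j) z - val j z + 2 * bnd"

lemma bnd_nonneg: "0 \<le> bnd"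
  using val_bound[of 0 0] by linarith

lemma gain_nonneg: "0 \<le> gain j z y"
  using restart_bound[of j "served P z y"] val_bound[of j z] by (simp add: gain_def)

lemma gain_mean_bounds: "0 \<le> gain_mean j z" "gain_mean j z \<le> 4 * bnd"
  using jump_mean_bounded(2)[OF restart_measurable restart_bound, of j z] val_bound[of j z]
  by (auto simp: gain_mean_def abs_le_iff)

lemma gain_measurable [measurable]:
  assumes [measurable]: "f \<in> borel_measurable N" "g \<in> borel_measurable N"
  shows "(\<lambda>x. gain j (f x) (g x)) \<in> borel_measurable N"
  unfolding gain_def by measurable

lemma gain_mean_measurable [measurable]: "gain_mean j \<in> borel_measurable borel"
  unfolding gain_mean_def by measurable

lemma nn_integral_gain: "(\<integral>\<^sup>+y. ennreal (gain j z y) \<partial>dlaw P) = ennreal (gain_mean j z)"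
proof -
  have i: "integrable (dlaw P) (\<lambda>y. restart j (served P z y))"
    by (rule jump_mean_bounded(1)[OF restart_measurable restart_bound])
  have "(\<integral>\<^sup>+y. ennreal (gain j z y) \<partial>dlaw P) = ennreal (\<integral>y. gain j z y \<partial>dlaw P)"
    using i by (intro nn_integral_eq_integral) (auto simp: gain_nonneg, simp add: gain_def)
  also have "(\<integral>y. gain j z y \<partial>dlaw P) = gain_mean j z"
    using i demand.prob_space unfolding gain_def gain_mean_def jump_mean_def by simp
  finally show ?thesis .
qed

lemma nn_integral_shortfall: "lmin P \<le> z \<Longrightarrow>
    (\<integral>\<^sup>+y. ennreal (shortfall_cost P z y) \<partial>dlaw P) = ennreal (shortfall_mean P z)"
  unfolding shortfall_mean_def
  by (intro nn_integral_eq_integral shortfall_cost_integrable) (auto simp: shortfall_cost_nonneg)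

lemma segment_compensator:
  assumes [measurable]: "\<And>j. (\<lambda>z. f j (fst z) (snd z)) \<in> borel_measurable (borel \<Otimes>\<^sub>M borel)"
    and m: "\<And>j z. lmin P \<le> z \<Longrightarrow> (\<integral>\<^sup>+y. f j z y \<partial>dlaw P) = m j z"
  shows "(\<integral>\<^sup>+\<omega>. ennreal (exp (- disc P * arr P (Suc n) \<omega>)) *
        f (prephase S (arr P (Suc n) \<omega>) \<omega>) (level_before P S x \<omega> (Suc n)) (dem P (Suc n) \<omega>) \<partial>pspace P)
    = (\<integral>\<^sup>+\<omega>. segment n \<omega> (\<lambda>j z. ennreal (lam P) * m j z) \<partial>pspace P)"
proof (rule trans[OF compensator[OF assms(1)]], rule nn_integral_cong, unfold segment_def, rule nn_integral_cong)
  fix \<omega> s assume "\<omega> \<in> space (pspace P)"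
  then show "indicator {arr P n \<omega><..<arr P (Suc n) \<omega>} s * (ennreal (lam P * exp (- disc P * s)) *
         (\<integral>\<^sup>+y. f (prephase S s \<omega>) (prelevel P S x n s \<omega>) y \<partial>dlaw P))
     = indicator {arr P n \<omega><..<arr P (Suc n) \<omega>} s * (ennreal (exp (- disc P * s)) *
         (ennreal (lam P) * m (prephase S s \<omega>) (prelevel P S x n s \<omega>)))"
    using lam_pos by (simp add: m prelevel_ge ennreal_mult mult_ac)
qed

text \<open>The path inequality without negative terms. Raising every jump by \<open>2 * bnd\<close>
  adds a constant at each arrival on the right, and raising its mean adds the matching constant rate
  on the left. The terminal value is bounded by the discounted \<open>bnd\<close>, the switches so
  far by the full series.\<close>

lemma path_inequality_ennreal:
  assumes \<omega>: "\<omega> \<in> space (pspace P)" and pos: "0 \<le> val i x"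
  shows "ennreal (val i x) + (\<Sum>n<N. ennreal (exp (- disc P * arr P (Suc n) \<omega>)) * ennreal (jump n \<omega> + 2 * bnd)
        + segment n \<omega> (\<lambda>_ _. ennreal (lam P) * ennreal (2 * bnd)))
    \<le> ennreal (exp (- disc P * arr P N \<omega>) * bnd)
      + ((\<Sum>n<N. segment n \<omega> (\<lambda>j z. ennreal (hold_rate P j z))
          + segment n \<omega> (\<lambda>j z. ennreal (lam P) * ennreal (gain_mean j z))
          + segment n \<omega> (\<lambda>j z. ennreal (lam P) * ennreal (shortfall_mean P z))
          + ennreal (exp (- disc P * arr P (Suc n) \<omega>)) * ennreal (2 * bnd))
      + (\<Sum>k. ennreal (scost \<omega> k)))"
proof -
  obtain H where H: "0 \<le> H" "\<And>i z. hold_rate P i z \<le> H" using hold_rate_bound by blast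
  let ?int = "\<lambda>n g. set_lebesgue_integral lborel {arr P n \<omega>..arr P (Suc n) \<omega>}
     (\<lambda>s. exp (- disc P * s) * g (prephase S s \<omega>) (prelevel P S x n s \<omega>))"
  define a where "a n = ?int n (hold_rate P)" for n
  define b where "b n = ?int n (\<lambda>j z. lam P * gain_mean j z)" for n
  define c where "c n = ?int n (\<lambda>j z. lam P * shortfall_mean P z)" for n
  define d where "d n = ?int n (\<lambda>j z. lam P * (2 * bnd))" for n
  define e where "e n = exp (- disc P * arr P (Suc n) \<omega>)" for n
  note lp = less_imp_le[OF lam_pos]
  have bb: "lam P * gain_mean j z \<le> lam P * (4 * bnd)" "0 \<le> lam P * gain_mean j z" for j z
    using gain_mean_bounds[of j z] lp by (auto intro: mult_left_mono)
  have cc: "lam P * shortfall_mean P z \<le> lam P * (\<integral>y. pen_pos y \<partial>dlaw P)" if "lmin P \<le> z" for z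
    using shortfall_mean_le[OF that] lp by (auto intro: mult_left_mono)
  have c0: "0 \<le> lam P * shortfall_mean P z" for z using shortfall_mean_nonneg[of z] lp by simp
  have d0: "0 \<le> lam P * (2 * bnd)" using bnd_nonneg lp by simp
  have ra: "segment n \<omega> (\<lambda>j z. ennreal (hold_rate P j z)) = ennreal (a n)"
    "set_integrable lborel {arr P n \<omega>..arr P (Suc n) \<omega>}
       (\<lambda>s. exp (- disc P * s) * hold_rate P (prephase S s \<omega>) (prelevel P S x n s \<omega>))" "0 \<le> a n" for n
    unfolding a_def using segment_real[of \<omega> "hold_rate P" H n] \<omega> H hold_rate_nonneg
    by auto
  have rb: "segment n \<omega> (\<lambda>j z. ennreal (lam P) * ennreal (gain_mean j z)) = ennreal (b n)"
    "set_integrable lborel {arr P n \<omega>..arr P (Suc n) \<omega>}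
       (\<lambda>s. exp (- disc P * s) * (lam P * gain_mean (prephase S s \<omega>) (prelevel P S x n s \<omega>)))" "0 \<le> b n" for n
    unfolding b_def using segment_real[of \<omega> "\<lambda>j z. lam P * gain_mean j z" "lam P * (4 * bnd)" n] \<omega> bb lp gain_mean_bounds
    by (auto simp: ennreal_mult)
  have rc: "segment n \<omega> (\<lambda>j z. ennreal (lam P) * ennreal (shortfall_mean P z)) = ennreal (c n)"
    "set_integrable lborel {arr P n \<omega>..arr P (Suc n) \<omega>}
       (\<lambda>s. exp (- disc P * s) * (lam P * shortfall_mean P (prelevel P S x n s \<omega>)))" "0 \<le> c n" for n
    unfolding c_def using segment_real[of \<omega> "\<lambda>j z. lam P * shortfall_mean P z" "lam P * (\<integral>y. pen_pos y \<partial>dlaw P)" n]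
      \<omega> c0 cc lp shortfall_mean_nonneg
    by (auto simp: ennreal_mult)
  have rd: "segment n \<omega> (\<lambda>_ _. ennreal (lam P) * ennreal (2 * bnd)) = ennreal (d n)"
    "set_integrable lborel {arr P n \<omega>..arr P (Suc n) \<omega>} (\<lambda>s. exp (- disc P * s) * (lam P * (2 * bnd)))" "0 \<le> d n" for n
    unfolding d_def using segment_real[of \<omega> "\<lambda>j z. lam P * (2 * bnd)" "lam P * (2 * bnd)" n] \<omega> d0 lp bnd_nonneg
    by (auto simp: ennreal_mult)
  \<comment> \<open>\<open>drift\<close> splits into holding rate, shifted mean jump and mean
    penalty, minus the shift.\<close>
  have drift: "set_lebesgue_integral lborel {arr P n \<omega>..arr P (Suc n) \<omega>} (drift n \<omega>) = a n + b n + c n - d n" for n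
  proof -
    have "set_lebesgue_integral lborel {arr P n \<omega>..arr P (Suc n) \<omega>} (drift n \<omega>)
     = set_lebesgue_integral lborel {arr P n \<omega>..arr P (Suc n) \<omega>} (\<lambda>s.
        exp (- disc P * s) * hold_rate P (prephase S s \<omega>) (prelevel P S x n s \<omega>)
      + exp (- disc P * s) * (lam P * gain_mean (prephase S s \<omega>) (prelevel P S x n s \<omega>))
      + exp (- disc P * s) * (lam P * shortfall_mean P (prelevel P S x n s \<omega>))
      - exp (- disc P * s) * (lam P * (2 * bnd)))"
      by (intro set_lebesgue_integral_cong)
        (auto simp: drift_def running_def gain_mean_def algebra_simps)
    also have "\<dots> = a n + b n + c n - d n"
      unfolding a_def b_def c_def d_def
      using ra(2)[of n] rb(2)[of n] rc(2)[of n] rd(2)[of n] by (simp only: set_integral_add set_integral_diff)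
    finally show ?thesis .
  qed
  have jb: "0 \<le> jump n \<omega> + 2 * bnd" for n
    using gain_nonneg[of "prephase S (arr P (Suc n) \<omega>) \<omega>" "level_before P S x \<omega> (Suc n)" "dem P (Suc n) \<omega>"]
    by (simp add: jump_def gain_def)
  have real: "val i x + (\<Sum>n<N. e n * (jump n \<omega> + 2 * bnd) + d n) \<le>
     exp (- disc P * arr P N \<omega>) * bnd + ((\<Sum>n<N. a n + b n + c n + e n * (2 * bnd))
      + (\<Sum>k | swtime S (Suc k) \<omega> \<le> ereal (arr P N \<omega>). scost \<omega> k))"
  proof -
    have "exp (- disc P * arr P N \<omega>) * val (phase S (arr P N \<omega>) \<omega>) (level_after P S x \<omega> N)
       \<le> exp (- disc P * arr P N \<omega>) * bnd"
      using val_bound[of "phase S (arr P N \<omega>) \<omega>" "level_after P S x \<omega> N"] by (intro mult_left_mono) auto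
    moreover have "(\<Sum>n<N. set_lebesgue_integral lborel {arr P n \<omega>..arr P (Suc n) \<omega>} (drift n \<omega>)
          - exp (- disc P * arr P (Suc n) \<omega>) * jump n \<omega>)
       = (\<Sum>n<N. a n + b n + c n + e n * (2 * bnd)) - (\<Sum>n<N. e n * (jump n \<omega> + 2 * bnd) + d n)"
      unfolding sum_subtractf[symmetric] by (intro sum.cong) (auto simp: drift e_def algebra_simps)
    ultimately show ?thesis using path_inequality[OF \<omega>, of N] by linarith
  qed
  have s1: "0 \<le> e n * (jump n \<omega> + 2 * bnd) + d n" "0 \<le> a n + b n + c n + e n * (2 * bnd)" for n
    using jb[of n] ra(3)[of n] rb(3)[of n] rc(3)[of n] rd(3)[of n] bnd_nonneg by (auto simp: e_def)
  have sk: "0 \<le> scost \<omega> k" for k by (rule scost_nonneg[OF \<omega>])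
  have "ennreal (val i x) + (\<Sum>n<N. ennreal (e n * (jump n \<omega> + 2 * bnd) + d n))
    \<le> ennreal (exp (- disc P * arr P N \<omega>) * bnd) + ((\<Sum>n<N. ennreal (a n + b n + c n + e n * (2 * bnd)))
      + (\<Sum>k | swtime S (Suc k) \<omega> \<le> ereal (arr P N \<omega>). ennreal (scost \<omega> k)))"
    using real pos s1 sk bnd_nonneg by (simp add: sum_nonneg flip: ennreal_plus)
  also have "\<dots> \<le> ennreal (exp (- disc P * arr P N \<omega>) * bnd) + ((\<Sum>n<N. ennreal (a n + b n + c n + e n * (2 * bnd)))
      + (\<Sum>k. ennreal (scost \<omega> k)))"
    by (intro add_left_mono sum_le_suminf finite_switches[OF \<omega>]) auto
  also have "(\<Sum>n<N. ennreal (a n + b n + c n + e n * (2 * bnd))) = (\<Sum>n<N. segment n \<omega> (\<lambda>j z. ennreal (hold_rate P j z))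
          + segment n \<omega> (\<lambda>j z. ennreal (lam P) * ennreal (gain_mean j z))
          + segment n \<omega> (\<lambda>j z. ennreal (lam P) * ennreal (shortfall_mean P z))
          + ennreal (exp (- disc P * arr P (Suc n) \<omega>)) * ennreal (2 * bnd))"
    using ra(1,3) rb(1,3) rc(1,3) bnd_nonneg
    by (intro sum.cong refl) (simp add: e_def ennreal_mult)
  also have "(\<Sum>n<N. ennreal (e n * (jump n \<omega> + 2 * bnd) + d n)) =
      (\<Sum>n<N. ennreal (exp (- disc P * arr P (Suc n) \<omega>)) * ennreal (jump n \<omega> + 2 * bnd)
        + segment n \<omega> (\<lambda>_ _. ennreal (lam P) * ennreal (2 * bnd)))"
    using rd(1,3) jb bnd_nonneg by (intro sum.cong refl) (simp add: e_def ennreal_mult)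
  finally show ?thesis .
qed

text \<open>A given time belongs to at most one open interval between consecutive arrivals, so at
  most one term of the series is nonzero. Passing from the left limit of the phase to the phase
  changes the integrand on a null set.\<close>

lemma summed_segments_le_hold:
  assumes \<omega>: "\<omega> \<in> space (pspace P)"
  shows "(\<Sum>n. segment n \<omega> (\<lambda>j z. ennreal (hold_rate P j z)))
    \<le> (\<integral>\<^sup>+t\<in>{0..}. ennreal (exp (- disc P * t) * hold P (phase S t \<omega>) (inventory P S x t \<omega>)) \<partial>lborel)"
proof -
  let ?f = "\<lambda>n s. indicator {arr P n \<omega><..<arr P (Suc n) \<omega>} s *
      (ennreal (exp (- disc P * s)) * ennreal (hold_rate P (prephase S s \<omega>) (prelevel P S x n s \<omega>)))"
  have [measurable]: "(\<lambda>t. prephase S t \<omega>) \<in> measurable borel (count_space UNIV)"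
    "(\<lambda>t. prelevel P S x n t \<omega>) \<in> borel_measurable borel" for n
    using prephase_measurable_time[OF \<omega>] prelevel_measurable_time[OF \<omega>] by auto
  have [measurable]: "(\<lambda>t. hold_rate P (prephase S t \<omega>) (prelevel P S x n t \<omega>)) \<in> borel_measurable borel" for n
    by (rule measurable_compose_countable[where f="\<lambda>j t. hold_rate P j (prelevel P S x n t \<omega>)"]) measurable
  have "(\<Sum>n. segment n \<omega> (\<lambda>j z. ennreal (hold_rate P j z))) = (\<integral>\<^sup>+s. (\<Sum>n. ?f n s) \<partial>lborel)"
    unfolding segment_def by (rule nn_integral_suminf[symmetric]) measurable
  also have "\<dots> \<le> (\<integral>\<^sup>+t\<in>{0..}. ennreal (exp (- disc P * t) * hold P (phase S t \<omega>) (inventory P S x t \<omega>)) \<partial>lborel)"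
  proof (rule nn_integral_mono_AE)
    show "AE s in lborel. (\<Sum>n. ?f n s) \<le>
       ennreal (exp (- disc P * s) * hold P (phase S s \<omega>) (inventory P S x s \<omega>)) * indicator {0..} s"
      using AE_phase_prephase[OF \<omega>]
    proof eventually_elim
      case (elim s)
      show ?case
      proof (cases "\<exists>n. s \<in> {arr P n \<omega><..<arr P (Suc n) \<omega>}")
        case False
        then show ?thesis by auto
      next
        case True
        then obtain n where n: "arr P n \<omega> < s" "s < arr P (Suc n) \<omega>" by auto
        have other: "?f m s = 0" if "m \<noteq> n" for m
        proof -
          have "s \<notin> {arr P m \<omega><..<arr P (Suc m) \<omega>}"
          proof
            assume "s \<in> {arr P m \<omega><..<arr P (Suc m) \<omega>}"
            then have "m = n"
              using num_arrivals_eqI[OF \<omega>, of m s] num_arrivals_eqI[OF \<omega>, of n s] n by simp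
            then show False using that by simp
          qed
          then show ?thesis by simp
        qed
        have "(\<Sum>m. ?f m s) = (\<Sum>m\<in>{n}. ?f m s)"
          by (rule suminf_finite) (use other in auto)
        also have "\<dots> = ennreal (exp (- disc P * s) * hold_rate P (phase S s \<omega>) (inventory P S x s \<omega>))"
        proof -
          have "0 < s" using n arr_nonneg[OF \<omega>, of n] by simp
          then have "prephase S s \<omega> = phase S s \<omega>" using elim by simp
          moreover have "inventory P S x s \<omega> = prelevel P S x n s \<omega>"
            using n by (intro inventory_prelevel[OF \<omega>]) auto
          ultimately show ?thesis using n by (simp add: ennreal_mult hold_rate_nonneg)
        qed
        also have "hold_rate P (phase S s \<omega>) (inventory P S x s \<omega>) = hold P (phase S s \<omega>) (inventory P S x s \<omega>)"
          using n arr_nonneg[OF \<omega>, of n] hold_eq_hold_rate[OF \<omega>, of s] by simp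
        finally show ?thesis using n arr_nonneg[OF \<omega>, of n] by simp
      qed
    qed
  qed
  finally show ?thesis .
qed

text \<open>The integrals of the discount factor over the gaps telescope, and their total is at most
  \<open>1 / disc P\<close>.\<close>

lemma summed_segments_const:
  assumes \<omega>: "\<omega> \<in> space (pspace P)" and D: "0 \<le> D"
  shows "(\<Sum>n. segment n \<omega> (\<lambda>_ _. ennreal D)) \<le> ennreal (D / disc P)"
proof -
  let ?I = "\<lambda>n. set_lebesgue_integral lborel {arr P n \<omega>..arr P (Suc n) \<omega>} (\<lambda>s. exp (- disc P * s) * D)"
  have I: "segment n \<omega> (\<lambda>_ _. ennreal D) = ennreal (?I n)" "0 \<le> ?I n" for n
    using segment_real[of \<omega> "\<lambda>_ _. D" D n] \<omega> D by auto
  have eq: "?I n = D / disc P * (exp (- disc P * arr P n \<omega>) - exp (- disc P * arr P (Suc n) \<omega>))" for n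
    using exp_set_integral[OF less_imp_le[OF arr_mono[OF \<omega>, of n]]] by simp
  have "(\<Sum>n<N. segment n \<omega> (\<lambda>_ _. ennreal D)) \<le> ennreal (D / disc P)" for N
  proof -
    have "(\<Sum>n<N. ?I n) = D / disc P * (\<Sum>n<N. exp (- disc P * arr P n \<omega>) - exp (- disc P * arr P (Suc n) \<omega>))"
      unfolding eq by (simp add: sum_distrib_left)
    also have "\<dots> = D / disc P * (exp (- disc P * arr P 0 \<omega>) - exp (- disc P * arr P N \<omega>))"
      by (simp only: sum_lessThan_telescope'[of "\<lambda>n. exp (- disc P * arr P n \<omega>)"])
    also have "\<dots> \<le> D / disc P * 1"
      using D disc_pos arr_0[OF \<omega>] by (intro mult_left_mono) auto
    finally have "(\<Sum>n<N. ?I n) \<le> D / disc P" by simp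
    then show ?thesis unfolding I(1) using I(2) by (simp add: ennreal_leI)
  qed
  then show ?thesis by (intro suminf_le_const summableI)
qed

text \<open>In expectation the compensator formula matches jumps with mean jumps, penalties with
  mean penalties, and shifts at arrivals with shift rates. The first and the last pair stand on
  opposite sides of the path inequality and cancel; holding, switching and penalty costs
  remain.\<close>

lemma val_le_cost:
  assumes pos: "0 \<le> val i x"
  shows "ennreal (val i x) \<le> cost P x S"
proof -
  let ?J = "\<lambda>n \<omega>. ennreal (exp (- disc P * arr P (Suc n) \<omega>)) * ennreal (jump n \<omega> + 2 * bnd)"
  let ?D = "\<lambda>n \<omega>. ennreal (exp (- disc P * arr P (Suc n) \<omega>)) * ennreal (2 * bnd)"
  let ?P = "\<lambda>n \<omega>. ennreal (exp (- disc P * arr P (Suc n) \<omega>)) *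
     ennreal (shortfall_cost P (level_before P S x \<omega> (Suc n)) (dem P (Suc n) \<omega>))"
  let ?h = "\<lambda>n \<omega>. segment n \<omega> (\<lambda>j z. ennreal (hold_rate P j z))"
  let ?g = "\<lambda>n \<omega>. segment n \<omega> (\<lambda>j z. ennreal (lam P) * ennreal (gain_mean j z))"
  let ?p = "\<lambda>n \<omega>. segment n \<omega> (\<lambda>j z. ennreal (lam P) * ennreal (shortfall_mean P z))"
  let ?d = "\<lambda>n \<omega>. segment n \<omega> (\<lambda>_ _. ennreal (lam P) * ennreal (2 * bnd))"
  let ?E = "\<lambda>f. \<integral>\<^sup>+\<omega>. f \<omega> \<partial>pspace P"
  have seg[measurable]: "?h n \<in> borel_measurable (pspace P)" "?g n \<in> borel_measurable (pspace P)"
     "?p n \<in> borel_measurable (pspace P)" "?d n \<in> borel_measurable (pspace P)" for n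
    by (rule segment_measurable; measurable)+
  have jm[measurable]: "?J n \<in> borel_measurable (pspace P)" for n
    using before_arrival_measurable[of "\<lambda>j z y. ennreal (gain j z y)" n]
    unfolding gain_def jump_def by measurable
  have pm[measurable]: "?P n \<in> borel_measurable (pspace P)" for n
    using before_arrival_measurable[of "\<lambda>j z y. ennreal (shortfall_cost P z y)" n] by measurable
  have EJ: "?E (?J n) = ?E (?g n)" for n
  proof -
    have "?E (?J n) = (\<integral>\<^sup>+\<omega>. ennreal (exp (- disc P * arr P (Suc n) \<omega>)) *
        ennreal (gain (prephase S (arr P (Suc n) \<omega>) \<omega>) (level_before P S x \<omega> (Suc n)) (dem P (Suc n) \<omega>)) \<partial>pspace P)"
      unfolding gain_def jump_def ..
    also have "\<dots> = ?E (?g n)"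
      by (rule segment_compensator[of "\<lambda>j z y. ennreal (gain j z y)"]) (auto simp: nn_integral_gain)
    finally show ?thesis .
  qed
  have EP: "?E (?P n) = ?E (?p n)" for n
    by (rule segment_compensator[of "\<lambda>j z y. ennreal (shortfall_cost P z y)"]) (auto simp: nn_integral_shortfall)
  have ED: "?E (?D n) = ?E (?d n)" for n
    using segment_compensator[of "\<lambda>j z y. ennreal (2 * bnd)" "\<lambda>j z. ennreal (2 * bnd)" n]
    by (simp add: demand.emeasure_space_1[simplified])
  \<comment> \<open>In \<open>ennreal\<close> only finite quantities can be cancelled. The shift has
    a finite discounted total, and the shifted jumps are at most twice the shift.\<close>
  have fin: "(\<Sum>n. ?E (?d n)) < \<infinity>"
  proof -
    have "(\<Sum>n. ?E (?d n)) = ?E (\<lambda>\<omega>. \<Sum>n. ?d n \<omega>)" by (rule nn_integral_suminf[symmetric]) measurable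
    also have "\<dots> \<le> ?E (\<lambda>\<omega>. ennreal (lam P * (2 * bnd) / disc P))"
      using bnd_nonneg lam_pos summed_segments_const[of _ "lam P * (2 * bnd)"]
      by (intro nn_integral_mono) (simp add: ennreal_mult)
    also have "\<dots> < \<infinity>" by (simp add: emeasure_space_1)
    finally show ?thesis .
  qed
  have finJ: "(\<Sum>n. ?E (?J n)) < \<infinity>"
  proof -
    have "?E (?J n) \<le> ennreal 2 * ?E (?D n)" for n
    proof -
      have "?J n \<omega> \<le> ennreal 2 * ?D n \<omega>" if "\<omega> \<in> space (pspace P)" for \<omega>
      proof -
        have "jump n \<omega> \<le> 2 * bnd"
          using restart_bound[of "prephase S (arr P (Suc n) \<omega>) \<omega>" "served P (level_before P S x \<omega> (Suc n)) (dem P (Suc n) \<omega>)"]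
            val_bound[of "prephase S (arr P (Suc n) \<omega>) \<omega>" "level_before P S x \<omega> (Suc n)"]
          unfolding jump_def abs_le_iff by linarith
        then have "ennreal (jump n \<omega> + 2 * bnd) \<le> ennreal (2 * (2 * bnd))" by (intro ennreal_leI) simp
        also have "\<dots> = ennreal 2 * ennreal (2 * bnd)" using bnd_nonneg by (intro ennreal_mult) auto
        finally show ?thesis by (subst mult.left_commute) (intro mult_left_mono, auto)
      qed
      then have "?E (?J n) \<le> ?E (\<lambda>\<omega>. ennreal 2 * ?D n \<omega>)" by (rule nn_integral_mono)
      also have "\<dots> = ennreal 2 * ?E (?D n)" by (rule nn_integral_cmult) measurable
      finally show ?thesis .
    qed
    then have "(\<Sum>n. ?E (?J n)) \<le> (\<Sum>n. ennreal 2 * ?E (?D n))" by (intro suminf_le summableI)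
    also have "\<dots> = ennreal 2 * (\<Sum>n. ?E (?d n))" unfolding ED by (rule ennreal_suminf_cmult)
    also have "\<dots> < \<infinity>" using fin by (simp add: ennreal_mult_less_top)
    finally show ?thesis .
  qed
  \<comment> \<open>Letting the number of arrivals tend to infinity removes the terminal value:
    candidates are bounded and the discount factor at the arrivals tends to 0.\<close>
  have path: "ennreal (val i x) + (\<Sum>n. ?J n \<omega> + ?d n \<omega>) \<le>
     (\<Sum>k. ennreal (scost \<omega> k)) + (\<Sum>n. ?h n \<omega> + ?g n \<omega> + ?p n \<omega> + ?D n \<omega>)"
    if \<omega>: "\<omega> \<in> space (pspace P)" for \<omega>
  proof -
    have lim: "(\<lambda>N. \<Sum>n<N. f n) \<longlonglongrightarrow> (\<Sum>n. f n)" for f :: "nat \<Rightarrow> ennreal"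
      by (rule summable_LIMSEQ) (rule summableI)
    have "(\<lambda>N. exp (- disc P * arr P N \<omega>) * bnd) \<longlonglongrightarrow> 0 * bnd"
    proof (intro tendsto_mult tendsto_const)
      have "filterlim (\<lambda>N. disc P * arr P N \<omega>) at_top sequentially"
        using disc_pos arr_unbounded[OF \<omega>] by (intro filterlim_tendsto_pos_mult_at_top[OF tendsto_const])
      then have "filterlim (\<lambda>N. - disc P * arr P N \<omega>) at_bot sequentially"
        by (simp add: filterlim_uminus_at_bot)
      then show "(\<lambda>N. exp (- disc P * arr P N \<omega>)) \<longlonglongrightarrow> 0"
        by (rule filterlim_compose[OF exp_at_bot])
    qed
    then have 0: "(\<lambda>N. ennreal (exp (- disc P * arr P N \<omega>) * bnd)) \<longlonglongrightarrow> 0"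
      using tendsto_ennrealI by fastforce
    have "ennreal (val i x) + (\<Sum>n. ?J n \<omega> + ?d n \<omega>) \<le>
      0 + ((\<Sum>n. ?h n \<omega> + ?g n \<omega> + ?p n \<omega> + ?D n \<omega>) + (\<Sum>k. ennreal (scost \<omega> k)))"
    proof (rule LIMSEQ_le)
      show "(\<lambda>N. ennreal (val i x) + (\<Sum>n<N. ?J n \<omega> + ?d n \<omega>)) \<longlonglongrightarrow> ennreal (val i x) + (\<Sum>n. ?J n \<omega> + ?d n \<omega>)"
        by (intro tendsto_add tendsto_const lim)
      show "(\<lambda>N. ennreal (exp (- disc P * arr P N \<omega>) * bnd) + ((\<Sum>n<N. ?h n \<omega> + ?g n \<omega> + ?p n \<omega> + ?D n \<omega>)
          + (\<Sum>k. ennreal (scost \<omega> k)))) \<longlonglongrightarrow> 0 + ((\<Sum>n. ?h n \<omega> + ?g n \<omega> + ?p n \<omega> + ?D n \<omega>) + (\<Sum>k. ennreal (scost \<omega> k)))"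
        by (intro tendsto_add tendsto_const lim 0)
    qed (use path_inequality_ennreal[OF \<omega> pos] in blast)
    then show ?thesis by (simp add: add.commute)
  qed
  \<comment> \<open>The switching costs are the one summand without known measurability, so the sum
    on the right is bounded through the lower integral.\<close>
  have "?E (\<lambda>\<omega>. ennreal (val i x) + (\<Sum>n. ?J n \<omega> + ?d n \<omega>)) \<le>
     ?E (\<lambda>\<omega>. \<Sum>k. ennreal (scost \<omega> k)) + ?E (\<lambda>\<omega>. \<Sum>n. ?h n \<omega> + ?g n \<omega> + ?p n \<omega> + ?D n \<omega>)"
    by (rule nn_integral_le_add_nonmeasurable[OF _ _ path]) measurable
  also have "?E (\<lambda>\<omega>. ennreal (val i x) + (\<Sum>n. ?J n \<omega> + ?d n \<omega>)) =
      ennreal (val i x) + ((\<Sum>n. ?E (?J n)) + (\<Sum>n. ?E (?d n)))"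
  proof -
    have "?E (\<lambda>\<omega>. ennreal (val i x) + (\<Sum>n. ?J n \<omega> + ?d n \<omega>)) =
       ?E (\<lambda>\<omega>. ennreal (val i x)) + ?E (\<lambda>\<omega>. \<Sum>n. ?J n \<omega> + ?d n \<omega>)"
      by (rule nn_integral_add) measurable
    also have "?E (\<lambda>\<omega>. \<Sum>n. ?J n \<omega> + ?d n \<omega>) = (\<Sum>n. ?E (\<lambda>\<omega>. ?J n \<omega> + ?d n \<omega>))"
      by (rule nn_integral_suminf) measurable
    also have "\<dots> = (\<Sum>n. ?E (?J n) + ?E (?d n))"
      by (intro suminf_cong nn_integral_add) measurable
    also have "\<dots> = (\<Sum>n. ?E (?J n)) + (\<Sum>n. ?E (?d n))"
      by (rule suminf_add[symmetric]) (rule summableI)+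
    finally show ?thesis by (simp add: emeasure_space_1)
  qed
  also have "?E (\<lambda>\<omega>. \<Sum>n. ?h n \<omega> + ?g n \<omega> + ?p n \<omega> + ?D n \<omega>) =
      (\<Sum>n. ?E (?h n)) + (\<Sum>n. ?E (?g n)) + (\<Sum>n. ?E (?p n)) + (\<Sum>n. ?E (?D n))"
  proof -
    have "?E (\<lambda>\<omega>. \<Sum>n. ?h n \<omega> + ?g n \<omega> + ?p n \<omega> + ?D n \<omega>) = (\<Sum>n. ?E (\<lambda>\<omega>. ?h n \<omega> + ?g n \<omega> + ?p n \<omega> + ?D n \<omega>))"
      by (rule nn_integral_suminf) measurable
    also have "\<dots> = (\<Sum>n. ?E (?h n) + ?E (?g n) + ?E (?p n) + ?E (?D n))"
    proof (rule suminf_cong)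
      fix n
      have "?E (\<lambda>\<omega>. ?h n \<omega> + ?g n \<omega> + ?p n \<omega> + ?D n \<omega>) = ?E (\<lambda>\<omega>. ?h n \<omega> + ?g n \<omega> + ?p n \<omega>) + ?E (?D n)"
        by (rule nn_integral_add) measurable
      also have "?E (\<lambda>\<omega>. ?h n \<omega> + ?g n \<omega> + ?p n \<omega>) = ?E (\<lambda>\<omega>. ?h n \<omega> + ?g n \<omega>) + ?E (?p n)"
        by (rule nn_integral_add) measurable
      also have "?E (\<lambda>\<omega>. ?h n \<omega> + ?g n \<omega>) = ?E (?h n) + ?E (?g n)"
        by (rule nn_integral_add) measurable
      finally show "?E (\<lambda>\<omega>. ?h n \<omega> + ?g n \<omega> + ?p n \<omega> + ?D n \<omega>) = ?E (?h n) + ?E (?g n) + ?E (?p n) + ?E (?D n)" .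
    qed
    also have "\<dots> = (\<Sum>n. ?E (?h n)) + (\<Sum>n. ?E (?g n)) + (\<Sum>n. ?E (?p n)) + (\<Sum>n. ?E (?D n))"
      by (simp add: suminf_add[OF summableI summableI, symmetric])
    finally show ?thesis .
  qed
  finally have "ennreal (val i x) + ((\<Sum>n. ?E (?J n)) + (\<Sum>n. ?E (?d n))) \<le>
     (?E (\<lambda>\<omega>. \<Sum>k. ennreal (scost \<omega> k)) + (\<Sum>n. ?E (?h n)) + (\<Sum>n. ?E (?p n))) + ((\<Sum>n. ?E (?J n)) + (\<Sum>n. ?E (?d n)))"
    unfolding EJ[symmetric] ED by (simp add: ac_simps)
  then have "ennreal (val i x) \<le> ?E (\<lambda>\<omega>. \<Sum>k. ennreal (scost \<omega> k)) + (\<Sum>n. ?E (?h n)) + (\<Sum>n. ?E (?p n))"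
    using fin finJ by (subst (asm) (1 2) add.commute, subst (asm) ennreal_add_left_cancel_le) auto
  also have "(\<Sum>n. ?E (?h n)) = ?E (\<lambda>\<omega>. \<Sum>n. ?h n \<omega>)" by (rule nn_integral_suminf[symmetric]) measurable
  also have "(\<Sum>n. ?E (?p n)) = ?E (\<lambda>\<omega>. \<Sum>n. ?P n \<omega>)"
    unfolding EP[symmetric] by (rule nn_integral_suminf[symmetric]) measurable
  also have "?E (\<lambda>\<omega>. \<Sum>k. ennreal (scost \<omega> k)) + ?E (\<lambda>\<omega>. \<Sum>n. ?h n \<omega>) + ?E (\<lambda>\<omega>. \<Sum>n. ?P n \<omega>) \<le>
     ?E (\<lambda>\<omega>. \<Sum>k. ennreal (scost \<omega> k))
     + ?E (\<lambda>\<omega>. \<integral>\<^sup>+t\<in>{0..}. ennreal (exp (- disc P * t) * hold P (phase S t \<omega>) (inventory P S x t \<omega>)) \<partial>lborel)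
     + ?E (\<lambda>\<omega>. \<Sum>n. ?P n \<omega>)"
    by (intro add_mono order_refl nn_integral_mono summed_segments_le_hold)
  also have "\<dots> = cost P x S"
    unfolding cost_def scost_def
    by (simp add: add.commute shortfall_cost_def Let_def ennreal_mult'[symmetric])
  finally show ?thesis .
qed

end

section \<open>Stopping times of the demand filtration\<close>

text \<open>One inequality is the previous estimate applied to the simple functions below the sum.
  For the other, \<open>g\<close> is added to each simple function below \<open>f\<close>.\<close>

lemma nn_integral_add_nonmeasurable:
  fixes f g :: "'a \<Rightarrow> ennreal"
  assumes g[measurable]: "g \<in> borel_measurable M"
  shows "(\<integral>\<^sup>+x. f x + g x \<partial>M) = (\<integral>\<^sup>+x. f x \<partial>M) + (\<integral>\<^sup>+x. g x \<partial>M)"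
proof (rule antisym)
  show "(\<integral>\<^sup>+x. f x + g x \<partial>M) \<le> (\<integral>\<^sup>+x. f x \<partial>M) + (\<integral>\<^sup>+x. g x \<partial>M)"
    unfolding nn_integral_def[of M "\<lambda>x. f x + g x"]
  proof (rule SUP_least)
    fix h assume "h \<in> {h. simple_function M h \<and> h \<le> (\<lambda>x. f x + g x)}"
    then have h: "simple_function M h" "\<And>x. h x \<le> f x + g x" by (auto simp: le_fun_def)
    then have "integral\<^sup>S M h = (\<integral>\<^sup>+x. h x \<partial>M)" by (simp add: nn_integral_eq_simple_integral)
    also have "\<dots> \<le> (\<integral>\<^sup>+x. f x \<partial>M) + (\<integral>\<^sup>+x. g x \<partial>M)"
      using h by (intro nn_integral_le_add_nonmeasurable) (auto intro: borel_measurable_simple_function)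
    finally show "integral\<^sup>S M h \<le> (\<integral>\<^sup>+x. f x \<partial>M) + (\<integral>\<^sup>+x. g x \<partial>M)" .
  qed
  have "(\<integral>\<^sup>+x. f x \<partial>M) + (\<integral>\<^sup>+x. g x \<partial>M) =
     (SUP h\<in>{h. simple_function M h \<and> h \<le> f}. integral\<^sup>S M h + (\<integral>\<^sup>+x. g x \<partial>M))"
    unfolding nn_integral_def[of M f]
    by (rule ennreal_SUP_add_left[symmetric]) (auto intro: exI[of _ "\<lambda>_. 0"] simp: le_fun_def)
  also have "\<dots> \<le> (\<integral>\<^sup>+x. f x + g x \<partial>M)"
  proof (rule SUP_least)
    fix h assume "h \<in> {h. simple_function M h \<and> h \<le> f}"
    then have h: "simple_function M h" "\<And>x. h x \<le> f x" by (auto simp: le_fun_def)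
    then have [measurable]: "h \<in> borel_measurable M" by (auto intro: borel_measurable_simple_function)
    have "integral\<^sup>S M h + (\<integral>\<^sup>+x. g x \<partial>M) = (\<integral>\<^sup>+x. h x \<partial>M) + (\<integral>\<^sup>+x. g x \<partial>M)"
      using h by (simp add: nn_integral_eq_simple_integral)
    also have "\<dots> = (\<integral>\<^sup>+x. h x + g x \<partial>M)" by (rule nn_integral_add[symmetric]) auto
    also have "\<dots> \<le> (\<integral>\<^sup>+x. f x + g x \<partial>M)" using h by (intro nn_integral_mono add_right_mono) auto
    finally show "integral\<^sup>S M h + (\<integral>\<^sup>+x. g x \<partial>M) \<le> (\<integral>\<^sup>+x. f x + g x \<partial>M)" .
  qed
  finally show "(\<integral>\<^sup>+x. f x \<partial>M) + (\<integral>\<^sup>+x. g x \<partial>M) \<le> (\<integral>\<^sup>+x. f x + g x \<partial>M)" .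
qed

section \<open>Discounted sums over the arrivals\<close>

context production_inventory
begin

text \<open>The past, the next gap and its demand are independent, so the expectation factors;
  \<open>lam P / (lam P + disc P)\<close> is the Laplace transform of the exponential gap at the
  discount rate.\<close>

lemma discounted_step:
  assumes [measurable]: "g \<in> borel_measurable borel"
  shows "(\<integral>\<^sup>+\<omega>. ennreal (exp (- disc P * arr P (Suc n) \<omega>)) * g (dem P (Suc n) \<omega>) \<partial>pspace P) =
    (\<integral>\<^sup>+\<omega>. ennreal (exp (- disc P * arr P n \<omega>)) \<partial>pspace P) * (ennreal (lam P / (lam P + disc P)) * (\<integral>\<^sup>+y. g y \<partial>dlaw P))"
proof -
  have [measurable]: "arr P n \<in> borel_measurable (history n)" by (rule history_arr) simp
  define f where "f z = ennreal (exp (- disc P * arr P n (fst z))) * (ennreal (exp (- disc P * fst (snd z))) * g (snd (snd z)))" for z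
  have f: "f \<in> borel_measurable (history n \<Otimes>\<^sub>M (borel \<Otimes>\<^sub>M borel))" unfolding f_def by measurable
  let ?r = "\<integral>\<^sup>+t. ennreal (exponential_density (lam P) t) * ennreal (exp (- disc P * t)) \<partial>lborel"
  have "(\<integral>\<^sup>+\<omega>. ennreal (exp (- disc P * arr P (Suc n) \<omega>)) * g (dem P (Suc n) \<omega>) \<partial>pspace P)
     = (\<integral>\<^sup>+\<omega>. f (\<omega>, gap n \<omega>, dem P (Suc n) \<omega>) \<partial>pspace P)"
  proof (rule nn_integral_cong)
    fix \<omega>
    have "exp (- disc P * arr P (Suc n) \<omega>) = exp (- disc P * arr P n \<omega>) * exp (- disc P * gap n \<omega>)"
      by (simp add: gap_def algebra_simps flip: exp_add)
    then show "ennreal (exp (- disc P * arr P (Suc n) \<omega>)) * g (dem P (Suc n) \<omega>) = f (\<omega>, gap n \<omega>, dem P (Suc n) \<omega>)"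
      by (simp add: f_def ennreal_mult mult.assoc)
  qed
  also have "\<dots> = (\<integral>\<^sup>+\<omega>. (\<integral>\<^sup>+t. ennreal (exponential_density (lam P) t) * (\<integral>\<^sup>+y. f (\<omega>, t, y) \<partial>dlaw P) \<partial>lborel) \<partial>past_law n)"
    by (rule nn_integral_joint[OF f])
  also have "\<dots> = (\<integral>\<^sup>+\<omega>. ennreal (exp (- disc P * arr P n \<omega>)) * (?r * (\<integral>\<^sup>+y. g y \<partial>dlaw P)) \<partial>past_law n)"
  proof (rule nn_integral_cong)
    fix \<omega>
    have inner: "(\<integral>\<^sup>+y. f (\<omega>, t, y) \<partial>dlaw P) = (ennreal (exp (- disc P * arr P n \<omega>)) * ennreal (exp (- disc P * t))) * (\<integral>\<^sup>+y. g y \<partial>dlaw P)" for t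
      unfolding f_def fst_conv snd_conv mult.assoc[symmetric] by (rule nn_integral_cmult) simp
    have "(\<integral>\<^sup>+t. ennreal (exponential_density (lam P) t) * (\<integral>\<^sup>+y. f (\<omega>, t, y) \<partial>dlaw P) \<partial>lborel)
      = (\<integral>\<^sup>+t. (ennreal (exponential_density (lam P) t) * ennreal (exp (- disc P * t))) *
          (ennreal (exp (- disc P * arr P n \<omega>)) * (\<integral>\<^sup>+y. g y \<partial>dlaw P)) \<partial>lborel)"
      unfolding inner by (rule nn_integral_cong) (simp only: mult_ac)
    also have "\<dots> = ?r * (ennreal (exp (- disc P * arr P n \<omega>)) * (\<integral>\<^sup>+y. g y \<partial>dlaw P))"
      by (rule nn_integral_multc) measurable
    finally show "(\<integral>\<^sup>+t. ennreal (exponential_density (lam P) t) * (\<integral>\<^sup>+y. f (\<omega>, t, y) \<partial>dlaw P) \<partial>lborel)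
      = ennreal (exp (- disc P * arr P n \<omega>)) * (?r * (\<integral>\<^sup>+y. g y \<partial>dlaw P))" by (simp add: mult_ac)
  qed
  also have "\<dots> = (\<integral>\<^sup>+\<omega>. ennreal (exp (- disc P * arr P n \<omega>)) \<partial>past_law n) * (?r * (\<integral>\<^sup>+y. g y \<partial>dlaw P))"
    using measurable_compose[OF history_arr[OF order_refl, of n], of "\<lambda>a. ennreal (exp (- disc P * a))" borel]
    by (intro nn_integral_multc) (simp add: measurable_cong_sets[OF sets_past_law refl])
  also have "(\<integral>\<^sup>+\<omega>. ennreal (exp (- disc P * arr P n \<omega>)) \<partial>past_law n) = (\<integral>\<^sup>+\<omega>. ennreal (exp (- disc P * arr P n \<omega>)) \<partial>pspace P)"
    using measurable_compose[OF history_arr[OF order_refl, of n], of "\<lambda>a. ennreal (exp (- disc P * a))" borel]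
    unfolding past_law_def by (intro nn_integral_distr) simp_all
  also have "?r = ennreal (lam P / (lam P + disc P))"
  proof -
    let ?m = "lam P + disc P"
    have m: "0 < ?m" using lam_pos disc_pos by simp
    have "?r = (\<integral>\<^sup>+t. ennreal (lam P / ?m) * ennreal (exponential_density ?m t) \<partial>lborel)"
    proof (rule nn_integral_cong)
      fix t
      have "exp (- t * lam P) * exp (- disc P * t) = exp (- t * ?m)" by (simp add: algebra_simps flip: exp_add)
      then have "exponential_density (lam P) t * exp (- disc P * t) = lam P / ?m * exponential_density ?m t"
        using m by (simp add: exponential_density_def)
      then show "ennreal (exponential_density (lam P) t) * ennreal (exp (- disc P * t)) =
         ennreal (lam P / ?m) * ennreal (exponential_density ?m t)"
        using lam_pos m exponential_density_nonneg by (simp flip: ennreal_mult ennreal_mult')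
    qed
    also have "\<dots> = ennreal (lam P / ?m) * (\<integral>\<^sup>+t. ennreal (exponential_density ?m t) \<partial>lborel)"
      by (rule nn_integral_cmult) measurable
    also have "(\<integral>\<^sup>+t. ennreal (exponential_density ?m t) \<partial>lborel) = 1"
      using prob_space.emeasure_space_1[OF prob_space_exponential_density[OF m]]
      by (simp add: emeasure_density)
    finally show ?thesis by simp
  qed
  finally show ?thesis .
qed

text \<open>Each gap contributes the same factor below 1 to the expected discount, so the series is
  geometric.\<close>

lemma discounted_sum_finite:
  assumes [measurable]: "g \<in> borel_measurable borel" and fin: "(\<integral>\<^sup>+y. g y \<partial>dlaw P) < \<infinity>"
  shows "(\<integral>\<^sup>+\<omega>. (\<Sum>n. ennreal (exp (- disc P * arr P (Suc n) \<omega>)) * g (dem P (Suc n) \<omega>)) \<partial>pspace P) < \<infinity>"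
proof -
  let ?r = "lam P / (lam P + disc P)"
  have r: "0 \<le> ?r" "?r < 1" using lam_pos disc_pos by (auto simp: field_simps)
  have geo: "(\<integral>\<^sup>+\<omega>. ennreal (exp (- disc P * arr P n \<omega>)) \<partial>pspace P) = ennreal (?r ^ n)" for n
  proof (induction n)
    case 0
    have "(\<integral>\<^sup>+\<omega>. ennreal (exp (- disc P * arr P 0 \<omega>)) \<partial>pspace P) = (\<integral>\<^sup>+\<omega>. 1 \<partial>pspace P)"
      by (rule nn_integral_cong) (simp add: arr_0)
    then show ?case by (simp add: emeasure_space_1)
  next
    case (Suc n)
    then show ?case
      using discounted_step[of "\<lambda>_. 1" n] r by (simp add: demand.emeasure_space_1[simplified] ennreal_mult[symmetric] mult.commute)
  qed
  have "(\<integral>\<^sup>+\<omega>. (\<Sum>n. ennreal (exp (- disc P * arr P (Suc n) \<omega>)) * g (dem P (Suc n) \<omega>)) \<partial>pspace P)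
    = (\<Sum>n. \<integral>\<^sup>+\<omega>. ennreal (exp (- disc P * arr P (Suc n) \<omega>)) * g (dem P (Suc n) \<omega>) \<partial>pspace P)"
    by (rule nn_integral_suminf) measurable
  also have "\<dots> = (\<Sum>n. ennreal (?r ^ n) * (ennreal ?r * (\<integral>\<^sup>+y. g y \<partial>dlaw P)))"
    by (simp only: discounted_step[OF assms(1)] geo)
  also have "\<dots> = (\<Sum>n. ennreal (?r ^ n)) * (ennreal ?r * (\<integral>\<^sup>+y. g y \<partial>dlaw P))"
    by (rule ennreal_suminf_multc)
  also have "(\<Sum>n. ennreal (?r ^ n)) = ennreal (\<Sum>n. ?r ^ n)"
    using r by (intro suminf_ennreal2 summable_geometric) (simp_all only: real_norm_def abs_of_nonneg zero_le_power)
  also have "\<dots> * (ennreal ?r * (\<integral>\<^sup>+y. g y \<partial>dlaw P)) < \<infinity>"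
    using fin by (simp add: ennreal_mult_less_top)
  finally show ?thesis .
qed

section \<open>Arrival times and demands as seen by the filtration\<close>

lemma total_demand_at:
  assumes "\<omega> \<in> space (pspace P)" "arr P n \<omega> \<le> s" "s < arr P (Suc n) \<omega>"
  shows "total_demand P s \<omega> = (\<Sum>m=1..n. dem P m \<omega>)"
  unfolding total_demand_def num_arrivals_eqI[OF assms] ..

lemma partial_demand_mono:
  assumes "\<omega> \<in> space (pspace P)" "m \<le> n" shows "(\<Sum>k=1..m. dem P k \<omega>) \<le> (\<Sum>k=1..n. dem P k \<omega>)"
  using assms by (intro sum_mono2) (auto intro!: less_imp_le[OF dem_pos])

lemma partial_demand_strict:
  assumes \<omega>: "\<omega> \<in> space (pspace P)" and "m < n" shows "(\<Sum>k=1..m. dem P k \<omega>) < (\<Sum>k=1..n. dem P k \<omega>)"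
proof -
  have "(\<Sum>k=1..m. dem P k \<omega>) < (\<Sum>k=1..Suc m. dem P k \<omega>)" using dem_pos[OF \<omega>, of "Suc m"] by simp
  also have "\<dots> \<le> (\<Sum>k=1..n. dem P k \<omega>)" using assms by (intro partial_demand_mono) auto
  finally show ?thesis .
qed

lemma arr_le_imp_total_demand:
  assumes \<omega>: "\<omega> \<in> space (pspace P)" and "arr P n \<omega> \<le> s"
  shows "(\<Sum>m=1..n. dem P m \<omega>) \<le> total_demand P s \<omega>"
proof -
  have "0 \<le> s" using assms arr_nonneg[OF \<omega>, of n] by simp
  then obtain k where k: "arr P k \<omega> \<le> s" "s < arr P (Suc k) \<omega>" by (rule arrival_interval[OF \<omega>])
  then have "arr P n \<omega> < arr P (Suc k) \<omega>" using assms by simp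
  then have "n \<le> k" using arr_le_iff[OF \<omega>, of "Suc k" n] by (simp add: not_le[symmetric])
  then show ?thesis unfolding total_demand_at[OF \<omega> k] by (rule partial_demand_mono[OF \<omega>])
qed

lemma demand_filtration_mono: "s \<le> t \<Longrightarrow> sets (demand_filtration P s) \<subseteq> sets (demand_filtration P t)"
  unfolding sets_demand_filtration by (intro sigma_sets_mono') (auto intro: order_trans)

lemma total_demand_adapted:
  assumes "0 \<le> s" "s \<le> t" shows "total_demand P s \<in> borel_measurable (demand_filtration P t)"
proof (rule measurableI)
  fix A :: "real set" assume "A \<in> sets borel"
  then show "total_demand P s -` A \<inter> space (demand_filtration P t) \<in> sets (demand_filtration P t)"
    using assms unfolding sets_demand_filtration space_demand_filtration by (intro sigma_sets.Basic) auto
qed simp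

text \<open>An arrival is seen as an increase of the total demand, demands being positive.\<close>

lemma arr_stopping:
  assumes "0 \<le> s" shows "{\<omega> \<in> space (pspace P). arr P n \<omega> \<le> s} \<in> sets (demand_filtration P s)"
  using assms
proof (induction n arbitrary: s)
  case 0
  have "{\<omega> \<in> space (pspace P). arr P 0 \<omega> \<le> s} = space (demand_filtration P s)"
    using 0 by (auto simp: arr_0)
  then show ?case by (metis sets.top)
next
  case (Suc n)
  let ?F = "demand_filtration P s"
  \<comment> \<open>The gap before the arrival \<open>Suc n\<close> contains a rational time;
    comparing the demand there with the demand at \<open>s\<close> detects the arrival by countably
    many events.\<close>
  let ?Q = "{q::rat. 0 \<le> real_of_rat q \<and> real_of_rat q < s}"
  let ?D = "\<lambda>q. {\<omega> \<in> space (pspace P). arr P n \<omega> \<le> real_of_rat q} \<inter>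
       {\<omega> \<in> space ?F. total_demand P (real_of_rat q) \<omega> < total_demand P s \<omega>}"
  have D: "?D q \<in> sets ?F" if q: "q \<in> ?Q" for q
  proof (rule sets.Int)
    show "{\<omega> \<in> space (pspace P). arr P n \<omega> \<le> real_of_rat q} \<in> sets ?F"
      using Suc.IH[of "real_of_rat q"] demand_filtration_mono[of "real_of_rat q" s] q by auto
    have [measurable]: "total_demand P (real_of_rat q) \<in> borel_measurable ?F" "total_demand P s \<in> borel_measurable ?F"
      using q Suc.prems by (auto intro!: total_demand_adapted)
    show "{\<omega> \<in> space ?F. total_demand P (real_of_rat q) \<omega> < total_demand P s \<omega>} \<in> sets ?F"
      by measurable
  qed
  have "(\<Union>q\<in>?Q. ?D q) \<in> sets ?F"
    by (rule sets.countable_UN') (use D in auto)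
  also have "(\<Union>q\<in>?Q. ?D q) = {\<omega> \<in> space (pspace P). arr P (Suc n) \<omega> \<le> s}"
  proof (intro set_eqI iffI)
    fix \<omega> assume "\<omega> \<in> (\<Union>q\<in>?Q. ?D q)"
    then obtain q where q: "0 \<le> real_of_rat q" "real_of_rat q < s" and \<omega>: "\<omega> \<in> space (pspace P)"
      and n: "arr P n \<omega> \<le> real_of_rat q" "total_demand P (real_of_rat q) \<omega> < total_demand P s \<omega>" by auto
    have "arr P (Suc n) \<omega> \<le> s"
    proof (rule ccontr)
      assume "\<not> arr P (Suc n) \<omega> \<le> s"
      then have "total_demand P (real_of_rat q) \<omega> = total_demand P s \<omega>"
        using total_demand_at[OF \<omega>, of n] n q by simp
      then show False using n by simp
    qed
    then show "\<omega> \<in> {\<omega> \<in> space (pspace P). arr P (Suc n) \<omega> \<le> s}" using \<omega> by simp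
  next
    fix \<omega> assume "\<omega> \<in> {\<omega> \<in> space (pspace P). arr P (Suc n) \<omega> \<le> s}"
    then have \<omega>: "\<omega> \<in> space (pspace P)" and s: "arr P (Suc n) \<omega> \<le> s" by auto
    obtain q where q: "arr P n \<omega> < real_of_rat q" "real_of_rat q < arr P (Suc n) \<omega>"
      using of_rat_dense[OF arr_mono[OF \<omega>, of n]] by blast
    have "total_demand P (real_of_rat q) \<omega> = (\<Sum>m=1..n. dem P m \<omega>)"
      using q by (intro total_demand_at[OF \<omega>]) auto
    also have "\<dots> < (\<Sum>m=1..Suc n. dem P m \<omega>)" by (rule partial_demand_strict[OF \<omega>]) simp
    also have "\<dots> \<le> total_demand P s \<omega>" by (rule arr_le_imp_total_demand[OF \<omega> s])
    finally have "total_demand P (real_of_rat q) \<omega> < total_demand P s \<omega>" .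
    moreover have "0 \<le> real_of_rat q" using q arr_nonneg[OF \<omega>, of n] by linarith
    ultimately show "\<omega> \<in> (\<Union>q\<in>?Q. ?D q)"
      using q s \<omega> arr_nonneg[OF \<omega>, of n] by (intro UN_I[of q]) auto
  qed
  finally show ?case .
qed

lemma arr_le_adapted:
  "0 \<le> s \<Longrightarrow> s \<le> t \<Longrightarrow> Measurable.pred (demand_filtration P t) (\<lambda>\<omega>. arr P n \<omega> \<le> s)"
  using arr_stopping[of s n] demand_filtration_mono[of s t] by (auto simp: pred_def)

lemma arr_min_adapted:
  assumes t: "0 \<le> t" shows "(\<lambda>\<omega>. min (arr P n \<omega>) t) \<in> borel_measurable (demand_filtration P t)"
  unfolding borel_measurable_iff_le
proof
  fix a
  consider "a < 0" | "0 \<le> a" "a < t" | "t \<le> a" by linarith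
  then show "{\<omega> \<in> space (demand_filtration P t). min (arr P n \<omega>) t \<le> a} \<in> sets (demand_filtration P t)"
  proof cases
    case 1
    have "a < min (arr P n \<omega>) t" if "\<omega> \<in> space (pspace P)" for \<omega>
      using arr_nonneg[OF that, of n] 1 t by simp
    then have "{\<omega> \<in> space (demand_filtration P t). min (arr P n \<omega>) t \<le> a} = {}" by fastforce
    then show ?thesis by (metis sets.empty_sets)
  next
    case 2
    then have "{\<omega> \<in> space (demand_filtration P t). min (arr P n \<omega>) t \<le> a} = {\<omega> \<in> space (demand_filtration P t). arr P n \<omega> \<le> a}"
      by auto
    then show ?thesis using arr_le_adapted[of a t n] 2 by (simp add: pred_def)
  next
    case 3
    then have "{\<omega> \<in> space (demand_filtration P t). min (arr P n \<omega>) t \<le> a} = space (demand_filtration P t)" by auto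
    then show ?thesis by (metis sets.top)
  qed
qed

text \<open>Total demand is nondecreasing and equals the partial sum from arrival \<open>n\<close>
  until the next one. So the partial sum is at most \<open>c\<close> iff the total demand is at most
  \<open>c\<close> at some time between arrival \<open>n\<close> and \<open>t\<close>.\<close>

lemma partial_demand_adapted:
  assumes t: "0 \<le> t"
  shows "(\<lambda>\<omega>. if arr P n \<omega> \<le> t then \<Sum>m=1..n. dem P m \<omega> else 0) \<in> borel_measurable (demand_filtration P t)"
  unfolding borel_measurable_iff_le
proof
  fix c
  let ?F = "demand_filtration P t"
  let ?S = "\<lambda>\<omega>. \<Sum>m=1..n. dem P m \<omega>"
  let ?Q = "{q::rat. 0 \<le> real_of_rat q \<and> real_of_rat q < t}"
  let ?D = "\<lambda>s. {\<omega> \<in> space ?F. arr P n \<omega> \<le> s} \<inter> {\<omega> \<in> space ?F. total_demand P s \<omega> \<le> c}"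
  have D: "?D s \<in> sets ?F" if "0 \<le> s" "s \<le> t" for s
  proof -
    have [measurable]: "total_demand P s \<in> borel_measurable ?F" using that by (rule total_demand_adapted)
    show ?thesis using arr_le_adapted[OF that, of n] total_demand_adapted[OF that]
      unfolding pred_def borel_measurable_iff_le by (intro sets.Int) blast+
  qed
  \<comment> \<open>The time \<open>t\<close> itself is added to the rational times because the
    arrival may occur exactly at \<open>t\<close>.\<close>
  have U: "(\<Union>q\<in>?Q. ?D (real_of_rat q)) \<union> ?D t \<in> sets ?F"
    using D t by (intro sets.Un sets.countable_UN') auto
  have eq: "(\<Union>q\<in>?Q. ?D (real_of_rat q)) \<union> ?D t = {\<omega> \<in> space ?F. arr P n \<omega> \<le> t \<and> ?S \<omega> \<le> c}"
  proof (intro set_eqI iffI)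
    fix \<omega> assume "\<omega> \<in> (\<Union>q\<in>?Q. ?D (real_of_rat q)) \<union> ?D t"
    then have "\<exists>s\<le>t. \<omega> \<in> ?D s"
    proof (elim UnE UN_E)
      fix q assume "q \<in> ?Q" "\<omega> \<in> ?D (real_of_rat q)"
      then show ?thesis by (intro exI[of _ "real_of_rat q"]) auto
    next
      assume "\<omega> \<in> ?D t"
      then show ?thesis by blast
    qed
    then obtain s where "\<omega> \<in> space (pspace P)" "s \<le> t" "arr P n \<omega> \<le> s" "total_demand P s \<omega> \<le> c"
      by auto
    then show "\<omega> \<in> {\<omega> \<in> space ?F. arr P n \<omega> \<le> t \<and> ?S \<omega> \<le> c}"
      using arr_le_imp_total_demand[of \<omega> n s] by auto
  next
    fix \<omega> assume "\<omega> \<in> {\<omega> \<in> space ?F. arr P n \<omega> \<le> t \<and> ?S \<omega> \<le> c}"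
    then have \<omega>: "\<omega> \<in> space (pspace P)" and a: "arr P n \<omega> \<le> t" "?S \<omega> \<le> c" by auto
    show "\<omega> \<in> (\<Union>q\<in>?Q. ?D (real_of_rat q)) \<union> ?D t"
    proof (cases "arr P n \<omega> = t")
      case True
      then have "total_demand P t \<omega> = ?S \<omega>" using arr_mono[OF \<omega>, of n] by (intro total_demand_at[OF \<omega>]) auto
      then show ?thesis using \<omega> a by auto
    next
      case False
      then have "arr P n \<omega> < min t (arr P (Suc n) \<omega>)" using a arr_mono[OF \<omega>, of n] by simp
      then obtain q where q: "arr P n \<omega> < real_of_rat q" "real_of_rat q < min t (arr P (Suc n) \<omega>)"
        using of_rat_dense by blast
      then have "total_demand P (real_of_rat q) \<omega> = ?S \<omega>" by (intro total_demand_at[OF \<omega>]) auto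
      moreover have "0 \<le> real_of_rat q" using q arr_nonneg[OF \<omega>, of n] by linarith
      ultimately have "\<omega> \<in> ?D (real_of_rat q)" "q \<in> ?Q" using \<omega> a q arr_nonneg[OF \<omega>, of n] by auto
      then show ?thesis by blast
    qed
  qed
  have N: "{\<omega> \<in> space ?F. \<not> arr P n \<omega> \<le> t} \<in> sets ?F"
    using arr_le_adapted[OF t order_refl, of n] by measurable
  have "{\<omega> \<in> space ?F. (if arr P n \<omega> \<le> t then ?S \<omega> else 0) \<le> c} =
    {\<omega> \<in> space ?F. arr P n \<omega> \<le> t \<and> ?S \<omega> \<le> c} \<union> (if 0 \<le> c then {\<omega> \<in> space ?F. \<not> arr P n \<omega> \<le> t} else {})"
    by auto
  then show "{\<omega> \<in> space ?F. (if arr P n \<omega> \<le> t then ?S \<omega> else 0) \<le> c} \<in> sets ?F"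
    using U[unfolded eq] N by simp
qed

lemma dem_adapted:
  assumes t: "0 \<le> t"
  shows "(\<lambda>\<omega>. if arr P (Suc n) \<omega> \<le> t then dem P (Suc n) \<omega> else 0) \<in> borel_measurable (demand_filtration P t)"
proof -
  have [measurable]: "Measurable.pred (demand_filtration P t) (\<lambda>\<omega>. arr P (Suc n) \<omega> \<le> t)"
    using t by (intro arr_le_adapted) auto
  have [measurable]: "(\<lambda>\<omega>. if arr P n \<omega> \<le> t then \<Sum>m=1..n. dem P m \<omega> else 0) \<in> borel_measurable (demand_filtration P t)"
    "(\<lambda>\<omega>. if arr P (Suc n) \<omega> \<le> t then \<Sum>m=1..Suc n. dem P m \<omega> else 0) \<in> borel_measurable (demand_filtration P t)"
    by (rule partial_demand_adapted[OF t])+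
  have "(\<lambda>\<omega>. if arr P (Suc n) \<omega> \<le> t then
      (if arr P (Suc n) \<omega> \<le> t then \<Sum>m=1..Suc n. dem P m \<omega> else 0) -
      (if arr P n \<omega> \<le> t then \<Sum>m=1..n. dem P m \<omega> else 0) else 0) \<in> borel_measurable (demand_filtration P t)"
    by measurable
  then show ?thesis
  proof (rule measurable_cong[THEN iffD1, rotated])
    fix \<omega> assume "\<omega> \<in> space (demand_filtration P t)"
    then have "arr P n \<omega> < arr P (Suc n) \<omega>" by (simp add: arr_mono)
    then show "(if arr P (Suc n) \<omega> \<le> t then
      (if arr P (Suc n) \<omega> \<le> t then \<Sum>m=1..Suc n. dem P m \<omega> else 0) -
      (if arr P n \<omega> \<le> t then \<Sum>m=1..n. dem P m \<omega> else 0) else 0) =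
      (if arr P (Suc n) \<omega> \<le> t then dem P (Suc n) \<omega> else 0)" by auto
  qed
qed

end

section \<open>Imitation of a strategy from full storage\<close>

context production_inventory
begin

text \<open>A default strategy started at full storage: idle when full, and otherwise swap phases 1 and 2
  at every arrival, so that every arrival is a switching time. \<open>dflt n\<close> is the phase and the level
  just after the \<open>n\<close>-th arrival; the phase in \<open>dflt 0\<close> is a dummy, since the storage is full at 0.\<close>

primrec dflt :: "nat \<Rightarrow> 'w \<Rightarrow> nat \<times> real" where
  "dflt 0 \<omega> = (1, cap P)"
| "dflt (Suc n) \<omega> =
     (if cap P < snd (dflt n \<omega>) + rate P (fst (dflt n \<omega>)) * (arr P (Suc n) \<omega> - arr P n \<omega>) then 1 else 3 - fst (dflt n \<omega>),
      served P (min (cap P) (snd (dflt n \<omega>) + rate P (fst (dflt n \<omega>)) * (arr P (Suc n) \<omega> - arr P n \<omega>))) (dem P (Suc n) \<omega>))"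

text \<open>The hypothetical filling time after arrival \<open>n\<close>; it counts only if it
  precedes the next arrival.\<close>

definition fill :: "nat \<Rightarrow> 'w \<Rightarrow> real" where
  "fill n \<omega> = arr P n \<omega> + (cap P - snd (dflt n \<omega>)) / rate P (fst (dflt n \<omega>))"

text \<open>Enumerates the switches: \<open>(n, False)\<close> is the switch at arrival
  \<open>n\<close>, \<open>(n, True)\<close> the switch to idling between arrivals \<open>n\<close>
  and \<open>Suc n\<close>. The storage is full at time 0, hence the initial \<open>True\<close>.
  Filling up exactly at an arrival is no switch to idling, since the demand is served at that
  instant; hence the strict inequality, as in \<open>dflt\<close>.\<close>

primrec dstate :: "nat \<Rightarrow> 'w \<Rightarrow> nat \<times> bool" where
  "dstate 0 \<omega> = (0, True)"
| "dstate (Suc k) \<omega> = (if \<not> snd (dstate k \<omega>) \<and> fill (fst (dstate k \<omega>)) \<omega> < arr P (Suc (fst (dstate k \<omega>))) \<omega>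
     then (fst (dstate k \<omega>), True) else (Suc (fst (dstate k \<omega>)), False))"

definition dtime :: "nat \<Rightarrow> 'w \<Rightarrow> real" where
  "dtime k \<omega> = (if snd (dstate k \<omega>) then fill (fst (dstate k \<omega>)) \<omega> else arr P (fst (dstate k \<omega>)) \<omega>)"

definition dphase :: "nat \<Rightarrow> 'w \<Rightarrow> nat" where
  "dphase k \<omega> = (if snd (dstate k \<omega>) then 0 else fst (dflt (fst (dstate k \<omega>)) \<omega>))"

definition default_strategy :: "'w strategy" where
  "default_strategy = \<lparr>swtime = (\<lambda>k \<omega>. ereal (dtime k \<omega>)), swphase = dphase\<rparr>"

lemma dflt_phase: "fst (dflt n \<omega>) \<in> {1, 2}"
  by (induction n) auto

lemma dflt_rate_pos: "0 < rate P (fst (dflt n \<omega>))"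
  using rate_pos[OF dflt_phase] .

context
  fixes \<omega> assumes \<omega>: "\<omega> \<in> space (pspace P)"
begin

lemma dflt_level: "lmin P \<le> snd (dflt n \<omega>)" "snd (dflt n \<omega>) \<le> cap P"
proof -
  have "lmin P \<le> snd (dflt n \<omega>) \<and> snd (dflt n \<omega>) \<le> cap P"
  proof (induction n)
    case 0
    show ?case using lmin_less_cap by simp
  next
    case (Suc n)
    let ?u = "snd (dflt n \<omega>) + rate P (fst (dflt n \<omega>)) * (arr P (Suc n) \<omega> - arr P n \<omega>)"
    have "0 \<le> rate P (fst (dflt n \<omega>)) * (arr P (Suc n) \<omega> - arr P n \<omega>)"
      using dflt_rate_pos[of n \<omega>] arr_mono[OF \<omega>, of n] by simp
    then have "lmin P \<le> min (cap P) ?u" using Suc lmin_less_cap by simp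
    then show ?case
      using served_bounds(1)[of "min (cap P) ?u" "dem P (Suc n) \<omega>"]
        served_bounds(2)[of "dem P (Suc n) \<omega>" "min (cap P) ?u"] dem_pos[OF \<omega>, of "Suc n"] by auto
  qed
  then show "lmin P \<le> snd (dflt n \<omega>)" "snd (dflt n \<omega>) \<le> cap P" by auto
qed

lemma dflt_level_less: "1 \<le> n \<Longrightarrow> snd (dflt n \<omega>) < cap P"
proof (cases n)
  case (Suc m)
  let ?u = "snd (dflt m \<omega>) + rate P (fst (dflt m \<omega>)) * (arr P (Suc m) \<omega> - arr P m \<omega>)"
  have "0 < dem P (Suc m) \<omega>" using dem_pos[OF \<omega>] by simp
  then show ?thesis using lmin_less_cap unfolding Suc by (auto simp: served_def min_def)
qed auto

lemma fill_0: "fill 0 \<omega> = 0"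
  by (simp add: fill_def arr_0[OF \<omega>])

lemma fill_ge: "arr P n \<omega> \<le> fill n \<omega>"
  using dflt_level(2)[of n] dflt_rate_pos[of n \<omega>] by (simp add: fill_def)

lemma fill_greater: "1 \<le> n \<Longrightarrow> arr P n \<omega> < fill n \<omega>"
  using dflt_level_less[of n] dflt_rate_pos[of n \<omega>] by (simp add: fill_def)

lemma fill_less_iff: "fill n \<omega> < t \<longleftrightarrow> cap P < snd (dflt n \<omega>) + rate P (fst (dflt n \<omega>)) * (t - arr P n \<omega>)"
  and fill_le_iff: "fill n \<omega> \<le> t \<longleftrightarrow> cap P \<le> snd (dflt n \<omega>) + rate P (fst (dflt n \<omega>)) * (t - arr P n \<omega>)"
  using dflt_rate_pos[of n \<omega>] by (auto simp: fill_def field_simps)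

lemma dstate_True: "dstate k \<omega> = (n, True) \<Longrightarrow> fill n \<omega> < arr P (Suc n) \<omega>"
  by (cases k) (use fill_0 arr_mono[OF \<omega>, of 0] arr_0[OF \<omega>] in \<open>auto split: if_splits\<close>)

lemma dstate_False: "dstate k \<omega> = (n, False) \<Longrightarrow> 1 \<le> n"
  by (cases k) (auto split: if_splits)

lemma dtime_ge: "arr P (fst (dstate k \<omega>)) \<omega> \<le> dtime k \<omega>"
  by (simp add: dtime_def fill_ge)

lemma dtime_less: "dtime k \<omega> < dtime (Suc k) \<omega>"
proof (cases "dstate k \<omega>")
  case (Pair n b)
  then show ?thesis
    using dstate_True[of k n] dstate_False[of k n] fill_greater[of n] arr_mono[OF \<omega>, of n]
    by (cases b) (auto simp: dtime_def)
qed

text \<open>A switch to idling is followed by the switch at the next arrival, so any two consecutive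
  switches pass an arrival. Hence the switching times are unbounded and their discounted costs
  summable.\<close>

lemma dstate_index: "Suc k div 2 \<le> fst (dstate k \<omega>)"
proof (induction k rule: less_induct)
  case (less k)
  consider "k = 0" | "k = 1" | j where "k = Suc (Suc j)" by (metis One_nat_def not0_implies_Suc)
  then show ?case
  proof cases
    case 3
    have "Suc (fst (dstate j \<omega>)) \<le> fst (dstate (Suc (Suc j)) \<omega>)" by (auto split: if_splits)
    moreover have "Suc j div 2 \<le> fst (dstate j \<omega>)" using less[of j] 3 by simp
    ultimately have "Suc (Suc j div 2) \<le> fst (dstate (Suc (Suc j)) \<omega>)" by linarith
    then show ?thesis unfolding 3 by simp
  qed auto
qed

lemma dtime_unbounded: "\<exists>k. t < dtime k \<omega>"
proof -
  obtain n where n: "t < arr P n \<omega>"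
    using arr_unbounded[OF \<omega>] unfolding filterlim_at_top_dense eventually_sequentially by blast
  have "n \<le> fst (dstate (2 * n) \<omega>)" using dstate_index[of "2 * n"] by simp
  then have "arr P n \<omega> \<le> arr P (fst (dstate (2 * n) \<omega>)) \<omega>" by (simp add: arr_le_iff[OF \<omega>])
  then show ?thesis using n dtime_ge[of "2 * n"] by (intro exI[of _ "2 * n"]) linarith
qed

lemma dstate_visits: "1 \<le> n \<Longrightarrow> \<exists>k. dstate k \<omega> = (n, False)"
proof (induction n rule: nat_induct_at_least)
  case base
  have "dstate (Suc 0) \<omega> = (1, False)" by simp
  then show ?case by blast
next
  case (Suc n)
  then obtain k where k: "dstate k \<omega> = (n, False)" by blast
  show ?case
  proof (cases "fill n \<omega> < arr P (Suc n) \<omega>")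
    case True
    then have "dstate (Suc (Suc k)) \<omega> = (Suc n, False)" using k by simp
    then show ?thesis by blast
  next
    case False
    then have "dstate (Suc k) \<omega> = (Suc n, False)" using k by simp
    then show ?thesis by blast
  qed
qed

lemma default_phase_eqI:
  assumes "dtime k \<omega> \<le> t" "t < dtime (Suc k) \<omega>"
  shows "phase default_strategy t \<omega> = dphase k \<omega>"
proof -
  have mono: "dtime j \<omega> \<le> dtime l \<omega>" if "j \<le> l" for j l
    using that by (rule lift_Suc_mono_le[of "\<lambda>k. dtime k \<omega>", OF less_imp_le[OF dtime_less]])
  have "(LEAST k. ereal t < swtime default_strategy (Suc k) \<omega>) = k"
  proof (rule Least_equality)
    fix j assume "ereal t < swtime default_strategy (Suc j) \<omega>"
    then have "t < dtime (Suc j) \<omega>" by (simp add: default_strategy_def)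
    then have "\<not> Suc j \<le> k" using mono[of "Suc j" k] assms by auto
    then show "k \<le> j" by simp
  qed (use assms in \<open>simp add: default_strategy_def\<close>)
  then show ?thesis by (simp add: phase_def default_strategy_def)
qed

lemma default_phase:
  assumes t: "arr P n \<omega> \<le> t" "t < arr P (Suc n) \<omega>"
  shows "phase default_strategy t \<omega> = (if fill n \<omega> \<le> t then 0 else fst (dflt n \<omega>))"
proof (cases "n = 0")
  case True
  have "phase default_strategy t \<omega> = dphase 0 \<omega>"
    using t arr_0[OF \<omega>] fill_0 by (intro default_phase_eqI) (auto simp: True dtime_def)
  then show ?thesis using t arr_0[OF \<omega>] fill_0 by (simp add: True dphase_def)
next
  case False
  then obtain k where k: "dstate k \<omega> = (n, False)" using dstate_visits[of n] by auto
  show ?thesis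
  proof (cases "fill n \<omega> \<le> t")
    case True
    then have "dstate (Suc k) \<omega> = (n, True)" using t k by simp
    moreover from this have "dstate (Suc (Suc k)) \<omega> = (Suc n, False)" by simp
    ultimately have "phase default_strategy t \<omega> = dphase (Suc k) \<omega>"
      using t True by (intro default_phase_eqI) (auto simp: dtime_def simp del: dstate.simps)
    then show ?thesis using \<open>dstate (Suc k) \<omega> = (n, True)\<close> True by (simp add: dphase_def del: dstate.simps)
  next
    case False
    then have "phase default_strategy t \<omega> = dphase k \<omega>"
      using t k by (intro default_phase_eqI) (auto simp: dtime_def)
    then show ?thesis using False k by (simp add: dphase_def)
  qed
qed

lemma default_produced:
  assumes t: "arr P n \<omega> \<le> t" "t \<le> arr P (Suc n) \<omega>"
  shows "snd (dflt n \<omega>) + produced P default_strategy (arr P n \<omega>) t \<omega> =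
    min (cap P) (snd (dflt n \<omega>) + rate P (fst (dflt n \<omega>)) * (t - arr P n \<omega>))"
proof -
  let ?r = "rate P (fst (dflt n \<omega>))"
  have r: "0 < ?r" by (rule dflt_rate_pos)
  have [measurable]: "(\<lambda>t. phase default_strategy t \<omega>) \<in> measurable borel (count_space UNIV)"
    unfolding phase_def by measurable
  have "AE u in lborel. u \<noteq> t \<and> u \<noteq> fill n \<omega>"
    using AE_lborel_singleton[of t] AE_lborel_singleton[of "fill n \<omega>"] by eventually_elim auto
  then have "AE u in lborel. indicator {arr P n \<omega>..t} u *\<^sub>R rate P (phase default_strategy u \<omega>)
     = indicator {arr P n \<omega>..min t (fill n \<omega>)} u *\<^sub>R ?r"
  proof eventually_elim
    case (elim u)
    show ?case
    proof (cases "u \<in> {arr P n \<omega>..t}")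
      case True
      then show ?thesis using elim t rates default_phase[of n u] by auto
    qed auto
  qed
  then have "produced P default_strategy (arr P n \<omega>) t \<omega> = (\<integral>u. indicator {arr P n \<omega>..min t (fill n \<omega>)} u *\<^sub>R ?r \<partial>lborel)"
    unfolding produced_def set_lebesgue_integral_def by (intro integral_cong_AE) measurable
  also have "\<dots> = (min t (fill n \<omega>) - arr P n \<omega>) * ?r"
    using t fill_ge[of n] by simp
  finally have p: "produced P default_strategy (arr P n \<omega>) t \<omega> = (min t (fill n \<omega>) - arr P n \<omega>) * ?r" .
  show ?thesis
  proof (cases "fill n \<omega> \<le> t")
    case True
    then have "produced P default_strategy (arr P n \<omega>) t \<omega> = cap P - snd (dflt n \<omega>)"
      using r unfolding p by (simp add: fill_def)
    then show ?thesis using True by (simp add: fill_le_iff)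
  next
    case False
    then have m: "min t (fill n \<omega>) = t" by simp
    show ?thesis using False unfolding p m by (simp add: fill_le_iff mult.commute)
  qed
qed

lemma default_level_after: "level_after P default_strategy (cap P) \<omega> n = snd (dflt n \<omega>)"
proof (induction n)
  case (Suc n)
  have "level_before P default_strategy (cap P) \<omega> (Suc n) =
     snd (dflt n \<omega>) + produced P default_strategy (arr P n \<omega>) (arr P (Suc n) \<omega>) \<omega>"
    by (simp add: level_before_def Suc)
  then show ?case
    using default_produced[of n "arr P (Suc n) \<omega>"] arr_mono[OF \<omega>, of n]
    unfolding level_after_Suc by simp
qed simp

lemma default_inventory:
  assumes t: "arr P n \<omega> \<le> t" "t < arr P (Suc n) \<omega>"
  shows "inventory P default_strategy (cap P) t \<omega> =
    min (cap P) (snd (dflt n \<omega>) + rate P (fst (dflt n \<omega>)) * (t - arr P n \<omega>))"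
  using default_produced[of n t] t
  unfolding inventory_def num_arrivals_eqI[OF \<omega> t] Let_def default_level_after by simp

lemma default_paths:
  "swtime default_strategy 0 \<omega> = 0" "swphase default_strategy 0 \<omega> = 0"
  "swtime default_strategy k \<omega> < swtime default_strategy (Suc k) \<omega>"
  "\<exists>k. ereal t < swtime default_strategy k \<omega>"
  "swphase default_strategy k \<omega> \<in> {0, 1, 2}"
  "swphase default_strategy (Suc k) \<omega> \<noteq> swphase default_strategy k \<omega>"
  "0 \<le> t \<Longrightarrow> inventory P default_strategy (cap P) t \<omega> \<le> cap P"
  "0 \<le> t \<Longrightarrow> inventory P default_strategy (cap P) t \<omega> < cap P \<Longrightarrow> phase default_strategy t \<omega> \<in> {1, 2}"
  "0 \<le> t \<Longrightarrow> inventory P default_strategy (cap P) t \<omega> = cap P \<Longrightarrow> phase default_strategy t \<omega> = 0"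
  "swtime default_strategy k \<omega> = ereal t \<Longrightarrow> swphase default_strategy k \<omega> = 0 \<Longrightarrow>
     swtime default_strategy (Suc k) \<omega> = ereal (arr P (Suc (num_arrivals P t \<omega>)) \<omega>)"
proof -
  show "swtime default_strategy 0 \<omega> = 0" "swphase default_strategy 0 \<omega> = 0"
    using fill_0 by (auto simp: default_strategy_def dtime_def dphase_def zero_ereal_def)
  show "swtime default_strategy k \<omega> < swtime default_strategy (Suc k) \<omega>"
    using dtime_less[of k] by (simp add: default_strategy_def)
  show "\<exists>k. ereal t < swtime default_strategy k \<omega>"
    using dtime_unbounded[of t] by (simp add: default_strategy_def)
  show "swphase default_strategy k \<omega> \<in> {0, 1, 2}"
    using dflt_phase by (auto simp: default_strategy_def dphase_def)
  show "swphase default_strategy (Suc k) \<omega> \<noteq> swphase default_strategy k \<omega>"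
  proof (cases "dstate k \<omega>")
    case (Pair n b)
    have "fst (dflt n \<omega>) = 1 \<or> fst (dflt n \<omega>) = 2" using dflt_phase[of n \<omega>] by auto
    then show ?thesis
      using Pair dstate_True[of k n] dflt_phase[of "Suc n" \<omega>] fill_less_iff[of n "arr P (Suc n) \<omega>"]
      by (cases b) (auto simp: default_strategy_def dphase_def)
  qed
  show "inventory P default_strategy (cap P) t \<omega> \<le> cap P" if t0: "0 \<le> t"
  proof -
    obtain n where n: "arr P n \<omega> \<le> t" "t < arr P (Suc n) \<omega>" by (rule arrival_interval[OF \<omega> t0])
    then show ?thesis by (simp add: default_inventory)
  qed
  show "phase default_strategy t \<omega> \<in> {1, 2}" if t0: "0 \<le> t" and lt: "inventory P default_strategy (cap P) t \<omega> < cap P"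
  proof -
    obtain n where n: "arr P n \<omega> \<le> t" "t < arr P (Suc n) \<omega>" by (rule arrival_interval[OF \<omega> t0])
    then have "\<not> fill n \<omega> \<le> t" using lt by (auto simp: default_inventory fill_le_iff)
    then show ?thesis using default_phase[OF n] dflt_phase[of n \<omega>] by simp
  qed
  show "phase default_strategy t \<omega> = 0" if t0: "0 \<le> t" and lt: "inventory P default_strategy (cap P) t \<omega> = cap P"
  proof -
    obtain n where n: "arr P n \<omega> \<le> t" "t < arr P (Suc n) \<omega>" by (rule arrival_interval[OF \<omega> t0])
    then have "fill n \<omega> \<le> t" using lt by (auto simp: default_inventory fill_le_iff)
    then show ?thesis using default_phase[OF n] by simp
  qed
  show "swtime default_strategy (Suc k) \<omega> = ereal (arr P (Suc (num_arrivals P t \<omega>)) \<omega>)"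
    if "swtime default_strategy k \<omega> = ereal t" "swphase default_strategy k \<omega> = 0"
  proof -
    obtain n b where k: "dstate k \<omega> = (n, b)" by (cases "dstate k \<omega>")
    have b: "b" using that(2) k dflt_phase[of n \<omega>] by (auto simp: default_strategy_def dphase_def split: if_splits)
    then have t: "t = fill n \<omega>" using that(1) k by (simp add: default_strategy_def dtime_def)
    have "num_arrivals P t \<omega> = n"
      using fill_ge[of n] dstate_True[of k n] k b t by (intro num_arrivals_eqI[OF \<omega>]) auto
    then show ?thesis using k b by (simp add: default_strategy_def dtime_def)
  qed
qed

text \<open>The switch \<open>Suc k\<close> does not precede arrival \<open>Suc (k div 2)\<close>,
  so each arrival is charged with at most two switches; this is the factor 2.\<close>

lemma default_switch_sum:
  assumes K: "\<And>i j. i \<in> {0, 1, 2} \<Longrightarrow> j \<in> {0, 1, 2} \<Longrightarrow> swc P i j \<le> K" "0 \<le> K"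
  shows "(\<Sum>k. ennreal (disc_at P (swtime default_strategy (Suc k) \<omega>) *
          swc P (swphase default_strategy k \<omega>) (swphase default_strategy (Suc k) \<omega>)))
    \<le> (\<Sum>n. ennreal (exp (- disc P * arr P (Suc n) \<omega>)) * ennreal (2 * K))"
proof -
  let ?e = "\<lambda>n. ennreal (exp (- disc P * arr P (Suc n) \<omega>)) * ennreal K"
  have step: "ennreal (disc_at P (swtime default_strategy (Suc k) \<omega>) *
          swc P (swphase default_strategy k \<omega>) (swphase default_strategy (Suc k) \<omega>)) \<le> ?e (k div 2)" for k
  proof -
    have "Suc (k div 2) \<le> fst (dstate (Suc k) \<omega>)" using dstate_index[of "Suc k"] by simp
    then have "arr P (Suc (k div 2)) \<omega> \<le> arr P (fst (dstate (Suc k) \<omega>)) \<omega>" by (simp add: arr_le_iff[OF \<omega>] del: dstate.simps)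
    also have "\<dots> \<le> dtime (Suc k) \<omega>" by (rule dtime_ge)
    finally have "exp (- disc P * dtime (Suc k) \<omega>) \<le> exp (- disc P * arr P (Suc (k div 2)) \<omega>)"
      using disc_pos by simp
    then have "disc_at P (swtime default_strategy (Suc k) \<omega>) *
          swc P (swphase default_strategy k \<omega>) (swphase default_strategy (Suc k) \<omega>)
       \<le> exp (- disc P * arr P (Suc (k div 2)) \<omega>) * K"
      using K default_paths(5)[of k] default_paths(5)[of "Suc k"]
        swc_nonneg[OF default_paths(5)[of k] default_paths(5)[of "Suc k"]] default_paths(6)[of k]
      by (intro mult_mono) (auto simp: disc_at_def default_strategy_def)
    then have "ennreal (disc_at P (swtime default_strategy (Suc k) \<omega>) *
          swc P (swphase default_strategy k \<omega>) (swphase default_strategy (Suc k) \<omega>))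
       \<le> ennreal (exp (- disc P * arr P (Suc (k div 2)) \<omega>) * K)" by (rule ennreal_leI)
    then show ?thesis using K by (simp add: ennreal_mult)
  qed
  have double: "(\<Sum>k<2 * N. ?e (k div 2)) = (\<Sum>n<N. ?e n * 2)" for N
    by (induction N) (simp_all add: mult_2_right add.assoc)
  have "(\<Sum>k<N. ennreal (disc_at P (swtime default_strategy (Suc k) \<omega>) *
          swc P (swphase default_strategy k \<omega>) (swphase default_strategy (Suc k) \<omega>))) \<le> (\<Sum>n. ?e n * 2)" for N
  proof -
    have "(\<Sum>k<N. ennreal (disc_at P (swtime default_strategy (Suc k) \<omega>) *
          swc P (swphase default_strategy k \<omega>) (swphase default_strategy (Suc k) \<omega>))) \<le> (\<Sum>k<N. ?e (k div 2))"
      by (intro sum_mono step)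
    also have "\<dots> \<le> (\<Sum>k<2 * N. ?e (k div 2))" by (intro sum_mono2) auto
    also have "\<dots> = (\<Sum>n<N. ?e n * 2)" by (rule double)
    also have "\<dots> \<le> (\<Sum>n. ?e n * 2)" by (intro sum_le_suminf summableI) auto
    finally show ?thesis .
  qed
  then have "(\<Sum>k. ennreal (disc_at P (swtime default_strategy (Suc k) \<omega>) *
          swc P (swphase default_strategy k \<omega>) (swphase default_strategy (Suc k) \<omega>))) \<le> (\<Sum>n. ?e n * 2)"
    by (intro suminf_le_const summableI)
  also have "(\<Sum>n. ?e n * 2) = (\<Sum>n. ennreal (exp (- disc P * arr P (Suc n) \<omega>)) * ennreal (2 * K))"
    using K by (intro suminf_cong) (simp add: ennreal_mult mult_ac)
  finally show ?thesis .
qed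

end

text \<open>The recursion only reads arrival times and demands. Stopped or masked at time
  \<open>t\<close> these are adapted, and once arrival \<open>n\<close> has occurred the masking no
  longer alters anything the recursion has read.\<close>

lemma dflt_adapted:
  assumes t: "0 \<le> t"
  shows "(\<lambda>\<omega>. if arr P n \<omega> \<le> t then fst (dflt n \<omega>) else 0) \<in> measurable (demand_filtration P t) (count_space UNIV)"
    and "(\<lambda>\<omega>. if arr P n \<omega> \<le> t then snd (dflt n \<omega>) else 0) \<in> borel_measurable (demand_filtration P t)"
proof (induction n)
  case 0
  have eq: "arr P 0 \<omega> \<le> t" if "\<omega> \<in> space (demand_filtration P t)" for \<omega>
    using that t by (simp add: arr_0)
  {
    case 1
    show ?case by (rule measurable_cong[THEN iffD2, of _ _ "\<lambda>_. 1"]) (auto simp: eq)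
  next
    case 2
    show ?case by (rule measurable_cong[THEN iffD2, of _ _ "\<lambda>_. cap P"]) (auto simp: eq)
  }
next
  case (Suc n)
  let ?F = "demand_filtration P t"
  define p where "p \<omega> \<longleftrightarrow> arr P (Suc n) \<omega> \<le> t" for \<omega>
  define J where "J \<omega> = (if arr P n \<omega> \<le> t then fst (dflt n \<omega>) else 0)" for \<omega>
  define z where "z \<omega> = (if arr P n \<omega> \<le> t then snd (dflt n \<omega>) else 0)" for \<omega>
  define Y where "Y \<omega> = (if arr P (Suc n) \<omega> \<le> t then dem P (Suc n) \<omega> else 0)" for \<omega>
  define a where "a \<omega> = min (arr P n \<omega>) t" for \<omega>
  define b where "b \<omega> = min (arr P (Suc n) \<omega>) t" for \<omega>
  have [measurable]: "Measurable.pred ?F p" "J \<in> measurable ?F (count_space UNIV)" "z \<in> borel_measurable ?F"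
     "Y \<in> borel_measurable ?F" "a \<in> borel_measurable ?F" "b \<in> borel_measurable ?F"
    using Suc arr_le_adapted[OF t order_refl, of "Suc n"] dem_adapted[OF t, of n] arr_min_adapted[OF t]
    unfolding p_def[abs_def] J_def[abs_def] z_def[abs_def] Y_def[abs_def] a_def[abs_def] b_def[abs_def] by auto
  have eq: "arr P n \<omega> \<le> t \<and> J \<omega> = fst (dflt n \<omega>) \<and> z \<omega> = snd (dflt n \<omega>) \<and> Y \<omega> = dem P (Suc n) \<omega> \<and>
      a \<omega> = arr P n \<omega> \<and> b \<omega> = arr P (Suc n) \<omega>" if "\<omega> \<in> space ?F" "p \<omega>" for \<omega>
    using that arr_mono[of \<omega> n] by (auto simp: p_def J_def z_def Y_def a_def b_def)
  {
    case 1
    have "(\<lambda>\<omega>. if p \<omega> then (if cap P < z \<omega> + rate P (J \<omega>) * (b \<omega> - a \<omega>) then 1 else 3 - J \<omega>) else 0)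
       \<in> measurable ?F (count_space UNIV)" by measurable
    then show ?case
      by (rule measurable_cong[THEN iffD1, rotated]) (use eq in \<open>auto simp: p_def\<close>)
  next
    case 2
    have "(\<lambda>\<omega>. if p \<omega> then served P (min (cap P) (z \<omega> + rate P (J \<omega>) * (b \<omega> - a \<omega>))) (Y \<omega>) else 0)
       \<in> borel_measurable ?F" by measurable
    then show ?case
      by (rule measurable_cong[THEN iffD1, rotated]) (use eq in \<open>auto simp: p_def\<close>)
  }
qed

lemma default_phase_adapted:
  assumes t: "0 \<le> t"
  shows "phase default_strategy t \<in> measurable (demand_filtration P t) (count_space UNIV)"
proof -
  let ?F = "demand_filtration P t"
  have "{\<omega> \<in> space ?F. phase default_strategy t \<omega> = j} \<in> sets ?F" for j
  proof -
    define p where "p n \<omega> \<longleftrightarrow> arr P n \<omega> \<le> t" for n \<omega>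
    define J where "J n \<omega> = (if arr P n \<omega> \<le> t then fst (dflt n \<omega>) else 0)" for n \<omega>
    define z where "z n \<omega> = (if arr P n \<omega> \<le> t then snd (dflt n \<omega>) else 0)" for n \<omega>
    define a where "a n \<omega> = min (arr P n \<omega>) t" for n \<omega>
    have [measurable]: "Measurable.pred ?F (p n)" "J n \<in> measurable ?F (count_space UNIV)" "z n \<in> borel_measurable ?F"
       "a n \<in> borel_measurable ?F" for n
      using dflt_adapted[OF t, of n] arr_le_adapted[OF t order_refl, of n] arr_min_adapted[OF t, of n]
      unfolding p_def[abs_def] J_def[abs_def] z_def[abs_def] a_def[abs_def] by auto
    \<comment> \<open>Exactly one \<open>n\<close> satisfies \<open>p n\<close> and not
      \<open>p (Suc n)\<close>, namely the number of arrivals up to \<open>t\<close>; the phase is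
      then a countable case distinction.\<close>
    have "{\<omega> \<in> space ?F. \<exists>n. p n \<omega> \<and> \<not> p (Suc n) \<omega> \<and>
        (if cap P \<le> z n \<omega> + rate P (J n \<omega>) * (t - a n \<omega>) then 0 else J n \<omega>) = j} \<in> sets ?F"
      by measurable
    also have "{\<omega> \<in> space ?F. \<exists>n. p n \<omega> \<and> \<not> p (Suc n) \<omega> \<and>
        (if cap P \<le> z n \<omega> + rate P (J n \<omega>) * (t - a n \<omega>) then 0 else J n \<omega>) = j} = {\<omega> \<in> space ?F. phase default_strategy t \<omega> = j}"
    proof (intro Collect_cong conj_cong refl)
      fix \<omega> assume "\<omega> \<in> space ?F"
      then have \<omega>: "\<omega> \<in> space (pspace P)" by simp
      obtain n where n: "arr P n \<omega> \<le> t" "t < arr P (Suc n) \<omega>" by (rule arrival_interval[OF \<omega> t])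
      have uniq: "m = n" if "p m \<omega>" "\<not> p (Suc m) \<omega>" for m
        using num_arrivals_eqI[OF \<omega>, of m t] num_arrivals_eqI[OF \<omega> n] that by (simp add: p_def)
      have "p n \<omega>" "\<not> p (Suc n) \<omega>" using n by (auto simp: p_def)
      moreover have "phase default_strategy t \<omega> = (if cap P \<le> z n \<omega> + rate P (J n \<omega>) * (t - a n \<omega>) then 0 else J n \<omega>)"
        unfolding default_phase[OF \<omega> n] using n by (simp add: fill_le_iff[OF \<omega>] z_def J_def a_def)
      ultimately show "(\<exists>n. p n \<omega> \<and> \<not> p (Suc n) \<omega> \<and>
        (if cap P \<le> z n \<omega> + rate P (J n \<omega>) * (t - a n \<omega>) then 0 else J n \<omega>) = j) \<longleftrightarrow> phase default_strategy t \<omega> = j"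
        using uniq by metis
    qed
    finally show ?thesis .
  qed
  then have "phase default_strategy t -` {j} \<inter> space ?F \<in> sets ?F" for j
    by (simp add: vimage_def Int_def conj_commute)
  then show ?thesis by (subst measurable_count_space_eq2_countable) auto
qed

lemma default_admissible: "default_strategy \<in> admissible P (cap P) 0"
  unfolding admissible_def using default_paths default_phase_adapted
  by (auto intro: less_imp_le)

end

section \<open>An integrable bound for early first demands\<close>

context production_inventory
begin

definition swc_sum :: real where
  "swc_sum = (\<Sum>i\<in>{0, 1, 2}. \<Sum>j\<in>{0, 1, 2}. \<bar>swc P i j\<bar>)"

lemma swc_sum_nonneg: "0 \<le> swc_sum"
  unfolding swc_sum_def by (intro sum_nonneg) auto

lemma swc_le_sum:
  assumes "i \<in> {0, 1, 2}" "j \<in> {0, 1, 2}" shows "swc P i j \<le> swc_sum"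
proof -
  have "swc P i j \<le> \<bar>swc P i j\<bar>" by simp
  also have "\<dots> \<le> (\<Sum>j\<in>{0, 1, 2}. \<bar>swc P i j\<bar>)" using assms(2) by (rule member_le_sum) auto
  also have "\<dots> \<le> swc_sum" unfolding swc_sum_def
    by (rule member_le_sum[OF assms(1), of "\<lambda>i. \<Sum>j\<in>{0, 1, 2}. \<bar>swc P i j\<bar>"]) (auto intro: sum_nonneg)
  finally show ?thesis .
qed

text \<open>All that can be lost on a path where the imitation fails: holding at the maximal rate,
  two switches per arrival, the penalty for each demand in full, and a final \<open>swc_sum\<close>
  for the entry cost. It does not depend on the initial level and can serve as a dominating
  function.\<close>

definition worst_cost :: "real \<Rightarrow> 'w \<Rightarrow> ennreal" where
  "worst_cost H \<omega> = ennreal (H / disc P)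
     + (\<Sum>n. ennreal (exp (- disc P * arr P (Suc n) \<omega>)) * ennreal (2 * swc_sum))
     + (\<Sum>n. ennreal (exp (- disc P * arr P (Suc n) \<omega>)) * ennreal (pen_pos (dem P (Suc n) \<omega>)))
     + ennreal swc_sum"

lemma worst_cost_measurable [measurable]: "worst_cost H \<in> borel_measurable (pspace P)"
  unfolding worst_cost_def by measurable

lemma worst_cost_finite: "(\<integral>\<^sup>+\<omega>. worst_cost H \<omega> \<partial>pspace P) < \<infinity>"
proof -
  have 1: "(\<integral>\<^sup>+\<omega>. (\<Sum>n. ennreal (exp (- disc P * arr P (Suc n) \<omega>)) * ennreal (2 * swc_sum)) \<partial>pspace P) < \<infinity>"
    by (rule discounted_sum_finite) (auto simp: demand.emeasure_space_1[simplified])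
  have "(\<integral>\<^sup>+y. ennreal (pen_pos y) \<partial>dlaw P) < \<infinity>"
    using pen_pos_integrable pen_pos_nonneg by (simp add: nn_integral_eq_integral)
  then have 2: "(\<integral>\<^sup>+\<omega>. (\<Sum>n. ennreal (exp (- disc P * arr P (Suc n) \<omega>)) * ennreal (pen_pos (dem P (Suc n) \<omega>))) \<partial>pspace P) < \<infinity>"
    by (intro discounted_sum_finite) auto
  have "(\<integral>\<^sup>+\<omega>. worst_cost H \<omega> \<partial>pspace P) = ennreal (H / disc P)
     + (\<integral>\<^sup>+\<omega>. (\<Sum>n. ennreal (exp (- disc P * arr P (Suc n) \<omega>)) * ennreal (2 * swc_sum)) \<partial>pspace P)
     + (\<integral>\<^sup>+\<omega>. (\<Sum>n. ennreal (exp (- disc P * arr P (Suc n) \<omega>)) * ennreal (pen_pos (dem P (Suc n) \<omega>))) \<partial>pspace P)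
     + ennreal swc_sum"
    unfolding worst_cost_def
    by (subst nn_integral_add, measurable)+ (simp add: emeasure_space_1)
  then show ?thesis using 1 2 by simp
qed

lemma discounted_hold_le:
  assumes "0 \<le> H"
  shows "(\<integral>\<^sup>+t\<in>{0..}. ennreal (exp (- disc P * t) * H) \<partial>lborel) = ennreal (H / disc P)"
proof -
  have "(\<integral>\<^sup>+t\<in>{0..}. ennreal (exp (- disc P * t) * H) \<partial>lborel) =
    (\<integral>\<^sup>+t. ennreal (H / disc P) * ennreal (exponential_density (disc P) t) \<partial>lborel)"
  proof (rule nn_integral_cong)
    fix t
    have "H / disc P * exponential_density (disc P) t = exp (- disc P * t) * H * indicator {0..} t"
      using disc_pos by (simp add: exponential_density_def mult.commute)
    then show "ennreal (exp (- disc P * t) * H) * indicator {0..} t =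
       ennreal (H / disc P) * ennreal (exponential_density (disc P) t)"
      using assms disc_pos exponential_density_nonneg[OF disc_pos, of t]
      by (simp flip: ennreal_mult ennreal_indicator)
  qed
  also have "\<dots> = ennreal (H / disc P) * (\<integral>\<^sup>+t. ennreal (exponential_density (disc P) t) \<partial>lborel)"
    by (rule nn_integral_cmult) measurable
  also have "(\<integral>\<^sup>+t. ennreal (exponential_density (disc P) t) \<partial>lborel) = 1"
    using prob_space.emeasure_space_1[OF prob_space_exponential_density[OF disc_pos]]
    by (simp add: emeasure_density)
  finally show ?thesis by simp
qed

end

text \<open>A strategy started at \<open>x < cap\<close> fills the storage before \<open>fill_time\<close> unless a demand arrives first.
  On that event the strategy started at full storage can imitate it from the first arrival on.\<close>

locale filling_strategy = admissible_strategy P S x i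
  for P :: "'w inventory_model" and S x i +
  assumes below: "x < cap P"
begin

lemma start_phase: "i \<in> {1, 2}"
  using start below by auto

text \<open>Computed with the slowest productive rate, so that no choice of phases can delay the
  filling beyond it unless a demand intervenes.\<close>

definition fill_time :: real where
  "fill_time = (cap P - x) / rate P 2"

lemma fill_time_pos: "0 < fill_time"
  using below rates by (simp add: fill_time_def)

text \<open>The switch in force at \<open>fill_time\<close>. If no demand has come before, it is the
  one into the idle phase, which then lasts until the first arrival.\<close>

definition idx :: "'w \<Rightarrow> nat" where
  "idx \<omega> = (LEAST k. ereal fill_time < swtime S (Suc k) \<omega>)"

context
  fixes \<omega> assumes \<omega>: "\<omega> \<in> space (pspace P)" and late: "fill_time < arr P 1 \<omega>"
begin

text \<open>Before the first demand the level never decreases, so a level below \<open>cap P\<close>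
  at \<open>fill_time\<close> would have been below all along. Production would then have run at
  rate \<open>rate P 2\<close> or faster and filled the storage.\<close>

lemma full_at_fill_time: "inventory P S x fill_time \<omega> = cap P"
proof (rule ccontr)
  assume "inventory P S x fill_time \<omega> \<noteq> cap P"
  then have lt: "inventory P S x fill_time \<omega> < cap P"
    using inventory_le[OF \<omega>, of fill_time] fill_time_pos by simp
  have a0: "arr P 0 \<omega> = 0" by (rule arr_0[OF \<omega>])
  have inv: "inventory P S x u \<omega> = prelevel P S x 0 u \<omega>" if "0 \<le> u" "u \<le> fill_time" for u
    using that late a0 by (intro inventory_prelevel[OF \<omega>]) auto
  have rate: "rate P 2 \<le> rate P (phase S u \<omega>)" if u: "0 \<le> u" "u \<le> fill_time" for u
  proof -
    have "inventory P S x u \<omega> < cap P"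
      using lt inv[OF u] inv[of fill_time] prelevel_split[OF \<omega>, of 0 u fill_time] u a0 fill_time_pos
        produced_nonneg[OF \<omega>, of u fill_time] by simp
    then show ?thesis using phase_below[OF \<omega> u(1)] rates by auto
  qed
  have "set_lebesgue_integral lborel {0..fill_time} (\<lambda>_. rate P 2) \<le> produced P S 0 fill_time \<omega>"
    unfolding produced_def
    by (intro set_integral_mono rate_integrable[OF \<omega>] set_integrable_bounded[of _ _ _ "\<bar>rate P 2\<bar>"]) (auto intro: rate)
  moreover have "set_lebesgue_integral lborel {0..fill_time} (\<lambda>_. rate P 2) = cap P - x"
    using fill_time_pos rates by (simp add: set_lebesgue_integral_def fill_time_def)
  ultimately have "cap P \<le> prelevel P S x 0 fill_time \<omega>" by (simp add: prelevel_def a0)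
  then show False using lt inv[of fill_time] fill_time_pos by simp
qed

lemma idx: "swtime S (idx \<omega>) \<omega> \<le> ereal fill_time" "swphase S (idx \<omega>) \<omega> = 0"
  "swtime S (Suc (idx \<omega>)) \<omega> = ereal (arr P 1 \<omega>)"
proof -
  obtain k where k: "swtime S k \<omega> \<le> ereal fill_time" "ereal fill_time < swtime S (Suc k) \<omega>"
    using switch_interval[OF \<omega>, of fill_time] fill_time_pos by auto
  have "idx \<omega> = k"
    unfolding idx_def
  proof (rule Least_equality)
    fix j assume "ereal fill_time < swtime S (Suc j) \<omega>"
    then have "\<not> Suc j \<le> k" using swtime_mono[OF \<omega>, of "Suc j" k] k by auto
    then show "k \<le> j" by simp
  qed fact
  then show 1: "swtime S (idx \<omega>) \<omega> \<le> ereal fill_time" using k by simp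
  show 2: "swphase S (idx \<omega>) \<omega> = 0"
    using phase_full[OF \<omega> _ full_at_fill_time] fill_time_pos unfolding phase_def idx_def by simp
  obtain r where r: "swtime S (idx \<omega>) \<omega> = ereal r"
    using 1 swtime_nonneg[OF \<omega>, of "idx \<omega>"] by (cases "swtime S (idx \<omega>) \<omega>") auto
  have "0 \<le> r" "r \<le> fill_time" using 1 swtime_nonneg[OF \<omega>, of "idx \<omega>"] r by auto
  then have "num_arrivals P r \<omega> = 0"
    using late arr_0[OF \<omega>] by (intro num_arrivals_eqI[OF \<omega>]) auto
  then show "swtime S (Suc (idx \<omega>)) \<omega> = ereal (arr P 1 \<omega>)" using idle_until[OF \<omega> r 2] by simp
qed

text \<open>An earlier idle period would have to last until the first arrival, which comes after
  \<open>fill_time\<close>.\<close>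

lemma phase_before_idx:
  assumes "k < idx \<omega>" shows "swphase S k \<omega> \<in> {1, 2}"
proof (rule ccontr)
  assume "swphase S k \<omega> \<notin> {1, 2}"
  then have 0: "swphase S k \<omega> = 0" using swphase_range[OF \<omega>, of k] by auto
  have le: "swtime S (Suc k) \<omega> \<le> ereal fill_time"
    using swtime_mono[OF \<omega>, of "Suc k" "idx \<omega>"] assms idx(1) by auto
  then have le': "swtime S k \<omega> \<le> ereal fill_time" using swtime_Suc_le[OF \<omega>, of k] by (rule order_trans[rotated])
  then obtain r where r: "swtime S k \<omega> = ereal r"
    using swtime_nonneg[OF \<omega>, of k] by (cases "swtime S k \<omega>") auto
  have "0 \<le> r" "r \<le> fill_time" using le' swtime_nonneg[OF \<omega>, of k] r by auto
  then have "num_arrivals P r \<omega> = 0"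
    using late arr_0[OF \<omega>] by (intro num_arrivals_eqI[OF \<omega>]) auto
  then have "swtime S (Suc k) \<omega> = ereal (arr P 1 \<omega>)" using idle_until[OF \<omega> r 0] by simp
  then show False using le late by simp
qed

text \<open>The switch into the idle phase comes either directly from \<open>i\<close> or from
  \<open>3 - i\<close>. In the second case the switch before it must be from \<open>i\<close> to
  \<open>3 - i\<close>, since no other productive phase exists. All these switches happen by
  \<open>fill_time\<close>, hence the common discount factor.\<close>

lemma switch_cost_before_idx:
  "exp (- disc P * fill_time) * min (swc P i 0) (swc P i (3 - i) + swc P (3 - i) 0)
    \<le> (\<Sum>k<idx \<omega>. disc_at P (swtime S (Suc k) \<omega>) * swc P (swphase S k \<omega>) (swphase S (Suc k) \<omega>))"
proof -
  let ?E = "exp (- disc P * fill_time)"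
  let ?f = "\<lambda>k. disc_at P (swtime S (Suc k) \<omega>) * swc P (swphase S k \<omega>) (swphase S (Suc k) \<omega>)"
  have fin: "swtime S (Suc k) \<omega> \<noteq> \<infinity>" "?E \<le> disc_at P (swtime S (Suc k) \<omega>)" if "k < idx \<omega>" for k
  proof -
    have "swtime S (Suc k) \<omega> \<le> ereal fill_time"
      using swtime_mono[OF \<omega>, of "Suc k" "idx \<omega>"] that idx(1) by auto
    then obtain r where r: "swtime S (Suc k) \<omega> = ereal r" "r \<le> fill_time"
      using swtime_nonneg[OF \<omega>, of "Suc k"] by (cases "swtime S (Suc k) \<omega>") auto
    then show "swtime S (Suc k) \<omega> \<noteq> \<infinity>" "?E \<le> disc_at P (swtime S (Suc k) \<omega>)"
      using disc_pos by (auto simp: disc_at_def)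
  qed
  have ne: "swphase S (Suc k) \<omega> \<noteq> swphase S k \<omega>" if "k < idx \<omega>" for k
    using swphase_neq[OF \<omega>, of k] fin(1)[OF that] by simp
  have low: "?E * swc P (swphase S k \<omega>) (swphase S (Suc k) \<omega>) \<le> ?f k"
    and nn: "0 \<le> ?f k" if "k < idx \<omega>" for k
  proof -
    have s: "0 \<le> swc P (swphase S k \<omega>) (swphase S (Suc k) \<omega>)"
      using swphase_range[OF \<omega>] ne[OF that] by (intro swc_nonneg) auto
    then show "?E * swc P (swphase S k \<omega>) (swphase S (Suc k) \<omega>) \<le> ?f k"
      using fin(2)[OF that] by (rule mult_right_mono[rotated])
    show "0 \<le> ?f k" using s by (simp add: disc_at_def)
  qed
  have "idx \<omega> \<noteq> 0"
  proof
    assume "idx \<omega> = 0"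
    then show False using idx(2) swphase_0[OF \<omega>] start_phase by simp
  qed
  then obtain m where m: "idx \<omega> = Suc m" by (cases "idx \<omega>") auto
  show ?thesis
  proof (cases "swphase S m \<omega> = i")
    case True
    have "?E * min (swc P i 0) (swc P i (3 - i) + swc P (3 - i) 0) \<le> ?E * swc P i 0"
      by (intro mult_left_mono) auto
    also have "\<dots> \<le> ?f m" using low[of m] m True idx(2) by simp
    also have "\<dots> \<le> sum ?f {..<idx \<omega>}" using nn m by (intro member_le_sum) auto
    finally show ?thesis .
  next
    case False
    then have j: "swphase S m \<omega> = 3 - i" using phase_before_idx[of m] m start_phase by auto
    have "m \<noteq> 0"
    proof
      assume "m = 0"
      then show False using False swphase_0[OF \<omega>] by simp
    qed
    then obtain l where l: "m = Suc l" by (cases m) auto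
    then have il: "swphase S l \<omega> = i"
      using phase_before_idx[of l] ne[of l] m j start_phase by auto
    have "?E * min (swc P i 0) (swc P i (3 - i) + swc P (3 - i) 0) \<le> ?E * (swc P i (3 - i) + swc P (3 - i) 0)"
      by (intro mult_left_mono) auto
    also have "\<dots> \<le> ?f l + ?f m"
      using low[of l] low[of m] m l il j idx(2) by (simp add: distrib_left)
    also have "\<dots> = sum ?f {l, m}" using l by simp
    also have "\<dots> \<le> sum ?f {..<idx \<omega>}" using nn m l by (intro sum_mono2) auto
    finally show ?thesis .
  qed
qed

end

text \<open>If no demand comes by \<open>fill_time\<close>, the first \<open>idx \<omega>\<close>
  switches of \<open>S\<close> are dropped and the start of its idle period is moved back to time 0;
  all later switches are kept. Otherwise the default strategy takes over.\<close>

definition merged :: "'w strategy" where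
  "merged = \<lparr>swtime = (\<lambda>j \<omega>. if fill_time < arr P 1 \<omega> then (if j = 0 then 0 else swtime S (idx \<omega> + j) \<omega>)
        else swtime default_strategy j \<omega>),
     swphase = (\<lambda>j \<omega>. if fill_time < arr P 1 \<omega> then swphase S (idx \<omega> + j) \<omega> else swphase default_strategy j \<omega>)\<rparr>"

lemma merged_default:
  assumes "\<not> fill_time < arr P 1 \<omega>"
  shows "swtime merged k \<omega> = swtime default_strategy k \<omega>" "swphase merged k \<omega> = swphase default_strategy k \<omega>"
    "phase merged t \<omega> = phase default_strategy t \<omega>" "produced P merged s t \<omega> = produced P default_strategy s t \<omega>"
    "level_after P merged y \<omega> n = level_after P default_strategy y \<omega> n"
    "level_before P merged y \<omega> n = level_before P default_strategy y \<omega> n"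
    "inventory P merged y t \<omega> = inventory P default_strategy y t \<omega>"
proof -
  show 1: "swtime merged k \<omega> = swtime default_strategy k \<omega>" "swphase merged k \<omega> = swphase default_strategy k \<omega>" for k
    using assms by (auto simp: merged_def)
  show 2: "phase merged t \<omega> = phase default_strategy t \<omega>" for t
    by (simp add: phase_def 1)
  show 3: "produced P merged s t \<omega> = produced P default_strategy s t \<omega>" for s t
    by (simp add: produced_def 2)
  show 4: "level_after P merged y \<omega> n = level_after P default_strategy y \<omega> n" for n
    by (induction n) (simp_all add: 3)
  show "level_before P merged y \<omega> n = level_before P default_strategy y \<omega> n"
    "inventory P merged y t \<omega> = inventory P default_strategy y t \<omega>"
    by (simp_all add: level_before_def inventory_def 3 4)
qed

context
  fixes \<omega> assumes \<omega>: "\<omega> \<in> space (pspace P)" and late: "fill_time < arr P 1 \<omega>"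
begin

lemma merged_times:
  "swtime merged 0 \<omega> = 0" "swtime merged (Suc k) \<omega> = swtime S (idx \<omega> + Suc k) \<omega>"
  "swphase merged k \<omega> = swphase S (idx \<omega> + k) \<omega>"
  using late by (auto simp: merged_def)

lemma merged_phase_early: "t < arr P 1 \<omega> \<Longrightarrow> phase merged t \<omega> = 0"
proof -
  assume t: "t < arr P 1 \<omega>"
  have "(LEAST k. ereal t < swtime merged (Suc k) \<omega>) = 0"
    using t idx(3)[OF \<omega> late] by (intro Least_equality) (auto simp: merged_times)
  then show ?thesis using idx(2)[OF \<omega> late] by (simp add: phase_def merged_times)
qed

lemma merged_phase_late: "arr P 1 \<omega> \<le> t \<Longrightarrow> phase merged t \<omega> = phase S t \<omega>"
proof -
  assume t: "arr P 1 \<omega> \<le> t"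
  then have "0 \<le> t" using arr_nonneg[OF \<omega>, of 1] by simp
  then obtain k where k: "swtime S k \<omega> \<le> ereal t" "ereal t < swtime S (Suc k) \<omega>" by (rule switch_interval[OF \<omega>])
  have "\<not> Suc k \<le> Suc (idx \<omega>)"
    using swtime_mono[OF \<omega>, of "Suc k" "Suc (idx \<omega>)"] idx(3)[OF \<omega> late] k t by (auto dest: less_le_trans)
  then have ik: "idx \<omega> \<le> k" by simp
  have "(LEAST j. ereal t < swtime merged (Suc j) \<omega>) = k - idx \<omega>"
  proof (rule Least_equality)
    show "ereal t < swtime merged (Suc (k - idx \<omega>)) \<omega>" using k ik by (simp add: merged_times)
    fix j assume "ereal t < swtime merged (Suc j) \<omega>"
    then have "ereal t < swtime S (idx \<omega> + Suc j) \<omega>" by (simp add: merged_times)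
    then have "\<not> idx \<omega> + Suc j \<le> k" using swtime_mono[OF \<omega>, of "idx \<omega> + Suc j" k] k by auto
    then show "k - idx \<omega> \<le> j" by simp
  qed
  then have "phase merged t \<omega> = swphase S k \<omega>" using ik by (simp add: phase_def merged_times)
  then show ?thesis using phase_eqI[OF \<omega> k] by simp
qed

lemma merged_produced_early: "t \<le> arr P 1 \<omega> \<Longrightarrow> produced P merged s t \<omega> = 0"
proof -
  assume t: "t \<le> arr P 1 \<omega>"
  have "AE u in lborel. u \<noteq> t" by (rule AE_lborel_singleton)
  then have "AE u in lborel. indicator {s..t} u *\<^sub>R rate P (phase merged u \<omega>) = 0"
    by eventually_elim (use t rates in \<open>auto simp: indicator_def merged_phase_early\<close>)
  then show ?thesis unfolding produced_def set_lebesgue_integral_def by (rule integral_eq_zero_AE)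
qed

lemma merged_produced_late: "arr P 1 \<omega> \<le> s \<Longrightarrow> produced P merged s t \<omega> = produced P S s t \<omega>"
  unfolding produced_def by (intro set_lebesgue_integral_cong) (auto simp: merged_phase_late)

text \<open>\<open>S\<close> idles right before the first demand, so it meets this demand with full
  storage exactly as \<open>merged\<close> does. From here on the two paths coincide.\<close>

lemma level_before_first: "level_before P S x \<omega> (Suc 0) = cap P"
proof -
  have "0 < arr P 1 \<omega>" using arr_mono[OF \<omega>, of 0] arr_0[OF \<omega>] by simp
  then have "prephase S (arr P 1 \<omega>) \<omega> = 0" using switch_at(1)[OF \<omega> _ idx(3)[OF \<omega> late]] idx(2)[OF \<omega> late] by simp
  then show ?thesis
    unfolding level_before_Suc using arr_mono[OF \<omega>, of 0] by (intro prephase_0_imp[OF \<omega>]) auto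
qed

lemma merged_level:
  "level_before P merged (cap P) \<omega> (Suc n) = level_before P S x \<omega> (Suc n)"
  "level_after P merged (cap P) \<omega> (Suc n) = level_after P S x \<omega> (Suc n)"
proof (induction n)
  case 0
  have "level_before P merged (cap P) \<omega> (Suc 0) = cap P"
    using merged_produced_early[of "arr P 1 \<omega>" "arr P 0 \<omega>"] by (simp add: level_before_def)
  then show 1: "level_before P merged (cap P) \<omega> (Suc 0) = level_before P S x \<omega> (Suc 0)"
    using level_before_first by simp
  show "level_after P merged (cap P) \<omega> (Suc 0) = level_after P S x \<omega> (Suc 0)"
    unfolding level_after_Suc 1 ..
next
  case (Suc n)
  have "arr P 1 \<omega> \<le> arr P (Suc n) \<omega>" by (simp add: arr_le_iff[OF \<omega>])
  then have "produced P merged (arr P (Suc n) \<omega>) t \<omega> = produced P S (arr P (Suc n) \<omega>) t \<omega>" for t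
    by (rule merged_produced_late)
  then show 1: "level_before P merged (cap P) \<omega> (Suc (Suc n)) = level_before P S x \<omega> (Suc (Suc n))"
    using Suc(2) by (simp add: level_before_def del: level_after.simps)
  show "level_after P merged (cap P) \<omega> (Suc (Suc n)) = level_after P S x \<omega> (Suc (Suc n))"
    unfolding level_after_Suc[of _ _ _ _ "Suc n"] 1 ..
qed

lemma merged_inventory_early:
  assumes "0 \<le> t" "t < arr P 1 \<omega>" shows "inventory P merged (cap P) t \<omega> = cap P"
proof -
  have "num_arrivals P t \<omega> = 0" using assms arr_0[OF \<omega>] by (intro num_arrivals_eqI[OF \<omega>]) auto
  then show ?thesis using merged_produced_early[of t] assms by (simp add: inventory_def)
qed

lemma merged_inventory_late:
  assumes "arr P 1 \<omega> \<le> t" shows "inventory P merged (cap P) t \<omega> = inventory P S x t \<omega>"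
proof -
  have "0 \<le> t" using assms arr_nonneg[OF \<omega>, of 1] by simp
  then obtain n where n: "arr P n \<omega> \<le> t" "t < arr P (Suc n) \<omega>" by (rule arrival_interval[OF \<omega>])
  have "n \<noteq> 0"
  proof
    assume "n = 0"
    then show False using n assms by simp
  qed
  then obtain m where m: "n = Suc m" by (cases n) auto
  have "arr P 1 \<omega> \<le> arr P n \<omega>" using m by (simp add: arr_le_iff[OF \<omega>])
  then show ?thesis
    using num_arrivals_eqI[OF \<omega> n] merged_level(2)[of m] merged_produced_late[of "arr P n \<omega>" t] m
    by (simp add: inventory_def del: level_after.simps)
qed

lemma merged_paths:
  "swphase merged 0 \<omega> = 0"
  "swtime merged k \<omega> \<le> swtime merged (Suc k) \<omega>"
  "1 \<le> k \<Longrightarrow> swtime merged k \<omega> < \<infinity> \<Longrightarrow> swtime merged k \<omega> < swtime merged (Suc k) \<omega>"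
  "\<exists>k. ereal t < swtime merged k \<omega>"
  "swphase merged k \<omega> \<in> {0, 1, 2}"
  "swtime merged (Suc k) \<omega> < \<infinity> \<Longrightarrow> swphase merged (Suc k) \<omega> \<noteq> swphase merged k \<omega>"
  "0 \<le> t \<Longrightarrow> inventory P merged (cap P) t \<omega> \<le> cap P"
  "0 \<le> t \<Longrightarrow> inventory P merged (cap P) t \<omega> < cap P \<Longrightarrow> phase merged t \<omega> \<in> {1, 2}"
  "0 \<le> t \<Longrightarrow> inventory P merged (cap P) t \<omega> = cap P \<Longrightarrow> phase merged t \<omega> = 0"
  "swtime merged k \<omega> = ereal t \<Longrightarrow> swphase merged k \<omega> = 0 \<Longrightarrow>
     swtime merged (Suc k) \<omega> = ereal (arr P (Suc (num_arrivals P t \<omega>)) \<omega>)"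
proof -
  show "swphase merged 0 \<omega> = 0" using idx(2)[OF \<omega> late] by (simp add: merged_times)
  show "swtime merged k \<omega> \<le> swtime merged (Suc k) \<omega>"
    using swtime_nonneg[OF \<omega>] swtime_Suc_le[OF \<omega>] by (cases k) (auto simp: merged_times)
  show "1 \<le> k \<Longrightarrow> swtime merged k \<omega> < \<infinity> \<Longrightarrow> swtime merged k \<omega> < swtime merged (Suc k) \<omega>"
    using swtime_less_Suc[OF \<omega>, of "idx \<omega> + k"] by (cases k) (auto simp: merged_times)
  obtain n where "ereal t < swtime S n \<omega>" using swtime_unbounded[OF \<omega>] by blast
  also have "\<dots> \<le> swtime merged (Suc n) \<omega>" unfolding merged_times by (rule swtime_mono[OF \<omega>]) simp
  finally show "\<exists>k. ereal t < swtime merged k \<omega>" by blast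
  show "swphase merged k \<omega> \<in> {0, 1, 2}" unfolding merged_times by (rule swphase_range[OF \<omega>])
  show "swtime merged (Suc k) \<omega> < \<infinity> \<Longrightarrow> swphase merged (Suc k) \<omega> \<noteq> swphase merged k \<omega>"
    using swphase_neq[OF \<omega>, of "idx \<omega> + k"] by (simp add: merged_times)
  show "0 \<le> t \<Longrightarrow> inventory P merged (cap P) t \<omega> \<le> cap P"
    using inventory_le[OF \<omega>, of t] merged_inventory_early[of t] merged_inventory_late[of t]
    by (cases "t < arr P 1 \<omega>") auto
  show "0 \<le> t \<Longrightarrow> inventory P merged (cap P) t \<omega> < cap P \<Longrightarrow> phase merged t \<omega> \<in> {1, 2}"
    using phase_below[OF \<omega>, of t] merged_inventory_early[of t] merged_inventory_late[of t] merged_phase_late[of t]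
    by (cases "t < arr P 1 \<omega>") auto
  show "0 \<le> t \<Longrightarrow> inventory P merged (cap P) t \<omega> = cap P \<Longrightarrow> phase merged t \<omega> = 0"
    using phase_full[OF \<omega>, of t] merged_inventory_late[of t] merged_phase_late[of t] merged_phase_early[of t]
    by (cases "t < arr P 1 \<omega>") auto
  show "swtime merged (Suc k) \<omega> = ereal (arr P (Suc (num_arrivals P t \<omega>)) \<omega>)"
    if "swtime merged k \<omega> = ereal t" "swphase merged k \<omega> = 0"
  proof (cases k)
    case 0
    have "num_arrivals P 0 \<omega> = 0" using arr_0[OF \<omega>] arr_mono[OF \<omega>, of 0] by (intro num_arrivals_eqI[OF \<omega>]) auto
    then show ?thesis using that idx(3)[OF \<omega> late] 0 by (simp add: merged_times zero_ereal_def)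
  next
    case (Suc j)
    then show ?thesis using that idle_until[OF \<omega>, of "idx \<omega> + k" t] by (simp add: merged_times)
  qed
qed

end

text \<open>This form makes \<open>merged\<close> adapted. Both branches idle until the first
  arrival, so the branch matters only after it, and then the comparison of the arrival with
  \<open>fill_time\<close> is known.\<close>

lemma merged_phase:
  assumes \<omega>: "\<omega> \<in> space (pspace P)" and t: "0 \<le> t"
  shows "phase merged t \<omega> = (if \<not> arr P 1 \<omega> \<le> t then 0
     else if \<not> arr P 1 \<omega> \<le> min fill_time t then phase S t \<omega> else phase default_strategy t \<omega>)"
proof (cases "fill_time < arr P 1 \<omega>")
  case True
  then show ?thesis using merged_phase_early[OF \<omega> True, of t] merged_phase_late[OF \<omega> True, of t] by auto
next
  case False
  have "phase default_strategy t \<omega> = 0" if "t < arr P 1 \<omega>"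
    using default_phase[OF \<omega>, of 0 t] that t arr_0[OF \<omega>] fill_0[OF \<omega>] by simp
  then show ?thesis using False merged_default(3)[OF False, of t] by auto
qed

lemma merged_admissible: "merged \<in> admissible P (cap P) 0"
proof -
  have adapt: "phase merged t \<in> measurable (demand_filtration P t) (count_space UNIV)" if t: "0 \<le> t" for t
  proof -
    define p where "p \<omega> \<longleftrightarrow> arr P 1 \<omega> \<le> t" for \<omega>
    define r where "r \<omega> \<longleftrightarrow> arr P 1 \<omega> \<le> min fill_time t" for \<omega>
    have [measurable]: "Measurable.pred (demand_filtration P t) p" "Measurable.pred (demand_filtration P t) r"
      unfolding p_def r_def using t fill_time_pos by (rule_tac arr_le_adapted; simp)+
    note [measurable] = phase_adapted[OF t] default_phase_adapted[OF t]
    have "(\<lambda>\<omega>. if \<not> p \<omega> then 0 else if \<not> r \<omega> then phase S t \<omega> else phase default_strategy t \<omega>)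
      \<in> measurable (demand_filtration P t) (count_space UNIV)" by measurable
    then show ?thesis
      by (rule measurable_cong[THEN iffD1, rotated]) (simp add: merged_phase t p_def r_def)
  qed
  have "swtime merged 0 \<omega> = 0 \<and> swphase merged 0 \<omega> = 0 \<and>
        (\<forall>k. swtime merged k \<omega> \<le> swtime merged (Suc k) \<omega>) \<and>
        (\<forall>k\<ge>1. swtime merged k \<omega> < \<infinity> \<longrightarrow> swtime merged k \<omega> < swtime merged (Suc k) \<omega>) \<and>
        (\<forall>t::real. \<exists>k. ereal t < swtime merged k \<omega>) \<and>
        (\<forall>k. swphase merged k \<omega> \<in> {0, 1, 2}) \<and>
        (\<forall>k. swtime merged (Suc k) \<omega> < \<infinity> \<longrightarrow> swphase merged (Suc k) \<omega> \<noteq> swphase merged k \<omega>) \<and>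
        (\<forall>t\<ge>0. inventory P merged (cap P) t \<omega> \<le> cap P \<and>
           (inventory P merged (cap P) t \<omega> < cap P \<longrightarrow> phase merged t \<omega> \<in> {1, 2}) \<and>
           (inventory P merged (cap P) t \<omega> = cap P \<longrightarrow> phase merged t \<omega> = 0)) \<and>
        (\<forall>k. \<forall>t. swtime merged k \<omega> = ereal t \<and> swphase merged k \<omega> = 0 \<longrightarrow>
           swtime merged (Suc k) \<omega> = ereal (arr P (Suc (num_arrivals P t \<omega>)) \<omega>))"
    if \<omega>: "\<omega> \<in> space (pspace P)" for \<omega>
  proof (cases "fill_time < arr P 1 \<omega>")
    case True
    show ?thesis using merged_paths[OF \<omega> True] merged_times(1)[OF \<omega> True] by blast
  next
    case False
    show ?thesis using default_admissible \<omega> unfolding merged_default[OF False] admissible_def by blast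
  qed
  then show ?thesis using adapt unfolding admissible_def by blast
qed

end

context production_inventory
begin

lemma cost_eq: "cost P x S =
     (\<integral>\<^sup>+\<omega>. (\<integral>\<^sup>+t\<in>{0..}. ennreal (exp (- disc P * t) * hold P (phase S t \<omega>) (inventory P S x t \<omega>)) \<partial>lborel) \<partial>pspace P)
   + (\<integral>\<^sup>+\<omega>. (\<Sum>k. ennreal (disc_at P (swtime S (Suc k) \<omega>) *
          swc P (swphase S k \<omega>) (swphase S (Suc k) \<omega>))) \<partial>pspace P)
   + (\<integral>\<^sup>+\<omega>. (\<Sum>n. ennreal (exp (- disc P * arr P (Suc n) \<omega>)) *
          ennreal (shortfall_cost P (level_before P S x \<omega> (Suc n)) (dem P (Suc n) \<omega>))) \<partial>pspace P)"
  unfolding cost_def shortfall_cost_def Let_def by (simp add: ennreal_mult'[symmetric])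

end

section \<open>Comparison of costs with the imitated strategy\<close>

context filling_strategy
begin

text \<open>If the imitation succeeds, both strategies idle at full storage between
  \<open>fill_time\<close> and the first demand and agree afterwards; the imitation pays at most the
  idle holding rate over \<open>fill_time\<close> in addition. Otherwise the maximal rate bounds
  everything.\<close>

lemma merged_hold_cost:
  assumes \<omega>: "\<omega> \<in> space (pspace P)" and H: "0 \<le> H" "\<And>j z. hold_rate P j z \<le> H"
  shows "(\<integral>\<^sup>+t\<in>{0..}. ennreal (exp (- disc P * t) * hold P (phase merged t \<omega>) (inventory P merged (cap P) t \<omega>)) \<partial>lborel)
    \<le> (\<integral>\<^sup>+t\<in>{0..}. ennreal (exp (- disc P * t) * hold P (phase S t \<omega>) (inventory P S x t \<omega>)) \<partial>lborel)
      + (ennreal (hold P 0 (cap P) * fill_time) + ennreal (H / disc P) * indicator {\<omega>. arr P 1 \<omega> \<le> fill_time} \<omega>)"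
proof (cases "fill_time < arr P 1 \<omega>")
  case late: True
  let ?f = "\<lambda>t. ennreal (exp (- disc P * t) * hold P (phase S t \<omega>) (inventory P S x t \<omega>)) * indicator {0..} t"
  have "(\<integral>\<^sup>+t\<in>{0..}. ennreal (exp (- disc P * t) * hold P (phase merged t \<omega>) (inventory P merged (cap P) t \<omega>)) \<partial>lborel)
    \<le> (\<integral>\<^sup>+t. ?f t + ennreal (hold P 0 (cap P)) * indicator {0..fill_time} t \<partial>lborel)"
  proof (rule nn_integral_mono)
    fix t
    consider "t < 0" | "0 \<le> t" "t < fill_time" | "fill_time \<le> t" "t < arr P 1 \<omega>" | "arr P 1 \<omega> \<le> t" by linarith
    then show "ennreal (exp (- disc P * t) * hold P (phase merged t \<omega>) (inventory P merged (cap P) t \<omega>)) * indicator {0..} t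
      \<le> ?f t + ennreal (hold P 0 (cap P)) * indicator {0..fill_time} t"
    proof cases
      case 1
      then show ?thesis by simp
    next
      case 2
      have "exp (- disc P * t) * hold P 0 (cap P) \<le> 1 * hold P 0 (cap P)"
        using 2 disc_pos hold_0 by (intro mult_right_mono) auto
      then have "ennreal (exp (- disc P * t) * hold P 0 (cap P)) \<le> ennreal (hold P 0 (cap P))"
        by (intro ennreal_leI) simp
      then show ?thesis
        using 2 late merged_phase_early[OF \<omega> late, of t] merged_inventory_early[OF \<omega> late, of t]
        by (simp add: add_increasing)
    next
      case 3
      then have t0: "0 \<le> t" using fill_time_pos by simp
      have "swtime S (idx \<omega>) \<omega> \<le> ereal t" using idx(1)[OF \<omega> late] 3 by (auto intro: order_trans)
      then have ph: "phase S t \<omega> = 0"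
        using phase_eqI[OF \<omega>, of "idx \<omega>" t] idx(2,3)[OF \<omega> late] 3 by simp
      then have "inventory P S x t \<omega> = cap P"
        using phase_below[OF \<omega> t0] inventory_le[OF \<omega> t0] by force
      then show ?thesis
        using 3 t0 ph merged_phase_early[OF \<omega> late, of t] merged_inventory_early[OF \<omega> late, of t] by simp
    next
      case 4
      then show ?thesis
        using merged_phase_late[OF \<omega> late, of t] merged_inventory_late[OF \<omega> late, of t] by simp
    qed
  qed
  also have "\<dots> = (\<integral>\<^sup>+t. ?f t \<partial>lborel) + (\<integral>\<^sup>+t. ennreal (hold P 0 (cap P)) * indicator {0..fill_time} t \<partial>lborel)"
    by (rule nn_integral_add_nonmeasurable) measurable
  also have "(\<integral>\<^sup>+t. ennreal (hold P 0 (cap P)) * indicator {0..fill_time} t \<partial>lborel) = ennreal (hold P 0 (cap P) * fill_time)"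
    using fill_time_pos hold_0 by (simp add: nn_integral_cmult_indicator ennreal_mult)
  finally show ?thesis using late by simp
next
  case False
  interpret D: admissible_strategy P default_strategy "cap P" 0
    by unfold_locales (auto simp: default_admissible)
  have "(\<integral>\<^sup>+t\<in>{0..}. ennreal (exp (- disc P * t) * hold P (phase merged t \<omega>) (inventory P merged (cap P) t \<omega>)) \<partial>lborel)
    \<le> (\<integral>\<^sup>+t\<in>{0..}. ennreal (exp (- disc P * t) * H) \<partial>lborel)"
  proof (rule nn_integral_mono)
    fix t
    show "ennreal (exp (- disc P * t) * hold P (phase merged t \<omega>) (inventory P merged (cap P) t \<omega>)) * indicator {0..} t
      \<le> ennreal (exp (- disc P * t) * H) * indicator {0..} t"
      unfolding merged_default[OF False]
      using D.hold_eq_hold_rate[OF \<omega>, of t] H(2) by (auto simp: indicator_def intro!: ennreal_leI mult_left_mono)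
  qed
  also have "\<dots> = ennreal (H / disc P)" by (rule discounted_hold_le[OF H(1)])
  finally show ?thesis using False by (simp add: add_increasing)
qed

text \<open>Lower bound for the discounted switching cost of getting from phase \<open>i\<close> to
  full storage, which a start at full storage saves.\<close>

definition entry_cost :: real where
  "entry_cost = exp (- disc P * fill_time) * min (swc P i 0) (swc P i (3 - i) + swc P (3 - i) 0)"

lemma entry_cost_bounds: "0 \<le> entry_cost" "entry_cost \<le> swc_sum"
proof -
  have s: "0 \<le> swc P i 0" "0 \<le> swc P i (3 - i)" "0 \<le> swc P (3 - i) 0"
    using start_phase swc_nonneg[of 1 0] swc_nonneg[of 2 0] swc_nonneg[of 1 2] swc_nonneg[of 2 1] by auto
  then show "0 \<le> entry_cost" by (simp add: entry_cost_def)
  have "entry_cost \<le> 1 * swc P i 0"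
    unfolding entry_cost_def using s fill_time_pos disc_pos by (intro mult_mono) auto
  also have "\<dots> \<le> swc_sum" using swc_le_sum[of i 0] start_phase by auto
  finally show "entry_cost \<le> swc_sum" .
qed

text \<open>The dropped switches of \<open>S\<close> cost at least \<open>entry_cost\<close>, and
  the remaining ones are those of \<open>merged\<close> with the index shifted. If the imitation
  fails, the extra \<open>swc_sum\<close> on the right pays for \<open>entry_cost\<close>.\<close>

lemma merged_switch_cost:
  assumes \<omega>: "\<omega> \<in> space (pspace P)"
  shows "(\<Sum>k. ennreal (disc_at P (swtime merged (Suc k) \<omega>) * swc P (swphase merged k \<omega>) (swphase merged (Suc k) \<omega>)))
      + ennreal entry_cost
    \<le> (\<Sum>k. ennreal (disc_at P (swtime S (Suc k) \<omega>) * swc P (swphase S k \<omega>) (swphase S (Suc k) \<omega>)))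
      + ((\<Sum>n. ennreal (exp (- disc P * arr P (Suc n) \<omega>)) * ennreal (2 * swc_sum)) + ennreal swc_sum)
         * indicator {\<omega>. arr P 1 \<omega> \<le> fill_time} \<omega>"
proof (cases "fill_time < arr P 1 \<omega>")
  case late: True
  let ?f = "\<lambda>k. disc_at P (swtime S (Suc k) \<omega>) * swc P (swphase S k \<omega>) (swphase S (Suc k) \<omega>)"
  have nn: "0 \<le> ?f k" for k by (rule switch_cost_nonneg[OF \<omega>])
  have "ennreal entry_cost \<le> ennreal (\<Sum>k<idx \<omega>. ?f k)"
    unfolding entry_cost_def by (intro ennreal_leI switch_cost_before_idx[OF \<omega> late])
  also have "\<dots> = (\<Sum>k<idx \<omega>. ennreal (?f k))" using nn by (intro sum_ennreal[symmetric]) auto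
  finally have 1: "ennreal entry_cost \<le> (\<Sum>k<idx \<omega>. ennreal (?f k))" .
  have "(\<Sum>k<N. ennreal (?f (idx \<omega> + k))) + ennreal entry_cost \<le> (\<Sum>k. ennreal (?f k))" for N
  proof -
    have "(\<Sum>k<N. ennreal (?f (idx \<omega> + k))) + ennreal entry_cost \<le>
      (\<Sum>k<N. ennreal (?f (idx \<omega> + k))) + (\<Sum>k<idx \<omega>. ennreal (?f k))" by (intro add_left_mono 1)
    also have "\<dots> = (\<Sum>k<idx \<omega> + N. ennreal (?f k))"
      by (induction N) (simp_all add: ac_simps)
    also have "\<dots> \<le> (\<Sum>k. ennreal (?f k))" by (intro sum_le_suminf summableI) auto
    finally show ?thesis .
  qed
  then have "(\<Sum>k. ennreal (?f (idx \<omega> + k))) + ennreal entry_cost \<le> (\<Sum>k. ennreal (?f k))"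
    by (intro LIMSEQ_le_const2[OF tendsto_add[OF summable_LIMSEQ[OF summableI] tendsto_const]]) auto
  then show ?thesis using late by (simp add: merged_times[OF \<omega> late])
next
  case False
  have "(\<Sum>k. ennreal (disc_at P (swtime merged (Suc k) \<omega>) * swc P (swphase merged k \<omega>) (swphase merged (Suc k) \<omega>)))
    \<le> (\<Sum>n. ennreal (exp (- disc P * arr P (Suc n) \<omega>)) * ennreal (2 * swc_sum))"
    unfolding merged_default[OF False] by (rule default_switch_sum[OF \<omega> swc_le_sum swc_sum_nonneg])
  moreover have "ennreal entry_cost \<le> ennreal swc_sum" by (intro ennreal_leI entry_cost_bounds)
  ultimately show ?thesis using False by (simp add: add_mono add_increasing)
qed

lemma merged_shortfall_cost:
  assumes \<omega>: "\<omega> \<in> space (pspace P)"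
  shows "(\<Sum>n. ennreal (exp (- disc P * arr P (Suc n) \<omega>)) *
          ennreal (shortfall_cost P (level_before P merged (cap P) \<omega> (Suc n)) (dem P (Suc n) \<omega>)))
    \<le> (\<Sum>n. ennreal (exp (- disc P * arr P (Suc n) \<omega>)) *
          ennreal (shortfall_cost P (level_before P S x \<omega> (Suc n)) (dem P (Suc n) \<omega>)))
      + (\<Sum>n. ennreal (exp (- disc P * arr P (Suc n) \<omega>)) * ennreal (pen_pos (dem P (Suc n) \<omega>)))
         * indicator {\<omega>. arr P 1 \<omega> \<le> fill_time} \<omega>"
proof (cases "fill_time < arr P 1 \<omega>")
  case late: True
  then show ?thesis by (simp add: merged_level(1)[OF \<omega> late])
next
  case False
  interpret D: admissible_strategy P default_strategy "cap P" 0
    by unfold_locales (auto simp: default_admissible)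
  have "(\<Sum>n. ennreal (exp (- disc P * arr P (Suc n) \<omega>)) *
          ennreal (shortfall_cost P (level_before P merged (cap P) \<omega> (Suc n)) (dem P (Suc n) \<omega>)))
    \<le> (\<Sum>n. ennreal (exp (- disc P * arr P (Suc n) \<omega>)) * ennreal (pen_pos (dem P (Suc n) \<omega>)))"
    unfolding merged_default[OF False]
    by (intro suminf_le summableI mult_left_mono ennreal_leI shortfall_cost_le D.level_before_le[OF \<omega>]) auto
  then show ?thesis using False by (simp add: add_increasing)
qed

text \<open>The pathwise comparisons are integrated one by one. Only the correction terms are shown
  to be measurable, which suffices to split each integral.\<close>

lemma full_cost_le:
  assumes H: "0 \<le> H" "\<And>j z. hold_rate P j z \<le> H"
  shows "opt_cost P 0 (cap P) + ennreal entry_cost \<le> cost P x S + ennreal (hold P 0 (cap P) * fill_time)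
     + (\<integral>\<^sup>+\<omega>. worst_cost H \<omega> * indicator {\<omega>. arr P 1 \<omega> \<le> fill_time} \<omega> \<partial>pspace P)"
proof -
  let ?E = "\<lambda>f. \<integral>\<^sup>+\<omega>. f \<omega> \<partial>pspace P"
  let ?N = "\<lambda>\<omega>. indicator {\<omega>. arr P 1 \<omega> \<le> fill_time} \<omega> :: ennreal"
  have [measurable]: "?N \<in> borel_measurable (pspace P)"
  proof -
    have "(\<lambda>\<omega>. if arr P 1 \<omega> \<le> fill_time then 1 else 0 :: ennreal) \<in> borel_measurable (pspace P)" by measurable
    also have "(\<lambda>\<omega>. if arr P 1 \<omega> \<le> fill_time then 1 else 0 :: ennreal) = ?N" by (auto simp: indicator_def)
    finally show ?thesis .
  qed
  define A where "A S x \<omega> = (\<integral>\<^sup>+t\<in>{0..}. ennreal (exp (- disc P * t) * hold P (phase S t \<omega>) (inventory P S x t \<omega>)) \<partial>lborel)"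
    for S :: "'w strategy" and x \<omega>
  define B where "B S \<omega> = (\<Sum>k. ennreal (disc_at P (swtime S (Suc k) \<omega>) * swc P (swphase S k \<omega>) (swphase S (Suc k) \<omega>)))"
    for S :: "'w strategy" and \<omega>
  define C where "C S x \<omega> = (\<Sum>n. ennreal (exp (- disc P * arr P (Suc n) \<omega>)) *
          ennreal (shortfall_cost P (level_before P S x \<omega> (Suc n)) (dem P (Suc n) \<omega>)))" for S :: "'w strategy" and x \<omega>
  define b where "b \<omega> = (\<Sum>n. ennreal (exp (- disc P * arr P (Suc n) \<omega>)) * ennreal (2 * swc_sum)) + ennreal swc_sum" for \<omega>
  define c where "c \<omega> = (\<Sum>n. ennreal (exp (- disc P * arr P (Suc n) \<omega>)) * ennreal (pen_pos (dem P (Suc n) \<omega>)))" for \<omega>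
  have [measurable]: "b \<in> borel_measurable (pspace P)" "c \<in> borel_measurable (pspace P)"
    unfolding b_def c_def by measurable
  have a: "?E (A merged (cap P)) \<le> ?E (A S x) + (ennreal (hold P 0 (cap P) * fill_time) + ?E (\<lambda>\<omega>. ennreal (H / disc P) * ?N \<omega>))"
  proof -
    have "?E (A merged (cap P)) \<le> ?E (\<lambda>\<omega>. A S x \<omega> + (ennreal (hold P 0 (cap P) * fill_time) + ennreal (H / disc P) * ?N \<omega>))"
      unfolding A_def by (intro nn_integral_mono merged_hold_cost H)
    also have "\<dots> = ?E (A S x) + ?E (\<lambda>\<omega>. ennreal (hold P 0 (cap P) * fill_time) + ennreal (H / disc P) * ?N \<omega>)"
      by (rule nn_integral_add_nonmeasurable) measurable
    also have "?E (\<lambda>\<omega>. ennreal (hold P 0 (cap P) * fill_time) + ennreal (H / disc P) * ?N \<omega>) =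
       ennreal (hold P 0 (cap P) * fill_time) + ?E (\<lambda>\<omega>. ennreal (H / disc P) * ?N \<omega>)"
      by (subst nn_integral_add) (auto simp: emeasure_space_1)
    finally show ?thesis .
  qed
  have b: "?E (B merged) + ennreal entry_cost \<le> ?E (B S) + ?E (\<lambda>\<omega>. b \<omega> * ?N \<omega>)"
  proof -
    have "?E (B merged) + ennreal entry_cost = ?E (\<lambda>\<omega>. B merged \<omega> + ennreal entry_cost)"
      by (subst nn_integral_add_nonmeasurable) (auto simp: emeasure_space_1)
    also have "\<dots> \<le> ?E (\<lambda>\<omega>. B S \<omega> + b \<omega> * ?N \<omega>)"
      unfolding B_def b_def by (intro nn_integral_mono merged_switch_cost)
    also have "\<dots> = ?E (B S) + ?E (\<lambda>\<omega>. b \<omega> * ?N \<omega>)"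
      by (rule nn_integral_add_nonmeasurable) measurable
    finally show ?thesis .
  qed
  have c: "?E (C merged (cap P)) \<le> ?E (C S x) + ?E (\<lambda>\<omega>. c \<omega> * ?N \<omega>)"
  proof -
    have "?E (C merged (cap P)) \<le> ?E (\<lambda>\<omega>. C S x \<omega> + c \<omega> * ?N \<omega>)"
      unfolding C_def c_def by (intro nn_integral_mono merged_shortfall_cost)
    also have "\<dots> = ?E (C S x) + ?E (\<lambda>\<omega>. c \<omega> * ?N \<omega>)"
      by (rule nn_integral_add_nonmeasurable) measurable
    finally show ?thesis .
  qed
  have w: "?E (\<lambda>\<omega>. worst_cost H \<omega> * ?N \<omega>) = ?E (\<lambda>\<omega>. ennreal (H / disc P) * ?N \<omega>) + ?E (\<lambda>\<omega>. b \<omega> * ?N \<omega>) + ?E (\<lambda>\<omega>. c \<omega> * ?N \<omega>)"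
  proof -
    have "?E (\<lambda>\<omega>. worst_cost H \<omega> * ?N \<omega>) = ?E (\<lambda>\<omega>. (ennreal (H / disc P) * ?N \<omega> + b \<omega> * ?N \<omega>) + c \<omega> * ?N \<omega>)"
      by (intro nn_integral_cong) (simp add: worst_cost_def b_def c_def algebra_simps)
    also have "\<dots> = ?E (\<lambda>\<omega>. ennreal (H / disc P) * ?N \<omega> + b \<omega> * ?N \<omega>) + ?E (\<lambda>\<omega>. c \<omega> * ?N \<omega>)"
      by (rule nn_integral_add) measurable
    also have "?E (\<lambda>\<omega>. ennreal (H / disc P) * ?N \<omega> + b \<omega> * ?N \<omega>) = ?E (\<lambda>\<omega>. ennreal (H / disc P) * ?N \<omega>) + ?E (\<lambda>\<omega>. b \<omega> * ?N \<omega>)"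
      by (rule nn_integral_add) measurable
    finally show ?thesis .
  qed
  have "opt_cost P 0 (cap P) \<le> cost P (cap P) merged"
    unfolding opt_cost_def by (rule INF_lower[OF merged_admissible])
  also have "\<dots> = ?E (A merged (cap P)) + ?E (B merged) + ?E (C merged (cap P))"
    unfolding cost_eq A_def B_def C_def ..
  finally have "opt_cost P 0 (cap P) + ennreal entry_cost \<le>
     ?E (A merged (cap P)) + (?E (B merged) + ennreal entry_cost) + ?E (C merged (cap P))"
    by (simp add: ac_simps add_left_mono)
  also have "\<dots> \<le> (?E (A S x) + (ennreal (hold P 0 (cap P) * fill_time) + ?E (\<lambda>\<omega>. ennreal (H / disc P) * ?N \<omega>)))
     + (?E (B S) + ?E (\<lambda>\<omega>. b \<omega> * ?N \<omega>)) + (?E (C S x) + ?E (\<lambda>\<omega>. c \<omega> * ?N \<omega>))"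
    by (intro add_mono a b c)
  also have "\<dots> = (?E (A S x) + ?E (B S) + ?E (C S x)) + ennreal (hold P 0 (cap P) * fill_time) + ?E (\<lambda>\<omega>. worst_cost H \<omega> * ?N \<omega>)"
    unfolding w by (simp add: ac_simps)
  also have "?E (A S x) + ?E (B S) + ?E (C S x) = cost P x S"
    unfolding cost_eq A_def B_def C_def ..
  finally show ?thesis .
qed

end

text \<open>The time needed to fill up tends to 0, while the first arrival time is positive on every
  path. So the event that the imitation fails disappears pointwise, and \<open>worst_cost\<close>
  dominates; the discount on the entry cost tends to 1.\<close>

lemma (in production_inventory) full_cost_limit:
  fixes X c :: "nat \<Rightarrow> real"
  assumes i: "i \<in> {1, 2}" and X: "\<And>n. X n \<in> {lmin P..<cap P}" "X \<longlonglongrightarrow> cap P"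
    and S: "\<And>n. S n \<in> admissible P (X n) i" "\<And>n. cost P (X n) (S n) = ennreal (c n)" and c: "c \<longlonglongrightarrow> C"
  shows "opt_cost P 0 (cap P) + ennreal (min (swc P i 0) (swc P i (3 - i) + swc P (3 - i) 0)) \<le> ennreal C"
proof -
  obtain H where H: "0 \<le> H" "\<And>i z. hold_rate P i z \<le> H" using hold_rate_bound by blast
  define T where "T n = (cap P - X n) / rate P 2" for n
  let ?m = "min (swc P i 0) (swc P i (3 - i) + swc P (3 - i) 0)"
  let ?I = "\<lambda>n. \<integral>\<^sup>+\<omega>. worst_cost H \<omega> * indicator {\<omega>. arr P 1 \<omega> \<le> T n} \<omega> \<partial>pspace P"
  have T: "T \<longlonglongrightarrow> 0"
  proof -
    have "T \<longlonglongrightarrow> (cap P - cap P) / rate P 2"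
      unfolding T_def using rates by (intro tendsto_intros X) auto
    then show ?thesis by simp
  qed
  have le: "opt_cost P 0 (cap P) + ennreal (exp (- disc P * T n) * ?m) \<le> ennreal (c n) + ennreal (hold P 0 (cap P) * T n) + ?I n" for n
  proof -
    interpret F: filling_strategy P "S n" "X n" i
      using S(1)[of n] X(1)[of n] i by unfold_locales auto
    show ?thesis
      using F.full_cost_le[OF H] unfolding F.entry_cost_def F.fill_time_def T_def S(2) .
  qed
  have "?I \<longlonglongrightarrow> (\<integral>\<^sup>+\<omega>. 0 \<partial>pspace P)"
  proof (rule nn_integral_dominated_convergence[where w="worst_cost H"])
    show "(\<lambda>\<omega>. worst_cost H \<omega> * indicator {\<omega>. arr P 1 \<omega> \<le> T n} \<omega>) \<in> borel_measurable (pspace P)" for n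
    proof -
      have "(\<lambda>\<omega>. worst_cost H \<omega> * (if arr P 1 \<omega> \<le> T n then 1 else 0)) \<in> borel_measurable (pspace P)" by measurable
      also have "(\<lambda>\<omega>. worst_cost H \<omega> * (if arr P 1 \<omega> \<le> T n then 1 else 0)) =
         (\<lambda>\<omega>. worst_cost H \<omega> * indicator {\<omega>. arr P 1 \<omega> \<le> T n} \<omega>)" by (auto simp: indicator_def)
      finally show ?thesis .
    qed
    show "AE \<omega> in pspace P. (\<lambda>n. worst_cost H \<omega> * indicator {\<omega>. arr P 1 \<omega> \<le> T n} \<omega>) \<longlonglongrightarrow> 0"
    proof (rule AE_I2)
      fix \<omega> assume \<omega>: "\<omega> \<in> space (pspace P)"
      have "0 < arr P 1 \<omega>" using arr_mono[OF \<omega>, of 0] arr_0[OF \<omega>] by simp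
      then have "\<forall>\<^sub>F n in sequentially. T n < arr P 1 \<omega>" using T by (rule order_tendstoD(2)[rotated])
      then have "\<forall>\<^sub>F n in sequentially. worst_cost H \<omega> * indicator {\<omega>. arr P 1 \<omega> \<le> T n} \<omega> = 0"
        by eventually_elim simp
      then show "(\<lambda>n. worst_cost H \<omega> * indicator {\<omega>. arr P 1 \<omega> \<le> T n} \<omega>) \<longlonglongrightarrow> 0"
        by (rule tendsto_eventually)
    qed
    show "(\<integral>\<^sup>+\<omega>. worst_cost H \<omega> \<partial>pspace P) < \<infinity>" by (rule worst_cost_finite)
  qed (auto simp: indicator_def)
  then have I: "?I \<longlonglongrightarrow> 0" by simp
  have "(\<lambda>n. ennreal (exp (- disc P * T n) * ?m)) \<longlonglongrightarrow> ennreal (exp (- disc P * 0) * ?m)"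
    by (intro tendsto_ennrealI tendsto_intros T)
  then have l: "(\<lambda>n. opt_cost P 0 (cap P) + ennreal (exp (- disc P * T n) * ?m)) \<longlonglongrightarrow> opt_cost P 0 (cap P) + ennreal ?m"
    by (intro tendsto_add tendsto_const) simp
  have "(\<lambda>n. ennreal (hold P 0 (cap P) * T n)) \<longlonglongrightarrow> ennreal (hold P 0 (cap P) * 0)"
    by (intro tendsto_ennrealI tendsto_intros T)
  then have "(\<lambda>n. ennreal (c n) + ennreal (hold P 0 (cap P) * T n) + ?I n) \<longlonglongrightarrow> ennreal C + 0 + 0"
    by (intro tendsto_add tendsto_ennrealI c I) simp
  from LIMSEQ_le[OF l this] le show ?thesis by auto
qed

section \<open>Verification theorem\<close>

text \<open>Close to any point there is one at which some parabola touches \<open>f\<close> from above.\<close>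

lemma le_of_touching_points:
  fixes f g :: "real \<Rightarrow> real"
  assumes lb: "l < b" and f: "continuous_on {l..b} f" and g: "continuous_on {l..b} g"
    and touch: "\<And>z \<phi>. l < z \<Longrightarrow> z < b \<Longrightarrow> C1_on l b \<phi> \<Longrightarrow> \<phi> z = f z \<Longrightarrow>
       (\<And>y. y \<in> {l..b} \<Longrightarrow> f y \<le> \<phi> y) \<Longrightarrow> f z \<le> g z"
    and z: "z \<in> {l..b}"
  shows "f z \<le> g z"
proof (rule ccontr)
  assume "\<not> f z \<le> g z"
  then have pos: "0 < f z - g z" by simp
  have "continuous_on {l..b} (\<lambda>y. f y - g y)" by (intro continuous_intros f g)
  then obtain d where d: "0 < d" "\<And>y. y \<in> {l..b} \<Longrightarrow> \<bar>y - z\<bar> < d \<Longrightarrow> \<bar>(f y - g y) - (f z - g z)\<bar> < f z - g z"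
    using z pos unfolding continuous_on_iff dist_real_def by metis
  \<comment> \<open>Centre and half-length of the part of \<open>{l..b}\<close> within distance
    \<open>d\<close> of \<open>z\<close>; there \<open>g < f\<close>. The point \<open>z\<close>
    itself may be an endpoint and need not qualify as centre.\<close>
  define c where "c = (max l (z - d) + min b (z + d)) / 2"
  define r where "r = (min b (z + d) - max l (z - d)) / 2"
  have r: "0 < r" using d(1) z lb by (auto simp: r_def)
  have near: "l < y \<and> y < b \<and> g y < f y" if "\<bar>y - c\<bar> < r" for y
  proof -
    have "max l (z - d) < y" "y < min b (z + d)" using that by (auto simp: c_def r_def abs_less_iff field_simps)
    then have "l < y" "y < b" "\<bar>y - z\<bar> < d" by auto
    then show ?thesis using d(2)[of y] by (auto simp: abs_less_iff)
  qed
  obtain B where B: "\<forall>y\<in>{l..b}. \<bar>f y\<bar> \<le> B"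
    using compact_imp_bounded[OF compact_continuous_image[OF f]] unfolding bounded_iff by auto
  have cI: "c \<in> {l..b}" using near[of c] r by simp
  \<comment> \<open>At distance \<open>r\<close> from \<open>c\<close> the parabola has fallen by
    \<open>2 * B + 1\<close>, more than \<open>f\<close> can vary, so the maximum is attained closer
    to \<open>c\<close>.\<close>
  define n where "n = (2 * B + 1) / r\<^sup>2"
  have B0: "0 \<le> B" using B cI by (meson abs_ge_zero order_trans)
  have n: "0 < n" using r B0 by (simp add: n_def)
  have "continuous_on {l..b} (\<lambda>y. f y - n * (y - c)\<^sup>2)" by (intro continuous_intros f)
  then obtain m where m: "m \<in> {l..b}" "\<And>y. y \<in> {l..b} \<Longrightarrow> f y - n * (y - c)\<^sup>2 \<le> f m - n * (m - c)\<^sup>2"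
    using continuous_attains_sup[of "{l..b}" "\<lambda>y. f y - n * (y - c)\<^sup>2"] lb by auto
  have "n * (m - c)\<^sup>2 \<le> f m - f c" using m(2)[OF cI] by simp
  also have "\<dots> < 2 * B + 1" using B[rule_format, OF m(1)] B[rule_format, OF cI] by linarith
  also have "\<dots> = n * r\<^sup>2" using r by (simp add: n_def)
  finally have "(m - c)\<^sup>2 < r\<^sup>2" using n by simp
  then have "\<bar>m - c\<bar> < r" using power2_less_imp_less[of "\<bar>m - c\<bar>" r] r by simp
  then have mI: "l < m" "m < b" "g m < f m" using near by auto
  define \<phi> where "\<phi> y = f m + n * ((y - c)\<^sup>2 - (m - c)\<^sup>2)" for y
  have "C1_on l b \<phi>"
    unfolding C1_on_def \<phi>_def
    by (intro exI[of _ "\<lambda>y. n * (2 * (y - c))"] conjI ballI) (auto intro!: derivative_eq_intros continuous_intros)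
  moreover have "\<phi> m = f m" by (simp add: \<phi>_def)
  moreover have "f y \<le> \<phi> y" if "y \<in> {l..b}" for y
    using m(2)[OF that] by (simp add: \<phi>_def algebra_simps)
  ultimately have "f m \<le> g m" using mI by (intro touch[of m \<phi>]) auto
  then show False using mI by simp
qed

text \<open>Demands are almost surely positive, so the two integrals in \<open>w0_cap\<close>
  together are the mean penalty and the mean value after a demand at full storage. Clearing the
  denominator gives the balance equation required of \<open>v0\<close>.\<close>

lemma (in production_inventory) w0_cap_running:
  assumes v: "\<And>j. j \<in> {1, 2} \<Longrightarrow> continuous_on UNIV (v j)" "\<And>j z. j \<in> {1, 2} \<Longrightarrow> \<bar>v j z\<bar> \<le> M"
    and vw: "\<And>j z. j \<in> {1, 2} \<Longrightarrow> z \<in> {lmin P..cap P} \<Longrightarrow> v j z = w j z"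
  shows "(disc P + lam P) * w0_cap P w = running P 0 (wbar P v) (cap P)"
proof -
  let ?c = "cap P - lmin P"
  have [measurable]: "wbar P v \<in> borel_measurable borel"
    unfolding wbar_def[abs_def] using v(1)[of 1] v(1)[of 2]
    by (intro borel_measurable_continuous_onI continuous_intros) auto
  have bnd: "\<bar>wbar P v z\<bar> \<le> \<bar>M\<bar> + \<bar>swc P 0 1\<bar> + \<bar>swc P 0 2\<bar>" for z
    using v(2)[of 1 z] v(2)[of 2 z] by (auto simp: wbar_def min_def)
  have wb: "wbar P v z = wbar P w z" if "z \<in> {lmin P..cap P}" for z
    using vw[of 1, OF _ that] vw[of 2, OF _ that] by (simp add: wbar_def)
  have 1: "set_lebesgue_integral (dlaw P) {0..?c} (\<lambda>a. wbar P w (cap P - a)) =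
     (\<integral>a. indicator {0..?c} a * wbar P v (cap P - a) \<partial>dlaw P)"
    unfolding set_lebesgue_integral_def
    by (intro Bochner_Integration.integral_cong refl) (auto simp: indicator_def wb)
  have 2: "set_lebesgue_integral (dlaw P) {?c<..} (\<lambda>a. pen P (a - cap P + lmin P) + wbar P w (lmin P)) =
     (\<integral>a. shortfall_cost P (cap P) a + indicator {?c<..} a * wbar P v (lmin P) \<partial>dlaw P)"
    unfolding set_lebesgue_integral_def using lmin_less_cap
    by (intro Bochner_Integration.integral_cong refl) (auto simp: indicator_def wb shortfall_cost_def algebra_simps)
  have i1: "integrable (dlaw P) (\<lambda>a. indicator {0..?c} a * wbar P v (cap P - a))"
    by (rule demand.integrable_const_bound[of _ "\<bar>M\<bar> + \<bar>swc P 0 1\<bar> + \<bar>swc P 0 2\<bar>"])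
      (use bnd in \<open>auto simp: indicator_def\<close>)
  have i2: "integrable (dlaw P) (\<lambda>a. indicator {?c<..} a * wbar P v (lmin P))"
    by (rule demand.integrable_const_bound[of _ "\<bar>M\<bar> + \<bar>swc P 0 1\<bar> + \<bar>swc P 0 2\<bar>"])
      (use bnd in \<open>auto simp: indicator_def\<close>)
  have i3: "integrable (dlaw P) (shortfall_cost P (cap P))"
    using lmin_less_cap by (intro shortfall_cost_integrable) simp
  have "jump_mean P (wbar P v) (cap P) =
     (\<integral>a. indicator {0..?c} a * wbar P v (cap P - a) + indicator {?c<..} a * wbar P v (lmin P) \<partial>dlaw P)"
    unfolding jump_mean_def
  proof (rule integral_cong_AE)
    show "AE a in dlaw P. wbar P v (served P (cap P) a) =
        indicator {0..?c} a * wbar P v (cap P - a) + indicator {?c<..} a * wbar P v (lmin P)"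
      using AE_dlaw_pos by eventually_elim (auto simp: served_def indicator_def min_def)
  qed measurable
  also have "\<dots> = (\<integral>a. indicator {0..?c} a * wbar P v (cap P - a) \<partial>dlaw P) + (\<integral>a. indicator {?c<..} a * wbar P v (lmin P) \<partial>dlaw P)"
    by (rule Bochner_Integration.integral_add[OF i1 i2])
  finally have "set_lebesgue_integral (dlaw P) {0..?c} (\<lambda>a. wbar P w (cap P - a))
     + set_lebesgue_integral (dlaw P) {?c<..} (\<lambda>a. pen P (a - cap P + lmin P) + wbar P w (lmin P))
     = jump_mean P (wbar P v) (cap P) + shortfall_mean P (cap P)"
    unfolding 1 2 Bochner_Integration.integral_add[OF i3 i2] shortfall_mean_def by simp
  then have "w0_cap P w = lam P / (disc P + lam P) * (jump_mean P (wbar P v) (cap P) + shortfall_mean P (cap P))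
     + hold P 0 (cap P) / (disc P + lam P)"
    unfolding w0_cap_def by simp
  moreover have "disc P + lam P \<noteq> 0" using disc_pos lam_pos by simp
  ultimately show ?thesis by (simp add: running_def hold_rate_def distrib_left)
qed

theorem theorem4p4:
  fixes P :: "'w inventory_model"
    and strat :: "nat \<Rightarrow> real \<Rightarrow> 'w strategy"
    and w :: "nat \<Rightarrow> real \<Rightarrow> real"
  assumes model: "production_inventory P"
    and adm: "\<And>i x. i \<in> {1, 2} \<Longrightarrow> x \<in> {lmin P..<cap P} \<Longrightarrow> strat i x \<in> admissible P x i"
    and cost_finite: "\<And>i x. i \<in> {1, 2} \<Longrightarrow> x \<in> {lmin P..<cap P} \<Longrightarrow> cost P x (strat i x) < \<infinity>"
    and w_eq: "\<And>i x. i \<in> {1, 2} \<Longrightarrow> x \<in> {lmin P..<cap P} \<Longrightarrow> w i x = enn2real (cost P x (strat i x))"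
    and supersol: "\<And>i j x. (i, j) \<in> {(1, 2), (2, 1)} \<Longrightarrow> x \<in> {lmin P<..<cap P} \<Longrightarrow>
                     viscosity_supersolution_at P i j (w i) x"
    and boundary: "w 1 (cap P) \<le> w0_cap P w + swc P 1 0" "w 2 (cap P) \<le> w0_cap P w + swc P 2 0"
  shows "opt_cost P 0 (cap P) = ennreal (w0_cap P w) \<and>
         (\<forall>i\<in>{1, 2}. \<forall>x\<in>{lmin P..<cap P}. opt_cost P i x = ennreal (w i x))"
proof -
  interpret production_inventory P by (rule model)
  let ?l = "lmin P" and ?b = "cap P"
  have lb: "?l < ?b" by (rule lmin_less_cap)
  have wc: "continuous_on {?l..?b} (w i)" if i: "i \<in> {1, 2}" for i
  proof -
    \<comment> \<open>Lipschitz continuity is part of the supersolution property at each single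
      point; the midpoint delivers it.\<close>
    have "(?l + ?b) / 2 \<in> {?l<..<?b}" "(i, 3 - i) \<in> {(1, 2), (2, 1)}" using lb i by auto
    then have "\<exists>L. L-lipschitz_on {?l..?b} (w i)"
      using supersol unfolding viscosity_supersolution_at_def by blast
    then show ?thesis by (auto intro: lipschitz_on_continuous_on)
  qed
  have cost_w: "cost P x (strat i x) = ennreal (w i x)" if "i \<in> {1, 2}" "x \<in> {?l..<?b}" for i x
    using w_eq[OF that] cost_finite[OF that] by (simp add: less_top)
  have V_le: "opt_cost P i x \<le> ennreal (w i x)" if "i \<in> {1, 2}" "x \<in> {?l..<?b}" for i x
    unfolding opt_cost_def cost_w[OF that, symmetric] by (rule INF_lower[OF adm[OF that]])
  define X where "X n = ?b - (?b - ?l) / real (Suc n)" for n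
  have X: "X n \<in> {?l..<?b}" for n
  proof -
    have "(?b - ?l) / real (Suc n) \<le> ?b - ?l" 
      using lb divide_left_mono[of 1 "real (Suc n)" "?b - ?l"] by simp
    moreover have "0 < (?b - ?l) / real (Suc n)" using lb by simp
    ultimately show ?thesis by (simp add: X_def)
  qed
  have Xlim: "X \<longlonglongrightarrow> ?b"
    unfolding X_def by real_asymp
  have wlim: "(\<lambda>n. w i (X n)) \<longlonglongrightarrow> w i ?b" if "i \<in> {1, 2}" for i
    using wc[OF that] X Xlim lb by (intro continuous_on_tendsto_compose[of "{?l..?b}" "w i"]) (auto intro!: always_eventually less_imp_le)
  have w_nonneg: "0 \<le> w i x" if "i \<in> {1, 2}" "x \<in> {?l..?b}" for i x
  proof (cases "x = ?b")
    case True
    show ?thesis unfolding True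
      by (rule LIMSEQ_le_const[OF wlim[OF that(1)]]) (use X w_eq that in auto)
  next
    case False
    then show ?thesis using that w_eq[of i x] by auto
  qed
  have touch: "0 \<le> hjb_op P i \<phi> x \<and> w i x \<le> enn2real (opt_cost P j x) + swc P i j"
    if "(i, j) \<in> {(1, 2), (2, 1)}" "x \<in> {?l<..<?b}" "C1_on ?l ?b \<phi>" "\<phi> x = w i x" "\<And>y. y \<in> {?l..?b} \<Longrightarrow> w i y \<le> \<phi> y"
    for i j x \<phi>
  proof -
    have "0 \<le> min (hjb_op P i \<phi> x) (enn2real (opt_cost P j x) + swc P i j - w i x)"
      using supersol[OF that(1,2)] that(3-5) unfolding viscosity_supersolution_at_def by auto
    then show ?thesis by simp
  qed
  \<comment> \<open>The obstacle inequality holds only at levels admitting a test function and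
    involves the optimal cost. The latter is at most \<open>w j\<close>, and continuity carries the
    inequality from the touching points to all levels, the endpoints included.\<close>
  have obstacle: "w i z \<le> w j z + swc P i j" if ij: "(i, j) \<in> {(1, 2), (2, 1)}" and z: "z \<in> {?l..?b}" for i j z
  proof (rule le_of_touching_points[OF lb _ _ _ z])
    show "continuous_on {?l..?b} (w i)" "continuous_on {?l..?b} (\<lambda>z. w j z + swc P i j)"
      using ij by (auto intro!: continuous_intros wc)
    fix y \<phi> assume y: "?l < y" "y < ?b" and \<phi>: "C1_on ?l ?b \<phi>" "\<phi> y = w i y" "\<And>s. s \<in> {?l..?b} \<Longrightarrow> w i s \<le> \<phi> s"
    have "enn2real (opt_cost P j y) \<le> enn2real (ennreal (w j y))"
      using ij y by (intro enn2real_mono V_le) auto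
    then show "w i y \<le> w j y + swc P i j"
      using touch[OF ij _ \<phi>] y w_nonneg[of j y] ij by auto
  qed
  \<comment> \<open>Clamping the argument extends \<open>w i\<close> to a bounded continuous
    function on the whole line, so no domain conditions are needed under the integrals.\<close>
  define v where "v i z = w i (max ?l (min ?b z))" for i z
  have vw: "v i z = w i z" if "z \<in> {?l..?b}" for i z using that by (simp add: v_def)
  have clamp: "max ?l (min ?b z) \<in> {?l..?b}" for z using lb by auto
  have vc: "continuous_on UNIV (v i)" if "i \<in> {1, 2}" for i
    unfolding v_def using clamp by (intro continuous_on_compose2[OF wc[OF that]] continuous_intros) auto
  have bdd: "\<exists>B. \<forall>y\<in>{?l..?b}. \<bar>w i y\<bar> \<le> B" if "i \<in> {1, 2}" for i
    using compact_imp_bounded[OF compact_continuous_image[OF wc[OF that]]] unfolding bounded_iff by auto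
  obtain B1 where B1: "\<forall>y\<in>{?l..?b}. \<bar>w 1 y\<bar> \<le> B1" using bdd[of 1] by auto
  obtain B2 where B2: "\<forall>y\<in>{?l..?b}. \<bar>w 2 y\<bar> \<le> B2" using bdd[of 2] by auto
  define M where "M = max B1 B2"
  have vM: "\<bar>v i z\<bar> \<le> M" if "i \<in> {1, 2}" for i z
    using that B1[rule_format, OF clamp, of z] B2[rule_format, OF clamp, of z]
    by (auto simp: v_def M_def le_max_iff_disj)
  interpret C: hjb_candidate P v "w0_cap P w" M
  proof
    show "0 \<le> hjb_op P j \<phi> x" if "j \<in> {1, 2}" "x \<in> {?l<..<?b}" "C1_on ?l ?b \<phi>" "\<phi> x = v j x"
      "\<And>y. y \<in> {?l..?b} \<Longrightarrow> v j y \<le> \<phi> y" for j x \<phi>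
      using touch[of j "3 - j" x \<phi>] that by (auto simp: vw)
    show "(disc P + lam P) * w0_cap P w = running P 0 (wbar P v) (cap P)"
      by (rule w0_cap_running[OF vc vM]) (auto simp: vw)
  qed (use vc vM obstacle boundary lb in \<open>auto simp: vw\<close>)
  have lower: "ennreal (C.val i x) \<le> opt_cost P i x"
    if "i \<in> {1, 2} \<and> x \<in> {?l..<?b} \<or> i = 0 \<and> x = ?b" "0 \<le> C.val i x" for i x
    unfolding opt_cost_def
  proof (rule INF_greatest)
    fix S assume "S \<in> admissible P x i"
    then interpret V: hjb_verification P v "w0_cap P w" M S x i
      using that(1) by unfold_locales auto
    show "ennreal (C.val i x) \<le> cost P x S" by (rule V.val_le_cost[OF that(2)])
  qed
  have eq: "opt_cost P i x = ennreal (w i x)" if "i \<in> {1, 2}" "x \<in> {?l..<?b}" for i x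
  proof (rule antisym[OF V_le[OF that]])
    have "C.val i x = w i x" using that by (auto simp: C.val_def vw)
    then show "ennreal (w i x) \<le> opt_cost P i x" using lower[of i x] w_nonneg[of i x] that by auto
  qed
  have upper: "opt_cost P 0 ?b + ennreal (min (swc P i 0) (swc P i (3 - i) + swc P (3 - i) 0)) \<le> ennreal (w i ?b)"
    if "i \<in> {1, 2}" for i
    using that X by (intro full_cost_limit[OF that X Xlim _ _ wlim[OF that], of "\<lambda>n. strat i (X n)"]) (auto intro: adm cost_w)
  have "opt_cost P 0 ?b \<le> ennreal (w 1 ?b)"
    by (rule order_trans[OF _ upper[of 1]]) auto
  then have "opt_cost P 0 ?b < \<infinity>" using le_less_trans[OF _ ennreal_less_top] by simp
  then obtain V0 where V0: "opt_cost P 0 ?b = ennreal V0" "0 \<le> V0" by (cases "opt_cost P 0 ?b") auto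
  have K: "0 \<le> swc P 1 0" "0 \<le> swc P 2 0" "0 \<le> swc P 1 2" "0 \<le> swc P 2 1"
    by (auto intro!: swc_nonneg)
  have "V0 + min (swc P 1 0) (swc P 1 2 + swc P 2 0) \<le> w 1 ?b" "V0 + min (swc P 2 0) (swc P 2 1 + swc P 1 0) \<le> w 2 ?b"
    using upper[of 1] upper[of 2] V0 K w_nonneg[of 1 ?b] w_nonneg[of 2 ?b] lb
    by (simp_all add: ennreal_le_iff flip: ennreal_plus)
  moreover have "w 1 ?b \<le> w 2 ?b + swc P 1 2" using obstacle[of 1 2 ?b] lb by simp
  \<comment> \<open>If the minimum for phase 1 is \<open>swc P 1 0\<close>, the boundary condition
    of phase 1 cancels it. Otherwise \<open>swc P 1 2\<close> cancels against the obstacle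
    inequality and \<open>swc P 2 0\<close> against the boundary condition of phase 2.\<close>
  ultimately have le: "V0 \<le> w0_cap P w" using boundary by (auto simp: min_def split: if_splits)
  have "opt_cost P 0 ?b = ennreal (w0_cap P w)"
  proof (rule antisym)
    show "opt_cost P 0 ?b \<le> ennreal (w0_cap P w)" using le V0 by (simp add: ennreal_leI)
    \<comment> \<open>The lower bound requires a nonnegative candidate; this follows from the upper
      bound, as \<open>V0\<close> is nonnegative.\<close>
    show "ennreal (w0_cap P w) \<le> opt_cost P 0 ?b"
      using lower[of 0 ?b] le V0 by (simp add: C.val_def)
  qed
  then show ?thesis using eq by blast
qed

end
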